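(* Let $\mathbf{A}$ be a finite set, $H$ and $H'$ finite-dimensional complex Hilbert spaces, $\theta=\{1,\ldots,T\}$ a finite set, and let $\{(W_t,V_t): t\in\theta\}$ be an arbitrarily varying classical-quantum wiretap channel, where $W_t: P(\mathbf{A})\to\mathcal{S}(H)$ is the channel to the legitimate receiver and $V_t: P(\mathbf{A})\to\mathcal{S}(H')$ is the channel to the wiretapper. Let $C_s(\{(W_t,V_t): t\in\theta\})$, $C_s(\{(W_t,V_t): t\in\theta\};r)$ and $C_s(\{(W_t,V_t): t\in\theta\};cr)$ denote its deterministic, randomness-assisted and common randomness-assisted secrecy capacities. Then: 1. (a) If the arbitrarily varying classical-quantum channel $\{W_t: t\in\theta\}$ is not symmetrizable, then $$C_s(\{(W_t,V_t): t\in\theta\})=C_s(\{(W_t,V_t): t\in\theta\};r).$$ (b) If $\{W_t: t\in\theta\}$ is symmetrizable, then $$C_s(\{(W_t,V_t): t\in\theta\})=0.$$ 2. $$C_s(\{(W_t,V_t): t\in\theta\};cr)=C_s(\{(W_t,V_t): t\in\theta\};r).$$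
   Context: Notation. All logarithms are to base 2. For a finite set $\mathbf{A}$, $P(\mathbf{A})$ is the set of probability distributions on $\mathbf{A}$. For a finite-dimensional complex Hilbert space $H$, $\mathcal{S}(H)$ is the set of density operators on $H$. A classical-quantum channel is a linear (i.e. convex-combination preserving) map $W:P(\mathbf{A})\to\mathcal{S}(H)$; $W(a)$ denotes the value at the point mass at $a\in\mathbf{A}$, so $W(P)=\sum_a P(a)W(a)$. For a family $\{W_t:t\in\theta\}$ of such channels and $t^n=(t_1,\ldots,t_n)\in\theta^n$, $W_{t^n}:P(\mathbf{A}^n)\to\mathcal{S}(H^{\otimes n})$ is the linear map with $W_{t^n}(a^n)=W_{t_1}(a_1)\otimes\cdots\otimes W_{t_n}(a_n)$ for $a^n=(a_1,\ldots,a_n)\in\mathbf{A}^n$; similarly $V_{t^n}$. von Neumann entropy: $S(\rho)=-\mathrm{tr}(\rho\log\rho)$. For a finite set of states $\Phi=\{\rho_x:x\in\mathbf{B}\}$ labeled by $\mathbf{B}$ and $Q\in P(\mathbf{B})$, the Holevo quantity is $\chi(Q;\Phi)=S\bigl(\sum_x Q(x)\rho_x\bigr)-\sum_x Q(x)S(\rho_x)$. Channels. A finite set $\{W_t:t\in\theta\}$ of classical-quantum channels $P(\mathbf{A})\to\mathcal{S}(H)$ is called an arbitrarily varying classical-quantum channel. It is symmetrizable if there is a family of probability distributions $\{\tau(\cdot\mid a):a\in\mathbf{A}\}$ on $\theta$ such that for all $a,a'\in\mathbf{A}$: $\sum_{t\in\theta}\tau(t\mid a)W_t(a')=\sum_{t\in\theta}\tau(t\mid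 a')W_t(a)$. A finite set of pairs $\{(W_t,V_t):t\in\theta\}$ of classical-quantum channels $W_t:P(\mathbf{A})\to\mathcal{S}(H)$, $V_t:P(\mathbf{A})\to\mathcal{S}(H')$ is called an arbitrarily varying classical-quantum wiretap channel. Codes. For positive integers $n,J_n$, an $(n,J_n)$ (deterministic) code $\mathcal{C}=(E,\{D_j:j=1,\ldots,J_n\})$ consists of a stochastic encoder $E:\{1,\ldots,J_n\}\to P(\mathbf{A}^n)$, $j\mapsto E(\cdot|j)$, and positive semi-definite operators $D_1,\ldots,D_{J_n}$ on $H^{\otimes n}$ with $\sum_{j}D_j=\mathrm{id}_{H^{\otimes n}}$. For $t^n\in\theta^n$ put $$P_e(\mathcal{C},t^n)=1-\frac1{J_n}\sum_{j=1}^{J_n}\mathrm{tr}\bigl(W_{t^n}(E(\cdot|j))D_j\bigr),\qquad Z_{\mathcal{C},t^n}=\{V_{t^n}(E(\cdot|j)):j\in\{1,\ldots,J_n\}\}.$$ $R_{\mathrm{uni}}$ is the uniform distribution on $\{1,\ldots,J_n\}$. Deterministic secrecy capacity. $R\ge0$ is an achievable (deterministic) secrecy rate if for every $\epsilon,\delta,\zeta>0$ and all sufficiently large $n$ there is an $(n,J_n)$ code $\mathcal{C}$ with $\frac{\log J_n}{n}>R-\delta$, $\max_{t^n\in\theta^n}P_e(\mathcal{C},t^n)<\epsilon$ and $\max_{t^n\in\theta^n}\chi(R_{\mathrm{uni}};Z_{\mathcal{C},t^n})<\zeta$. $C_s(\{(W_t,V_t):t\in\theta\})$ is the supremum of all such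 rates. Randomness-assisted secrecy capacity. Let $\{\mathcal{C}^\gamma:\gamma\in\Lambda\}$ be the set of $(n,J_n)$ deterministic codes, labeled by a set $\Lambda$. An $(n,J_n)$ randomness-assisted code is a probability distribution $G$ on $(\Lambda,\sigma)$, where $\sigma$ is a sigma-algebra such that for every $t^n\in\theta^n$ the functions $\gamma\mapsto P_e(\mathcal{C}^\gamma,t^n)$ and $\gamma\mapsto\chi(R_{\mathrm{uni}};Z_{\mathcal{C}^\gamma,t^n})$ are measurable. $R\ge0$ is achievable under randomness-assisted coding if for every $\epsilon,\delta,\zeta>0$ and all sufficiently large $n$ there is an $(n,J_n)$ randomness-assisted code with $\frac{\log J_n}{n}>R-\delta$, $\max_{t^n}\int_\Lambda P_e(\mathcal{C}^\gamma,t^n)\,dG(\gamma)<\epsilon$ and $\max_{t^n}\int_\Lambda\chi(R_{\mathrm{uni}};Z_{\mathcal{C}^\gamma,t^n})\,dG(\gamma)<\zeta$. $C_s(\{(W_t,V_t):t\in\theta\};r)$ is the supremum of all such rates. Common randomness-assisted secrecy capacity. An $(n,J_n)$ common randomness-assisted code is a finite (nonempty) subset $\{\mathcal{C}^\gamma:\gamma\in\Gamma\}$ of the set of $(n,J_n)$ deterministic codes, labeled by a finite set $\Gamma$. $R\ge0$ is achievable under common randomness-assisted coding if for every $\epsilon,\delta,\zeta>0$ and all sufficiently large $n$ there is an $(n,J_n)$ common randomness-assisted code with $\frac{\log J_n}{n}>R-\delta$, $\max_{t^n}\frac1{|\Gamma|}\sum_{\gamma\in\Gamma}P_e(\mathcal{C}^\gamma,t^n)<\epsilon$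 and $\max_{t^n}\frac1{|\Gamma|}\sum_{\gamma\in\Gamma}\chi(R_{\mathrm{uni}};Z_{\mathcal{C}^\gamma,t^n})<\zeta$. $C_s(\{(W_t,V_t):t\in\theta\};cr)$ is the supremum of all such rates. *)

theory Defs
  imports "HOL-Probability.Probability" "Jordan_Normal_Form.Schur_Decomposition"
begin

text \<open>
  A Hilbert space of dimension \<open>d\<close> is represented by \<open>d\<close>-dimensional complex coordinate space and
  its operators by complex \<open>d\<close> by \<open>d\<close> matrices. Probability distributions are of type \<open>'a pmf\<close>.
\<close>

hide_const (open) Finite_Cartesian_Product.vec Finite_Cartesian_Product.mat
  Finite_Cartesian_Product.row Finite_Cartesian_Product.transpose

section \<open>Operators and states\<close>

definition mat_trace :: "complex mat \<Rightarrow> complex" where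
  "mat_trace A = (\<Sum>i<dim_row A. A $$ (i, i))"

definition mat_sum :: "nat \<Rightarrow> 'x set \<Rightarrow> ('x \<Rightarrow> complex mat) \<Rightarrow> complex mat" where
  "mat_sum d X F = mat d d (\<lambda>(i, j). \<Sum>x\<in>X. F x $$ (i, j))"

text \<open>\<open>0 \<le> z\<close> is the order of \<open>HOL-Library.Complex_Order\<close>: \<open>z\<close> is real and nonnegative.\<close>

definition positive_semidef :: "nat \<Rightarrow> complex mat \<Rightarrow> bool" where
  "positive_semidef d A \<longleftrightarrow>
     A \<in> carrier_mat d d \<and> (\<forall>v\<in>carrier_vec d. 0 \<le> (A *\<^sub>v v) \<bullet>c v)"

definition density_operators :: "nat \<Rightarrow> complex mat set" where
  "density_operators d = {\<rho>. positive_semidef d \<rho> \<and> mat_trace \<rho> = 1}"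

text \<open>The Kronecker product; basis vectors of the product space are ordered lexicographically.\<close>

definition tensor_mat :: "complex mat \<Rightarrow> complex mat \<Rightarrow> complex mat" where
  "tensor_mat A B =
     mat (dim_row A * dim_row B) (dim_col A * dim_col B)
       (\<lambda>(i, j). A $$ (i div dim_row B, j div dim_col B) * B $$ (i mod dim_row B, j mod dim_col B))"

definition tensor_list :: "complex mat list \<Rightarrow> complex mat" where
  "tensor_list As = foldr tensor_mat As (1\<^sub>m 1)"

section \<open>Entropy and Holevo quantity\<close>

definition unitary_mat :: "nat \<Rightarrow> complex mat \<Rightarrow> bool" where
  "unitary_mat d U \<longleftrightarrow>
     U \<in> carrier_mat d d \<and> U * mat_adjoint U = 1\<^sub>m d \<and> mat_adjoint U * U = 1\<^sub>m d"

text \<open>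
  Functional calculus of a Hermitian matrix: the result does not depend on the choice of the
  diagonalisation.
\<close>

definition mat_fun :: "(real \<Rightarrow> real) \<Rightarrow> complex mat \<Rightarrow> complex mat" where
  "mat_fun f A = (SOME B. \<exists>U l. unitary_mat (dim_row A) U \<and>
     A = U * mat_diag (dim_row A) (\<lambda>i. complex_of_real (l i)) * mat_adjoint U \<and>
     B = U * mat_diag (dim_row A) (\<lambda>i. complex_of_real (f (l i))) * mat_adjoint U)"

text \<open>As \<open>log 2 0 = 0\<close> in HOL, a zero eigenvalue contributes \<open>0\<close> to the trace.\<close>

definition von_neumann_entropy :: "complex mat \<Rightarrow> real" where
  "von_neumann_entropy \<rho> = - Re (mat_trace (\<rho> * mat_fun (log 2) \<rho>))"

text \<open>
  The sums below run over the support of the distribution, which is finite in all uses.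
\<close>

definition mixture :: "nat \<Rightarrow> 'x pmf \<Rightarrow> ('x \<Rightarrow> complex mat) \<Rightarrow> complex mat" where
  "mixture d Q \<rho> = mat_sum d (set_pmf Q) (\<lambda>x. complex_of_real (pmf Q x) \<cdot>\<^sub>m \<rho> x)"

definition holevo :: "nat \<Rightarrow> 'x pmf \<Rightarrow> ('x \<Rightarrow> complex mat) \<Rightarrow> real" where
  "holevo d Q \<rho> =
     von_neumann_entropy (mixture d Q \<rho>) - (\<Sum>x\<in>set_pmf Q. pmf Q x * von_neumann_entropy (\<rho> x))"

section \<open>Channels\<close>

definition cq_channel :: "nat \<Rightarrow> ('a::finite pmf \<Rightarrow> complex mat) \<Rightarrow> bool" where
  "cq_channel d W \<longleftrightarrow>
     (\<forall>P. W P \<in> density_operators d) \<and>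
     (\<forall>P Q R. \<forall>c::real. 0 \<le> c \<and> c \<le> 1 \<and> (\<forall>a. pmf R a = c * pmf P a + (1 - c) * pmf Q a) \<longrightarrow>
        W R = complex_of_real c \<cdot>\<^sub>m W P + complex_of_real (1 - c) \<cdot>\<^sub>m W Q)"

abbreviation at_letter :: "('a pmf \<Rightarrow> complex mat) \<Rightarrow> 'a \<Rightarrow> complex mat" where
  "at_letter W a \<equiv> W (return_pmf a)"

definition av_wiretap_channel ::
  "nat \<Rightarrow> nat \<Rightarrow> 't set \<Rightarrow> ('t \<Rightarrow> 'a::finite pmf \<Rightarrow> complex mat) \<Rightarrow>
   ('t \<Rightarrow> 'a pmf \<Rightarrow> complex mat) \<Rightarrow> bool" where
  "av_wiretap_channel d d' \<theta> W V \<longleftrightarrow>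
     finite \<theta> \<and> (\<forall>t\<in>\<theta>. cq_channel d (W t) \<and> cq_channel d' (V t))"

definition symmetrizable ::
  "nat \<Rightarrow> 't set \<Rightarrow> ('t \<Rightarrow> 'a::finite pmf \<Rightarrow> complex mat) \<Rightarrow> bool" where
  "symmetrizable d \<theta> W \<longleftrightarrow>
     (\<exists>\<tau> :: 'a \<Rightarrow> 't pmf. (\<forall>a. set_pmf (\<tau> a) \<subseteq> \<theta>) \<and>
        (\<forall>a a'. mixture d (\<tau> a) (\<lambda>t. at_letter (W t) a') =
                mixture d (\<tau> a') (\<lambda>t. at_letter (W t) a)))"

definition words :: "'x set \<Rightarrow> nat \<Rightarrow> 'x list set" where
  "words X n = {xs. set xs \<subseteq> X \<and> length xs = n}"

text \<open>
  The extension of a channel family along \<open>ts = t\<^sup>n\<close>, applied to a distribution on words of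
  length \<open>n\<close>.
\<close>

definition channel_ext ::
  "nat \<Rightarrow> ('t \<Rightarrow> 'a::finite pmf \<Rightarrow> complex mat) \<Rightarrow> 't list \<Rightarrow> 'a list pmf \<Rightarrow> complex mat" where
  "channel_ext d W ts P =
     mixture (d ^ length ts) P (\<lambda>as. tensor_list (map2 (\<lambda>t a. at_letter (W t) a) ts as))"

section \<open>Codes\<close>

type_synonym 'a code = "(nat \<Rightarrow> 'a list pmf) \<times> (nat \<Rightarrow> complex mat)"

text \<open>
  The extensional function space \<open>PiE\<close> makes encoder and decoder determined by their values on
  the messages \<open>1, \<dots>, J\<close>, so that distinct elements of \<open>codes d n J\<close> are distinct codes.
\<close>

definition codes :: "nat \<Rightarrow> nat \<Rightarrow> nat \<Rightarrow> 'a::finite code set" where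
  "codes d n J = {(E, D).
     E \<in> {1..J} \<rightarrow>\<^sub>E {P. set_pmf P \<subseteq> words UNIV n} \<and>
     D \<in> {1..J} \<rightarrow>\<^sub>E {A. positive_semidef (d ^ n) A} \<and>
     mat_sum (d ^ n) {1..J} D = 1\<^sub>m (d ^ n)}"

definition error_prob ::
  "nat \<Rightarrow> ('t \<Rightarrow> 'a::finite pmf \<Rightarrow> complex mat) \<Rightarrow> nat \<Rightarrow> 'a code \<Rightarrow> 't list \<Rightarrow> real" where
  "error_prob d W J C ts =
     1 - 1 / real J * (\<Sum>j=1..J. Re (mat_trace (channel_ext d W ts (fst C j) * snd C j)))"

definition leakage ::
  "nat \<Rightarrow> ('t \<Rightarrow> 'a::finite pmf \<Rightarrow> complex mat) \<Rightarrow> nat \<Rightarrow> 'a code \<Rightarrow> 't list \<Rightarrow> real" where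
  "leakage d' V J C ts =
     holevo (d' ^ length ts) (pmf_of_set {1..J}) (\<lambda>j. channel_ext d' V ts (fst C j))"

section \<open>Secrecy capacities\<close>

definition achievable ::
  "nat \<Rightarrow> nat \<Rightarrow> 't set \<Rightarrow> ('t \<Rightarrow> 'a::finite pmf \<Rightarrow> complex mat) \<Rightarrow>
   ('t \<Rightarrow> 'a pmf \<Rightarrow> complex mat) \<Rightarrow> real \<Rightarrow> bool" where
  "achievable d d' \<theta> W V R \<longleftrightarrow> 0 \<le> R \<and>
     (\<forall>\<epsilon>>0. \<forall>\<delta>>0. \<forall>\<zeta>>0. \<forall>\<^sub>F n in sequentially. \<exists>J\<ge>1. \<exists>C\<in>codes d n J.
        log 2 (real J) / real n > R - \<delta> \<and>
        Max ((\<lambda>ts. error_prob d W J C ts) ` words \<theta> n) < \<epsilon> \<and>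
        Max ((\<lambda>ts. leakage d' V J C ts) ` words \<theta> n) < \<zeta>)"

text \<open>The label set of the deterministic codes is the set of codes itself.\<close>

definition random_code ::
  "nat \<Rightarrow> nat \<Rightarrow> 't set \<Rightarrow> ('t \<Rightarrow> 'a::finite pmf \<Rightarrow> complex mat) \<Rightarrow>
   ('t \<Rightarrow> 'a pmf \<Rightarrow> complex mat) \<Rightarrow> nat \<Rightarrow> nat \<Rightarrow> 'a code measure \<Rightarrow> bool" where
  "random_code d d' \<theta> W V n J G \<longleftrightarrow>
     prob_space G \<and> space G = codes d n J \<and>
     (\<forall>ts\<in>words \<theta> n.
        (\<lambda>C. error_prob d W J C ts) \<in> borel_measurable G \<and>
        (\<lambda>C. leakage d' V J C ts) \<in> borel_measurable G)"

definition achievable_r ::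
  "nat \<Rightarrow> nat \<Rightarrow> 't set \<Rightarrow> ('t \<Rightarrow> 'a::finite pmf \<Rightarrow> complex mat) \<Rightarrow>
   ('t \<Rightarrow> 'a pmf \<Rightarrow> complex mat) \<Rightarrow> real \<Rightarrow> bool" where
  "achievable_r d d' \<theta> W V R \<longleftrightarrow> 0 \<le> R \<and>
     (\<forall>\<epsilon>>0. \<forall>\<delta>>0. \<forall>\<zeta>>0. \<forall>\<^sub>F n in sequentially. \<exists>J\<ge>1. \<exists>G.
        random_code d d' \<theta> W V n J G \<and>
        log 2 (real J) / real n > R - \<delta> \<and>
        Max ((\<lambda>ts. \<integral>C. error_prob d W J C ts \<partial>G) ` words \<theta> n) < \<epsilon> \<and>
        Max ((\<lambda>ts. \<integral>C. leakage d' V J C ts \<partial>G) ` words \<theta> n) < \<zeta>)"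

definition achievable_cr ::
  "nat \<Rightarrow> nat \<Rightarrow> 't set \<Rightarrow> ('t \<Rightarrow> 'a::finite pmf \<Rightarrow> complex mat) \<Rightarrow>
   ('t \<Rightarrow> 'a pmf \<Rightarrow> complex mat) \<Rightarrow> real \<Rightarrow> bool" where
  "achievable_cr d d' \<theta> W V R \<longleftrightarrow> 0 \<le> R \<and>
     (\<forall>\<epsilon>>0. \<forall>\<delta>>0. \<forall>\<zeta>>0. \<forall>\<^sub>F n in sequentially. \<exists>J\<ge>1. \<exists>\<Gamma>.
        finite \<Gamma> \<and> \<Gamma> \<noteq> {} \<and> \<Gamma> \<subseteq> codes d n J \<and>
        log 2 (real J) / real n > R - \<delta> \<and>
        Max ((\<lambda>ts. 1 / real (card \<Gamma>) * (\<Sum>C\<in>\<Gamma>. error_prob d W J C ts)) ` words \<theta> n) < \<epsilon> \<and>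
        Max ((\<lambda>ts. 1 / real (card \<Gamma>) * (\<Sum>C\<in>\<Gamma>. leakage d' V J C ts)) ` words \<theta> n) < \<zeta>)"

text \<open>Suprema are taken in \<open>ereal\<close>, where they exist without a boundedness side condition.\<close>

definition secrecy_capacity ::
  "nat \<Rightarrow> nat \<Rightarrow> 't set \<Rightarrow> ('t \<Rightarrow> 'a::finite pmf \<Rightarrow> complex mat) \<Rightarrow>
   ('t \<Rightarrow> 'a pmf \<Rightarrow> complex mat) \<Rightarrow> ereal" where
  "secrecy_capacity d d' \<theta> W V = Sup (ereal ` {R. achievable d d' \<theta> W V R})"

definition secrecy_capacity_r ::
  "nat \<Rightarrow> nat \<Rightarrow> 't set \<Rightarrow> ('t \<Rightarrow> 'a::finite pmf \<Rightarrow> complex mat) \<Rightarrow>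
   ('t \<Rightarrow> 'a pmf \<Rightarrow> complex mat) \<Rightarrow> ereal" where
  "secrecy_capacity_r d d' \<theta> W V = Sup (ereal ` {R. achievable_r d d' \<theta> W V R})"

definition secrecy_capacity_cr ::
  "nat \<Rightarrow> nat \<Rightarrow> 't set \<Rightarrow> ('t \<Rightarrow> 'a::finite pmf \<Rightarrow> complex mat) \<Rightarrow>
   ('t \<Rightarrow> 'a pmf \<Rightarrow> complex mat) \<Rightarrow> ereal" where
  "secrecy_capacity_cr d d' \<theta> W V = Sup (ereal ` {R. achievable_cr d d' \<theta> W V R})"

end

theory Submission
  imports Defs "HOL-Real_Asymp.Real_Asymp"
begin

text \<open>
  A random code is replaced by a short list of codes \<open>C\<^sub>1, \<dots>, C\<^sub>N\<close>: exponential moments show that a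
  number \<open>N\<close> polynomial in the block length suffices to keep the average error probability and the
  average leakage small for all state sequences at once. For common randomness it remains to make
  these codes distinct, which a small change of the decoders achieves.

  For deterministic codes the sender draws \<open>i\<close> uniformly and announces it by a prefix. Neither the
  prefix nor the draw depends on the message, and the Holevo quantity is convex in the states and
  unchanged by a constant tensor factor, so the leakage of the concatenated code is at most the
  average leakage of the \<open>C\<^sub>i\<close>. Convexity of the Holevo quantity is joint convexity of the relative
  entropy, proved from an integral representation whose integrand is a maximum of affine functions.

  The prefix code exists for every nonsymmetrizable channel. Applying a fixed informationally
  complete measurement to every output yields a classical arbitrarily varying channel that is again not
  symmetrizable. There the decoder chooses the codeword \<open>x\<close> such that for every other codeword \<open>x'\<close>
  the joint type of \<open>x\<close>, \<open>x'\<close> and the output can be explained by states that depend on \<open>x'\<close> only; two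
  codewords with this property would give a symmetrizing family, by averaging and compactness.
\<close>

text \<open>The size of the sample shapes the construction. The error probability lies between
  \<open>0\<close> and \<open>1\<close>, but the leakage at block length \<open>m\<close> is only
  bounded by \<open>m * log 2 d'\<close>, so the sample mean has to be accurate to order
  \<open>1 / m\<close>. A union bound over the \<open>card \<theta> ^ m\<close> state sequences then
  asks for about \<open>m ^ 3\<close> codes, and the fourth power of the prefix length leaves room.
  Naming one of polynomially many codes takes vanishing rate, so a prefix code of rate zero will do:
  no capacity formula enters, and achievable rates are carried over one by one. The prefix error is
  needed only on average over the index. Hence one codebook can serve exponentially many state
  sequences, provided that each of them spoils few codewords. The wiretapper may learn the index
  completely. This does no harm, because the index is independent of the message, and convexity
  covers every degree of such knowledge. For common randomness the obstacle is that a set of codes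
  carries uniform weights, so a code that is sampled twice would be counted once.\<close>

unbundle no vec_syntax and no inner_syntax

section \<open>Adjoint, trace and positive semidefinite matrices\<close>

lemma mat_adjoint_dim [simp]: "dim_row (mat_adjoint A) = dim_col A" "dim_col (mat_adjoint A) = dim_row A"
  by (auto simp: mat_adjoint_def)

lemma mat_adjoint_index [simp]:
  fixes A :: "complex mat"
  shows "i < dim_col A \<Longrightarrow> j < dim_row A \<Longrightarrow> mat_adjoint A $$ (i, j) = cnj (A $$ (j, i))"
  by (auto simp: mat_adjoint_def mat_of_rows_def col_def)

lemma mat_adjoint_carrier [simp]: "A \<in> carrier_mat n m \<Longrightarrow> mat_adjoint A \<in> carrier_mat m n"
  by (auto intro: carrier_matI)

lemma mat_adjoint_adjoint [simp]: "mat_adjoint (mat_adjoint A) = (A :: complex mat)"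
  by (rule eq_matI) auto

lemma mult_mat_index:
  fixes A B :: "complex mat"
  assumes "A \<in> carrier_mat n m" "B \<in> carrier_mat m k" "i < n" "j < k"
  shows "(A * B) $$ (i, j) = (\<Sum>l<m. A $$ (i, l) * B $$ (l, j))"
  using assms by (auto simp: scalar_prod_def lessThan_atLeast0 intro!: sum.cong)

declare index_mult_mat(1) [simp del]

lemma mat_adjoint_mult:
  fixes A B :: "complex mat"
  assumes "A \<in> carrier_mat n m" "B \<in> carrier_mat m k"
  shows "mat_adjoint (A * B) = mat_adjoint B * mat_adjoint A"
proof (rule eq_matI)
  fix i j assume "i < dim_row (mat_adjoint B * mat_adjoint A)" "j < dim_col (mat_adjoint B * mat_adjoint A)"
  then have ij: "i < k" "j < n" using assms by auto
  have "mat_adjoint (A * B) $$ (i, j) = cnj ((A * B) $$ (j, i))"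
    using ij assms by auto
  also have "\<dots> = (\<Sum>l<m. cnj (A $$ (j, l)) * cnj (B $$ (l, i)))"
    using ij assms by (simp add: mult_mat_index[OF assms])
  also have "\<dots> = (mat_adjoint B * mat_adjoint A) $$ (i, j)"
    using assms ij
    by (subst mult_mat_index[where n = k and m = m and k = n]) (auto intro!: sum.cong)
  finally show "mat_adjoint (A * B) $$ (i, j) = (mat_adjoint B * mat_adjoint A) $$ (i, j)" .
qed (use assms in auto)

lemma mat_adjoint_diag [simp]:
  "mat_adjoint (mat_diag d (\<lambda>i. complex_of_real (l i))) = mat_diag d (\<lambda>i. complex_of_real (l i))"
  by (rule eq_matI) (auto simp: mat_diag_def)

lemma square_mult_carrier [simp]:
  "A \<in> carrier_mat d d \<Longrightarrow> B \<in> carrier_mat d d \<Longrightarrow> A * B \<in> carrier_mat d d"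
  by (rule mult_carrier_mat)

lemma square_mult_assoc:
  fixes A B C :: "complex mat"
  assumes "A \<in> carrier_mat d d" "B \<in> carrier_mat d d" "C \<in> carrier_mat d d"
  shows "A * B * C = A * (B * C)"
  using assms by (rule assoc_mult_mat)

lemma mat_trace_mult:
  assumes "A \<in> carrier_mat n m" "B \<in> carrier_mat m n"
  shows "mat_trace (A * B) = (\<Sum>i<n. \<Sum>j<m. A $$ (i, j) * B $$ (j, i))"
  using assms unfolding mat_trace_def by (auto simp: mult_mat_index[OF assms] intro!: sum.cong)

lemma mat_trace_comm:
  assumes "A \<in> carrier_mat n m" "B \<in> carrier_mat m n"
  shows "mat_trace (A * B) = mat_trace (B * A)"
  unfolding mat_trace_mult[OF assms] mat_trace_mult[OF assms(2,1)]
  by (subst sum.swap) (simp add: mult.commute)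

lemma quadratic_form:
  fixes A :: "complex mat"
  assumes "A \<in> carrier_mat d d" "v \<in> carrier_vec d"
  shows "(A *\<^sub>v v) \<bullet>c v = (\<Sum>i<d. \<Sum>j<d. A $$ (i, j) * v $ j * cnj (v $ i))"
proof -
  have "(A *\<^sub>v v) \<bullet>c v = (\<Sum>i<d. (A *\<^sub>v v) $ i * cnj (v $ i))"
    using assms by (auto simp: scalar_prod_def lessThan_atLeast0 intro!: sum.cong)
  also have "\<dots> = (\<Sum>i<d. (\<Sum>j<d. A $$ (i, j) * v $ j) * cnj (v $ i))"
    using assms by (intro sum.cong refl) (auto simp: scalar_prod_def lessThan_atLeast0 intro!: sum.cong)
  finally show ?thesis by (simp add: sum_distrib_right)
qed

text \<open>The Hermitian form of \<open>A\<close>, taken on functions instead of vectors: test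
  vectors can be given by a formula, and no carrier condition has to be checked for them.\<close>

definition quad :: "nat \<Rightarrow> complex mat \<Rightarrow> (nat \<Rightarrow> complex) \<Rightarrow> complex" where
  "quad d A f = (\<Sum>i<d. \<Sum>j<d. cnj (f i) * A $$ (i, j) * f j)"

lemma positive_semidef_iff_quad:
  "positive_semidef d A \<longleftrightarrow> A \<in> carrier_mat d d \<and> (\<forall>f. 0 \<le> quad d A f)"
proof (cases "A \<in> carrier_mat d d")
  case True
  have "(\<forall>v\<in>carrier_vec d. 0 \<le> (A *\<^sub>v v) \<bullet>c v) \<longleftrightarrow> (\<forall>f. 0 \<le> quad d A f)"
  proof (intro iffI allI ballI)
    fix v :: "complex vec" assume *: "\<forall>f. 0 \<le> quad d A f" "v \<in> carrier_vec d"
    have "(A *\<^sub>v v) \<bullet>c v = quad d A (\<lambda>i. v $ i)"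
      unfolding quadratic_form[OF True *(2)] quad_def by (simp add: mult_ac)
    with * show "0 \<le> (A *\<^sub>v v) \<bullet>c v" by simp
  next
    fix f :: "nat \<Rightarrow> complex" assume *: "\<forall>v\<in>carrier_vec d. 0 \<le> (A *\<^sub>v v) \<bullet>c v"
    let ?v = "Matrix.vec d f"
    have "(A *\<^sub>v ?v) \<bullet>c ?v = quad d A f"
      using quadratic_form[OF True, of ?v] unfolding quad_def by (simp add: mult_ac)
    with * show "0 \<le> quad d A f" by (metis vec_carrier)
  qed
  then show ?thesis using True by (simp add: positive_semidef_def)
qed (simp add: positive_semidef_def)

lemma positive_semidef_carrier [simp]: "positive_semidef d A \<Longrightarrow> A \<in> carrier_mat d d"
  by (simp add: positive_semidef_def)

lemma positive_semidef_quad: "positive_semidef d A \<Longrightarrow> 0 \<le> quad d A f"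
  by (simp add: positive_semidef_iff_quad)

text \<open>The form at \<open>f\<close> is the squared norm of \<open>mat_adjoint X\<close> applied
  to \<open>f\<close>, whose coordinates are the conjugates of \<open>g l\<close>.\<close>

lemma positive_semidef_gram:
  assumes X: "X \<in> carrier_mat d m"
  shows "positive_semidef d (X * mat_adjoint X)"
  unfolding positive_semidef_iff_quad
proof (intro conjI allI)
  fix f
  define g where "g l = (\<Sum>i<d. cnj (f i) * X $$ (i, l))" for l
  have "quad d (X * mat_adjoint X) f
      = (\<Sum>i<d. \<Sum>j<d. \<Sum>l<m. cnj (f i) * X $$ (i, l) * (cnj (X $$ (j, l)) * f j))"
    unfolding quad_def using X
    by (intro sum.cong refl, subst mult_mat_index[where m = m])
      (auto simp: sum_distrib_left sum_distrib_right mult_ac intro!: sum.cong)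
  also have "\<dots> = (\<Sum>i<d. \<Sum>l<m. \<Sum>j<d. cnj (f i) * X $$ (i, l) * (cnj (X $$ (j, l)) * f j))"
    by (rule sum.cong[OF refl], rule sum.swap)
  also have "\<dots> = (\<Sum>l<m. \<Sum>i<d. \<Sum>j<d. cnj (f i) * X $$ (i, l) * (cnj (X $$ (j, l)) * f j))"
    by (rule sum.swap)
  also have "\<dots> = (\<Sum>l<m. g l * cnj (g l))"
    by (auto simp: g_def sum_product intro!: sum.cong)
  finally show "0 \<le> quad d (X * mat_adjoint X) f"
    by (simp only:) (rule sum_nonneg, simp add: less_eq_complex_def)
qed (use X in auto)

text \<open>In the sum over \<open>k\<close> the two diagonal entries carry the factor
  \<open>\<i> ^ k\<close> and the entry at \<open>(b, a)\<close> carries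
  \<open>\<i> ^ (2 * k)\<close>, so all three cancel, while the entry at \<open>(a, b)\<close>
  carries \<open>1\<close> four times. The case \<open>a = b\<close> is included.\<close>

lemma polarization:
  assumes "a < d" "b < d"
  shows "4 * A $$ (a, b) = (\<Sum>k<4. \<i> ^ k * quad d A (\<lambda>j. (if j = a then \<i> ^ k else 0) + (if j = b then 1 else 0)))"
proof -
  have q: "quad d A (\<lambda>j. (if j = a then c else 0) + (if j = b then 1 else 0))
     = cnj c * c * A $$ (a, a) + cnj c * A $$ (a, b) + c * A $$ (b, a) + A $$ (b, b)" for c
  proof -
    have s: "(\<Sum>j<d. h j * ((if j = a then c else 0) + (if j = b then 1 else 0))) = h a * c + h b"
      for h :: "nat \<Rightarrow> complex" and c
    proof -
      have "(\<Sum>j<d. h j * ((if j = a then c else 0) + (if j = b then 1 else 0)))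
        = (\<Sum>j<d. (if j = a then h j * c else 0) + (if j = b then h j else 0))"
        by (intro sum.cong) (auto simp: distrib_left)
      then show ?thesis using assms by (simp add: sum.distrib)
    qed
    have cnj: "cnj ((if i = a then c else 0) + (if i = b then 1 else 0))
      = (if i = a then cnj c else 0) + (if i = b then 1 else 0)" for i by simp
    have "quad d A (\<lambda>j. (if j = a then c else 0) + (if j = b then 1 else 0))
      = (\<Sum>i<d. cnj ((if i = a then c else 0) + (if i = b then 1 else 0)) * (A $$ (i, a) * c + A $$ (i, b)))"
      unfolding quad_def mult.assoc sum_distrib_left[symmetric] s ..
    also have "\<dots> = (\<Sum>i<d. (A $$ (i, a) * c + A $$ (i, b)) *
          ((if i = a then cnj c else 0) + (if i = b then 1 else 0)))"
      unfolding cnj by (simp only: mult.commute)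
    also have "\<dots> = (A $$ (a, a) * c + A $$ (a, b)) * cnj c + (A $$ (b, a) * c + A $$ (b, b))"
      by (rule s)
    finally show ?thesis by (simp add: algebra_simps)
  qed
  have "{..<4} = {0, 1, 2, 3::nat}" by auto
  then show ?thesis unfolding q
    by (simp add: algebra_simps power3_eq_cube power2_eq_square)
qed

text \<open>Only the reality of the form matters: it gives the matrix and its adjoint the same form,
  and polarization recovers the entries.\<close>

lemma positive_semidef_hermitian:
  assumes "positive_semidef d A"
  shows "mat_adjoint A = A"
proof (rule eq_matI)
  have A: "A \<in> carrier_mat d d" using assms by simp
  have adj: "mat_adjoint A \<in> carrier_mat d d" using A by simp
  have q: "quad d (mat_adjoint A) f = quad d A f" for f
  proof -
    have "quad d (mat_adjoint A) f = (\<Sum>i<d. \<Sum>j<d. cnj (cnj (f j) * A $$ (j, i) * f i))"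
      unfolding quad_def using A by (intro sum.cong refl) (auto simp: mult_ac)
    also have "\<dots> = cnj (quad d A f)"
      unfolding quad_def by (subst sum.swap) simp
    also have "\<dots> = quad d A f"
      using positive_semidef_quad[OF assms, of f]
      by (simp add: complex_eq_iff less_eq_complex_def)
    finally show ?thesis .
  qed
  fix i j assume "i < dim_row A" "j < dim_col A"
  then have "i < d" "j < d" using A by auto
  from polarization[OF this, of "mat_adjoint A"] polarization[OF this, of A]
  show "mat_adjoint A $$ (i, j) = A $$ (i, j)" unfolding q by (metis mult_cancel_left zero_neq_numeral)
qed (use assms[THEN positive_semidef_carrier] in auto)

text \<open>Cyclicity turns the trace into the sum of the values of the form of \<open>B\<close> at
  the columns of \<open>X\<close>.\<close>

lemma mat_trace_psd_mult_nonneg: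
  assumes X: "X \<in> carrier_mat d m" and B: "positive_semidef d B"
  shows "0 \<le> mat_trace (X * mat_adjoint X * B)"
proof -
  have "mat_trace (X * mat_adjoint X * B) = mat_trace (mat_adjoint X * (B * X))"
    using mat_trace_comm[of X d m "mat_adjoint X * B"] mat_trace_comm[of "mat_adjoint X * B" m d X]
      assoc_mult_mat[of X d m "mat_adjoint X" d B d] assoc_mult_mat[of "mat_adjoint X" m d B d X m]
      X positive_semidef_carrier[OF B]
      mult_carrier_mat[of "mat_adjoint X" m d B d] by simp
  also have "\<dots> = (\<Sum>i<m. quad d B (\<lambda>j. X $$ (j, i)))"
    using X B unfolding quad_def
    by (subst mat_trace_mult[where n = m and m = d]) 
      (auto simp: mult_mat_index[where n = d and m = d and k = m] mult_carrier_mat[where n = d and nc = m and nr = d] sum_distrib_left mult_ac intro!: sum.cong)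
  finally show ?thesis using positive_semidef_quad[OF B] by (simp add: sum_nonneg)
qed

section \<open>The spectral theorem\<close>

lemma unitary_mat_carrier [simp]: "unitary_mat d U \<Longrightarrow> U \<in> carrier_mat d d"
  by (simp add: unitary_mat_def)

lemma unitary_mat_dim [simp]: "unitary_mat d U \<Longrightarrow> dim_row U = d" "unitary_mat d U \<Longrightarrow> dim_col U = d"
  by (auto simp: unitary_mat_def)

lemma unitary_matI:
  assumes U: "U \<in> carrier_mat d d"
    and "\<And>i j. i < d \<Longrightarrow> j < d \<Longrightarrow> (\<Sum>k<d. U $$ (i, k) * cnj (U $$ (j, k))) = (if i = j then 1 else 0)"
  shows "unitary_mat d U"
proof -
  have 1: "U * mat_adjoint U = 1\<^sub>m d"
  proof (rule eq_matI)
    fix i j assume "i < dim_row (1\<^sub>m d :: complex mat)" "j < dim_col (1\<^sub>m d :: complex mat)"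
    then show "(U * mat_adjoint U) $$ (i, j) = 1\<^sub>m d $$ (i, j)"
      using assms by (subst mult_mat_index[where n = d and m = d and k = d]) auto
  qed (use U in auto)
  with mat_mult_left_right_inverse[OF U _ this] U show ?thesis
    by (simp add: unitary_mat_def)
qed

lemma unitary_mat_mult:
  assumes U: "unitary_mat d U" and V: "unitary_mat d V"
  shows "unitary_mat d (U * V)"
proof -
  note c = unitary_mat_carrier[OF U] unitary_mat_carrier[OF V]
  have "U * V * (mat_adjoint V * mat_adjoint U) = U * (V * mat_adjoint V) * mat_adjoint U"
    using c by (simp add: square_mult_assoc[where d = d])
  also have "\<dots> = 1\<^sub>m d" using U V c by (simp add: unitary_mat_def)
  finally have 1: "U * V * mat_adjoint (U * V) = 1\<^sub>m d"
    by (simp add: mat_adjoint_mult[OF c])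
  have UV: "U * V \<in> carrier_mat d d" using c by simp
  from mat_mult_left_right_inverse[OF UV _ 1] UV 1 show ?thesis
    by (simp add: unitary_mat_def)
qed

lemma unitary_mat_adjoint: "unitary_mat d U \<Longrightarrow> unitary_mat d (mat_adjoint U)"
  by (simp add: unitary_mat_def)

lemma diag_conj_index:
  assumes "U \<in> carrier_mat d d" "i < d" "j < d"
  shows "(U * mat_diag d (\<lambda>i. complex_of_real (l i)) * mat_adjoint U) $$ (i, j)
    = (\<Sum>k<d. U $$ (i, k) * of_real (l k) * cnj (U $$ (j, k)))"
  using assms
  by (subst mult_mat_index[where n = d and m = d and k = d])
    (auto simp: mat_diag_mult_right[where nr = d] intro!: sum.cong)

text \<open>A Householder reflection: \<open>c\<close> rotates \<open>v 0\<close> onto the negative real axis, so that the vector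
  \<open>c v\<close> differs from the first unit vector and the reflection exchanging the two exists.\<close>

lemma unitary_with_first_column:
  fixes v :: "nat \<Rightarrow> complex"
  assumes d: "0 < d" and v: "(\<Sum>i<d. v i * cnj (v i)) = 1"
  obtains U c where "unitary_mat d U" "\<And>i. i < d \<Longrightarrow> U $$ (i, 0) = c * v i"
proof -
  define c where "c = (if v 0 = 0 then 1 else - cnj (v 0) / of_real (cmod (v 0)))"
  define r where "r = - cmod (v 0)"
  define u where "u i = c * v i" for i
  define w where "w i = u i - (if i = 0 then 1 else 0)" for i
  \<comment> \<open>This is the identity minus twice the projection on \<open>w\<close>: the squared
    norm of \<open>w\<close> is \<open>2 * (1 - r)\<close>, because \<open>u\<close> is a unit
    vector with real first coordinate \<open>r\<close>.\<close>
  define U where "U = Matrix.mat d d (\<lambda>(i, j). (if i = j then 1 else 0) - of_real (inverse (1 - r)) * w i * cnj (w j))"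
  have cc: "c * cnj c = 1"
  proof (cases "v 0 = 0")
    case False
    have "c * cnj c = (v 0 * cnj (v 0)) / (of_real (cmod (v 0)) * of_real (cmod (v 0)))"
      using False by (simp add: c_def mult.commute)
    also have "\<dots> = 1" using False
      by (simp only: complex_norm_square[symmetric] power2_eq_square of_real_mult) simp
    finally show ?thesis .
  qed (simp add: c_def)
  have u0: "u 0 = of_real r"
    by (auto simp: u_def c_def r_def mult.commute[of "cnj _"] complex_norm_square[symmetric] power2_eq_square)
  have uu: "(\<Sum>i<d. u i * cnj (u i)) = 1"
  proof -
    have "(\<Sum>i<d. u i * cnj (u i)) = (\<Sum>i<d. c * cnj c * (v i * cnj (v i)))"
      by (simp add: u_def mult_ac)
    with v show ?thesis by (simp add: cc)
  qed
  have r: "1 - r \<noteq> 0" "complex_of_real (1 - r) \<noteq> 0"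
  proof -
    show "1 - r \<noteq> 0" by (simp add: r_def add_nonneg_eq_0_iff)
    then show "complex_of_real (1 - r) \<noteq> 0" using of_real_eq_0_iff by blast
  qed
  have w0: "w 0 = - of_real (1 - r)" by (simp add: w_def u0)
  have ww: "(\<Sum>i<d. w i * cnj (w i)) = 2 * of_real (1 - r)"
  proof -
    have "(\<Sum>i<d. w i * cnj (w i)) = (\<Sum>i<d. u i * cnj (u i) - (if i = 0 then u 0 + cnj (u 0) - 1 else 0))"
      by (intro sum.cong) (auto simp: w_def algebra_simps)
    also have "\<dots> = 2 * of_real (1 - r)"
      using d by (simp add: sum_subtractf uu u0)
    finally show ?thesis .
  qed
  define t where "t = complex_of_real (inverse (1 - r))"
  have t: "t * of_real (1 - r) = 1"
    unfolding t_def of_real_mult[symmetric] using r(1) by simp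
  have U_index: "U $$ (i, j) = (if i = j then 1 else 0) - t * w i * cnj (w j)" if "i < d" "j < d" for i j
    using that by (simp add: U_def t_def)
  have cnj_t: "cnj t = t" by (simp add: t_def)
  have "unitary_mat d U"
  proof (rule unitary_matI)
    fix i j assume ij: "i < d" "j < d"
    have "(\<Sum>k<d. U $$ (i, k) * cnj (U $$ (j, k)))
      = (\<Sum>k<d. (if k = i then (if i = j then 1 else 0) - t * (w i * cnj (w j)) else 0)
          - (if k = j then t * (w i * cnj (w j)) else 0)
          + t * t * w i * cnj (w j) * (w k * cnj (w k)))"
      using ij by (intro sum.cong refl) (auto simp: U_index cnj_t algebra_simps)
    also have "\<dots> = (if i = j then 1 else 0) - t * (w i * cnj (w j)) - t * (w i * cnj (w j))
        + t * t * w i * cnj (w j) * (2 * of_real (1 - r))"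
      using ij by (simp only: sum.distrib sum_subtractf sum_distrib_left[symmetric] ww) simp
    also have "\<dots> = (if i = j then 1 else 0) - 2 * t * (w i * cnj (w j)) * (1 - t * of_real (1 - r))"
      by (simp add: algebra_simps del: of_real_diff)
    also have "\<dots> = (if i = j then 1 else 0)"
      by (simp only: t) simp
    finally show "(\<Sum>k<d. U $$ (i, k) * cnj (U $$ (j, k))) = (if i = j then 1 else 0)" .
  qed (simp add: U_def)
  moreover have "U $$ (i, 0) = c * v i" if "i < d" for i
  proof -
    have "U $$ (i, 0) = (if i = 0 then 1 else 0) + w i"
      using that d t by (simp add: U_index w0 algebra_simps del: of_real_diff)
    then show ?thesis by (simp add: w_def u_def)
  qed
  ultimately show ?thesis using that by blast
qed

lemma unit_eigenvector_exists:
  fixes A :: "complex mat"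
  assumes A: "A \<in> carrier_mat d d" and d: "0 < d"
  obtains v lam where "(\<Sum>i<d. v i * cnj (v i)) = 1"
    "\<And>i. i < d \<Longrightarrow> (\<Sum>j<d. A $$ (i, j) * v j) = lam * v i"
proof -
  obtain as where as: "char_poly A = (\<Prod>a\<leftarrow>as. [:- a, 1:])" "length as = d"
    using char_poly_factorized[OF A] by blast
  then obtain lam as' where "as = lam # as'" using d by (cases as) auto
  with as have "poly (char_poly A) lam = 0" by simp
  then have "eigenvalue A lam" using eigenvalue_root_char_poly[OF A] by simp
  then obtain x where x: "x \<in> carrier_vec d" "x \<noteq> 0\<^sub>v d" "A *\<^sub>v x = lam \<cdot>\<^sub>v x"
    using A unfolding eigenvalue_def eigenvector_def by auto
  define s where "s = (\<Sum>i<d. (cmod (x $ i))\<^sup>2)"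
  have "s \<noteq> 0"
  proof
    assume "s = 0"
    then have "\<forall>i<d. x $ i = 0" unfolding s_def by (subst (asm) sum_nonneg_eq_0_iff) auto
    with x have "x = 0\<^sub>v d" by (intro eq_vecI) auto
    with x show False by simp
  qed
  moreover have "s \<ge> 0" unfolding s_def by (intro sum_nonneg) simp
  ultimately have s: "s > 0" by simp
  define v where "v i = x $ i / of_real (sqrt s)" for i
  have "(\<Sum>i<d. v i * cnj (v i)) = (\<Sum>i<d. of_real ((cmod (x $ i))\<^sup>2 / s))"
    using s by (intro sum.cong refl)
      (simp add: v_def complex_norm_square[symmetric] power2_eq_square flip: of_real_mult)
  also have "\<dots> = 1"
    using s by (simp add: sum_divide_distrib[symmetric] s_def[symmetric] del: of_real_power flip: of_real_sum)
  finally have "(\<Sum>i<d. v i * cnj (v i)) = 1" .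
  moreover have "(\<Sum>j<d. A $$ (i, j) * v j) = lam * v i" if i: "i < d" for i
  proof -
    have "(\<Sum>j<d. A $$ (i, j) * x $ j) = (A *\<^sub>v x) $ i"
      using A x(1) i by (auto simp: scalar_prod_def lessThan_atLeast0 intro!: sum.cong)
    also have "\<dots> = lam * x $ i" using x i by simp
    finally show ?thesis by (simp add: v_def sum_divide_distrib[symmetric])
  qed
  ultimately show ?thesis using that by blast
qed

definition diagonalizes :: "nat \<Rightarrow> complex mat \<Rightarrow> (nat \<Rightarrow> real) \<Rightarrow> complex mat \<Rightarrow> bool" where
  "diagonalizes d U l A \<longleftrightarrow>
     unitary_mat d U \<and> A = U * mat_diag d (\<lambda>i. complex_of_real (l i)) * mat_adjoint U"

text \<open>Deflation: in an orthonormal basis that starts with an eigenvector, a Hermitian matrix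
  splits into a real number and a Hermitian block of size one less.\<close>

theorem hermitian_diagonalizable:
  assumes "A \<in> carrier_mat d d" "mat_adjoint A = A"
  shows "\<exists>U l. diagonalizes d U l A"
  using assms
proof (induction d arbitrary: A)
  case 0
  have "unitary_mat 0 (1\<^sub>m 0)" by (auto simp: unitary_mat_def intro!: eq_matI)
  with 0 show ?case unfolding diagonalizes_def by (intro exI[of _ "1\<^sub>m 0"] exI conjI eq_matI) auto
next
  case (Suc d)
  let ?n = "Suc d"
  have A: "A \<in> carrier_mat ?n ?n" by fact
  obtain v lam where v: "(\<Sum>i<?n. v i * cnj (v i)) = 1"
    "\<And>i. i < ?n \<Longrightarrow> (\<Sum>j<?n. A $$ (i, j) * v j) = lam * v i"
    using unit_eigenvector_exists[OF A] by auto
  obtain U c where U: "unitary_mat ?n U" "\<And>i. i < ?n \<Longrightarrow> U $$ (i, 0) = c * v i"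
    using unitary_with_first_column[OF _ v(1)] by auto
  note Uc = unitary_mat_carrier[OF U(1)]
  have UU: "U * mat_adjoint U = 1\<^sub>m ?n" "mat_adjoint U * U = 1\<^sub>m ?n"
    using U by (auto simp: unitary_mat_def)
  define B where "B = mat_adjoint U * (A * U)"
  have B: "B \<in> carrier_mat ?n ?n" using A Uc by (simp add: B_def)
  have Bh: "mat_adjoint B = B"
    unfolding B_def using A Uc Suc.prems
    by (simp add: mat_adjoint_mult[where n = ?n and m = ?n and k = ?n]
        square_mult_assoc[where d = ?n])
  have B0: "B $$ (i, 0) = (if i = 0 then lam else 0)" if i: "i < ?n" for i
  proof -
    have AU: "(A * U) $$ (k, 0) = lam * U $$ (k, 0)" if "k < ?n" for k
    proof -
      have "(A * U) $$ (k, 0) = (\<Sum>j<?n. A $$ (k, j) * U $$ (j, 0))"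
        using mult_mat_index[OF A Uc that] by simp
      also have "\<dots> = (\<Sum>j<?n. c * (A $$ (k, j) * v j))"
        by (intro sum.cong) (auto simp: U(2))
      also have "\<dots> = lam * U $$ (k, 0)"
        using v(2)[OF that] that by (simp add: sum_distrib_left[symmetric] U(2) del: sum.lessThan_Suc)
      finally show ?thesis .
    qed
    have "B $$ (i, 0) = (\<Sum>k<?n. mat_adjoint U $$ (i, k) * (A * U) $$ (k, 0))"
      unfolding B_def using A Uc i by (subst mult_mat_index[where n = ?n and m = ?n and k = ?n]) auto
    also have "\<dots> = (\<Sum>k<?n. lam * (mat_adjoint U $$ (i, k) * U $$ (k, 0)))"
      by (intro sum.cong) (auto simp: AU)
    also have "\<dots> = lam * (mat_adjoint U * U) $$ (i, 0)"
      using Uc i by (subst mult_mat_index[where n = ?n and m = ?n and k = ?n]) (auto simp: sum_distrib_left simp del: sum.lessThan_Suc)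
    finally show ?thesis using i by (auto simp: UU)
  qed
  have Bc: "B $$ (j, i) = cnj (B $$ (i, j))" if "i < ?n" "j < ?n" for i j
    using mat_adjoint_index[of j B i] that B Bh by auto
  have lam: "of_real (Re lam) = lam"
    using Bc[of 0 0] B0[of 0] by (simp add: complex_eq_iff)
  have B0': "B $$ (0, j) = (if j = 0 then lam else 0)" if "j < ?n" for j
    using Bc[of j 0] B0[of j] that B0[of 0] by auto
  define C where "C = Matrix.mat d d (\<lambda>(i, j). B $$ (Suc i, Suc j))"
  have C: "C \<in> carrier_mat d d" "mat_adjoint C = C"
    using B by (auto simp: C_def Bc[symmetric] intro!: eq_matI)
  obtain U' l where U': "diagonalizes d U' l C" using Suc.IH[OF C] by blast
  then have U'c: "U' \<in> carrier_mat d d" "unitary_mat d U'" by (auto simp: diagonalizes_def)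
  \<comment> \<open>The block sum of \<open>1\<close> and \<open>U'\<close>; index \<open>0\<close>
    belongs to the eigenvector, and all other indices are shifted by one.\<close>
  define V where "V = Matrix.mat ?n ?n (\<lambda>(i, j). if i = 0 \<or> j = 0 then (if i = j then 1 else 0) else U' $$ (i - 1, j - 1))"
  define m where "m i = (case i of 0 \<Rightarrow> Re lam | Suc i \<Rightarrow> l i)" for i
  have U'U': "(\<Sum>k<d. U' $$ (i, k) * cnj (U' $$ (j, k))) = (if i = j then 1 else 0)"
    if "i < d" "j < d" for i j
  proof -
    have "(\<Sum>k<d. U' $$ (i, k) * cnj (U' $$ (j, k))) = (U' * mat_adjoint U') $$ (i, j)"
      using that U'c by (subst mult_mat_index[where n = d and m = d and k = d]) (auto intro!: sum.cong)
    then show ?thesis using U'c(2) that by (simp add: unitary_mat_def)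
  qed
  have Vu: "unitary_mat ?n V"
  proof (rule unitary_matI)
    fix i j assume "i < ?n" "j < ?n"
    then show "(\<Sum>k<?n. V $$ (i, k) * cnj (V $$ (j, k))) = (if i = j then 1 else 0)"
      unfolding sum.lessThan_Suc_shift by (cases i; cases j) (auto simp: V_def U'U')
  qed (simp add: V_def)
  have BV: "B = V * mat_diag ?n (\<lambda>i. complex_of_real (m i)) * mat_adjoint V"
  proof (rule eq_matI, goal_cases)
    case (1 i j)
    then have ij: "i < ?n" "j < ?n" using Vu by auto
    have "(V * mat_diag ?n (\<lambda>i. complex_of_real (m i)) * mat_adjoint V) $$ (i, j)
      = (\<Sum>k<?n. V $$ (i, k) * of_real (m k) * cnj (V $$ (j, k)))"
      using Vu ij by (intro diag_conj_index) auto
    also have "\<dots> = B $$ (i, j)"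
    proof (cases "i = 0 \<or> j = 0")
      case True
      then show ?thesis unfolding sum.lessThan_Suc_shift using ij
        by (cases i; cases j) (auto simp: V_def m_def lam B0 B0')
    next
      case False
      then obtain i' j' where ij': "i = Suc i'" "j = Suc j'" by (cases i; cases j) auto
      have "(\<Sum>k<?n. V $$ (i, k) * of_real (m k) * cnj (V $$ (j, k)))
        = (\<Sum>k<d. U' $$ (i', k) * of_real (l k) * cnj (U' $$ (j', k)))"
        unfolding sum.lessThan_Suc_shift using ij ij' by (simp add: V_def m_def)
      also have "\<dots> = C $$ (i', j')"
        using U' U'c ij ij' by (auto simp: diagonalizes_def diag_conj_index)
      finally show ?thesis using ij ij' by (simp add: C_def)
    qed
    finally show ?case by simp
  qed (use B Vu in auto)
  have "A = U * B * mat_adjoint U"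
  proof -
    have "U * B * mat_adjoint U = (U * mat_adjoint U) * A * (U * mat_adjoint U)"
      unfolding B_def using A Uc
      by (simp add: square_mult_assoc[where d = ?n] del: UU)
    then show ?thesis using A by (simp add: UU)
  qed
  also have "\<dots> = (U * V) * mat_diag ?n (\<lambda>i. complex_of_real (m i)) * mat_adjoint (U * V)"
    unfolding BV using Uc unitary_mat_carrier[OF Vu] mat_diag_dim[of ?n "\<lambda>i. complex_of_real (m i)"]
    by (simp add: mat_adjoint_mult[where n = ?n and m = ?n and k = ?n]
        square_mult_assoc[where d = ?n])
  finally have "diagonalizes ?n (U * V) m A"
    using unitary_mat_mult[OF U(1) Vu] by (simp add: diagonalizes_def)
  then show ?case by blast
qed

section \<open>Functional calculus and entropy\<close>

abbreviation rdiag :: "nat \<Rightarrow> (nat \<Rightarrow> real) \<Rightarrow> complex mat" where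
  "rdiag d l \<equiv> mat_diag d (\<lambda>i. complex_of_real (l i))"

lemma square_mult_one [simp]: "A \<in> carrier_mat d d \<Longrightarrow> A * 1\<^sub>m d = (A :: complex mat)"
  by (rule right_mult_one_mat)

lemma diagonalizes_unitary: "diagonalizes d U l A \<Longrightarrow> unitary_mat d U"
  by (simp add: diagonalizes_def)

lemma diagonalizes_eq: "diagonalizes d U l A \<Longrightarrow> A = U * rdiag d l * mat_adjoint U"
  by (simp add: diagonalizes_def)

lemma diagonalizes_carrier: "diagonalizes d U l A \<Longrightarrow> A \<in> carrier_mat d d"
  unfolding diagonalizes_def by (metis mat_adjoint_carrier mat_diag_dim square_mult_carrier unitary_mat_carrier)

lemma unitary_mat_cancel:
  assumes "unitary_mat d U" "A \<in> carrier_mat d d"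
  shows "U * (mat_adjoint U * A) = A" "mat_adjoint U * (U * A) = A"
  using assms by (simp_all add: unitary_mat_def square_mult_assoc[where d = d, symmetric])

text \<open>The change of basis \<open>M\<close> intertwines the two diagonal matrices, so its entry
  at \<open>(i, j)\<close> vanishes unless \<open>l i = m j\<close>. It therefore intertwines every
  function of the eigenvalues. This makes the choice in \<open>mat_fun\<close> harmless.\<close>

lemma diagonalization_fun_unique:
  assumes U: "diagonalizes d U l A" and V: "diagonalizes d V m A"
  shows "U * rdiag d (\<lambda>i. f (l i)) * mat_adjoint U = V * rdiag d (\<lambda>i. f (m i)) * mat_adjoint V"
proof -
  note u = diagonalizes_unitary[OF U] diagonalizes_unitary[OF V]
  note Uc = u[THEN unitary_mat_carrier]
  define M where "M = mat_adjoint U * V"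
  have M: "M \<in> carrier_mat d d" using Uc by (simp add: M_def)
  note assoc = square_mult_assoc[where d = d]
  have "rdiag d l * M = mat_adjoint U * (U * rdiag d l * mat_adjoint U) * V"
    using Uc u by (simp add: assoc M_def unitary_mat_cancel)
  also have "U * rdiag d l * mat_adjoint U = V * rdiag d m * mat_adjoint V"
    using U V unfolding diagonalizes_def by metis
  also have "mat_adjoint U * \<dots> * V = M * rdiag d m"
    using Uc u by (simp add: assoc M_def) (simp add: unitary_mat_def)
  finally have eq: "rdiag d l * M = M * rdiag d m" .
  have "rdiag d (\<lambda>i. f (l i)) * M = M * rdiag d (\<lambda>i. f (m i))"
  proof (rule eq_matI)
    fix i j assume "i < dim_row (M * rdiag d (\<lambda>i. f (m i)))" "j < dim_col (M * rdiag d (\<lambda>i. f (m i)))"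
    then have ij: "i < d" "j < d" using M by (auto simp: mat_diag_def)
    have "(rdiag d l * M) $$ (i, j) = (M * rdiag d m) $$ (i, j)" by (simp add: eq)
    then have "of_real (l i) * M $$ (i, j) = M $$ (i, j) * of_real (m j)"
      using ij M by (simp add: mat_diag_mult_left[OF M] mat_diag_mult_right[OF M])
    then have "M $$ (i, j) = 0 \<or> l i = m j" by auto
    then have "of_real (f (l i)) * M $$ (i, j) = M $$ (i, j) * of_real (f (m j))" by auto
    then show "(rdiag d (\<lambda>i. f (l i)) * M) $$ (i, j) = (M * rdiag d (\<lambda>i. f (m i))) $$ (i, j)"
      using ij M by (simp add: mat_diag_mult_left[OF M] mat_diag_mult_right[OF M])
  qed (use M in \<open>auto simp: mat_diag_def\<close>)
  then have "U * (rdiag d (\<lambda>i. f (l i)) * M) * mat_adjoint V = U * (M * rdiag d (\<lambda>i. f (m i))) * mat_adjoint V"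
    by simp
  then show ?thesis using Uc u by (simp add: assoc M_def unitary_mat_cancel) (simp add: unitary_mat_def)
qed

lemma mat_fun_eq:
  assumes "diagonalizes d U l A"
  shows "mat_fun f A = U * rdiag d (\<lambda>i. f (l i)) * mat_adjoint U"
proof -
  have d: "dim_row A = d" using diagonalizes_carrier[OF assms] by simp
  let ?P = "\<lambda>B. \<exists>U l. unitary_mat (dim_row A) U \<and>
     A = U * rdiag (dim_row A) l * mat_adjoint U \<and>
     B = U * rdiag (dim_row A) (\<lambda>i. f (l i)) * mat_adjoint U"
  have "?P (U * rdiag d (\<lambda>i. f (l i)) * mat_adjoint U)"
    using assms unfolding diagonalizes_def d by blast
  then have "?P (mat_fun f A)"
    unfolding mat_fun_def by (rule someI[of ?P])
  then obtain V m where V: "diagonalizes d V m A" "mat_fun f A = V * rdiag d (\<lambda>i. f (m i)) * mat_adjoint V"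
    unfolding diagonalizes_def d by blast
  show ?thesis unfolding V(2) by (rule diagonalization_fun_unique[OF V(1) assms])
qed

text \<open>Squared inner products of the columns of two eigenbases. For unitary matrices the
  overlaps are doubly stochastic, and through them the trace of a product of noncommuting matrices
  becomes a sum over pairs of eigenvalues.\<close>

definition overlap :: "complex mat \<Rightarrow> complex mat \<Rightarrow> nat \<Rightarrow> nat \<Rightarrow> real" where
  "overlap U V i j = (cmod ((mat_adjoint U * V) $$ (i, j)))\<^sup>2"

lemma overlap_nonneg [simp]: "0 \<le> overlap U V i j"
  by (simp add: overlap_def)

lemma unitary_mat_sums:
  assumes "unitary_mat d M"
  shows "i < d \<Longrightarrow> (\<Sum>j<d. (cmod (M $$ (i, j)))\<^sup>2) = 1"
    and "j < d \<Longrightarrow> (\<Sum>i<d. (cmod (M $$ (i, j)))\<^sup>2) = 1"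
proof -
  have M: "M \<in> carrier_mat d d" using assms by simp
  assume i: "i < d"
  have "complex_of_real (\<Sum>j<d. (cmod (M $$ (i, j)))\<^sup>2) = (\<Sum>j<d. M $$ (i, j) * cnj (M $$ (i, j)))"
    by (simp add: complex_norm_square[symmetric] del: of_real_power)
  also have "\<dots> = (M * mat_adjoint M) $$ (i, i)"
    using M i by (subst mult_mat_index[where n = d and m = d and k = d]) (auto intro!: sum.cong)
  also have "\<dots> = complex_of_real 1" using assms i by (simp add: unitary_mat_def)
  finally show "(\<Sum>j<d. (cmod (M $$ (i, j)))\<^sup>2) = 1" using of_real_eq_iff by blast
next
  have M: "M \<in> carrier_mat d d" using assms by simp
  assume j: "j < d"
  have "complex_of_real (\<Sum>i<d. (cmod (M $$ (i, j)))\<^sup>2) = (\<Sum>i<d. cnj (M $$ (i, j)) * M $$ (i, j))"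
    by (simp add: complex_norm_square[symmetric] mult.commute[of "cnj _"] del: of_real_power)
  also have "\<dots> = (mat_adjoint M * M) $$ (j, j)"
    using M j by (subst mult_mat_index[where n = d and m = d and k = d]) (auto intro!: sum.cong)
  also have "\<dots> = complex_of_real 1" using assms j by (simp add: unitary_mat_def)
  finally show "(\<Sum>i<d. (cmod (M $$ (i, j)))\<^sup>2) = 1" using of_real_eq_iff by blast
qed

lemma overlap_sums:
  assumes "unitary_mat d U" "unitary_mat d V"
  shows "i < d \<Longrightarrow> (\<Sum>j<d. overlap U V i j) = 1" "j < d \<Longrightarrow> (\<Sum>i<d. overlap U V i j) = 1"
  using unitary_mat_sums[OF unitary_mat_mult[OF unitary_mat_adjoint[OF assms(1)] assms(2)]]
  by (simp_all add: overlap_def)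

lemma overlap_self:
  assumes "unitary_mat d U" "i < d" "j < d"
  shows "overlap U U i j = (if i = j then 1 else 0)"
  using assms by (auto simp: overlap_def unitary_mat_def)

lemma mat_trace_diag_mult:
  assumes U: "unitary_mat d U" and V: "unitary_mat d V"
  shows "mat_trace (U * rdiag d p * mat_adjoint U * (V * rdiag d q * mat_adjoint V))
    = of_real (\<Sum>i<d. \<Sum>j<d. overlap U V i j * p i * q j)"
proof -
  note c = unitary_mat_carrier[OF U] unitary_mat_carrier[OF V]
  note assoc = square_mult_assoc[where d = d]
  define M where "M = mat_adjoint U * V"
  have M: "M \<in> carrier_mat d d" using c by (simp add: M_def)
  have M': "mat_adjoint V * U = mat_adjoint M" using c by (simp add: M_def mat_adjoint_mult[of _ d d _ d])
  have "mat_trace (U * rdiag d p * mat_adjoint U * (V * rdiag d q * mat_adjoint V))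
    = mat_trace (U * (rdiag d p * M * (rdiag d q * mat_adjoint V)))"
    using c by (simp add: assoc M_def)
  also have "\<dots> = mat_trace (rdiag d p * M * (rdiag d q * mat_adjoint V) * U)"
    using c M by (intro mat_trace_comm[of _ d d]) auto
  also have "\<dots> = mat_trace ((rdiag d p * M) * (rdiag d q * mat_adjoint M))"
    using c M by (simp add: assoc M'[symmetric])
  also have "\<dots> = (\<Sum>i<d. \<Sum>j<d. of_real (p i) * M $$ (i, j) * (of_real (q j) * cnj (M $$ (i, j))))"
    using M by (subst mat_trace_mult[of _ d d])
      (auto simp: mat_diag_mult_left[of _ d d] intro!: sum.cong)
  also have "\<dots> = (\<Sum>i<d. \<Sum>j<d. of_real (overlap U V i j * p i * q j))"
    by (intro sum.cong refl) (simp add: overlap_def M_def[symmetric] complex_norm_square mult_ac del: of_real_power)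
  finally show ?thesis by simp
qed

lemma sum_overlap_self:
  assumes "unitary_mat d U"
  shows "(\<Sum>i<d. \<Sum>j<d. overlap U U i j * p i * q j) = (\<Sum>i<d. p i * q i)"
proof -
  have "(\<Sum>i<d. \<Sum>j<d. overlap U U i j * p i * q j) = (\<Sum>i<d. \<Sum>j<d. if j = i then p i * q i else 0)"
    using assms by (intro sum.cong refl) (auto simp: overlap_self)
  then show ?thesis by simp
qed

lemma von_neumann_entropy_eq:
  assumes A: "diagonalizes d U l A"
  shows "von_neumann_entropy A = - (\<Sum>i<d. l i * log 2 (l i))"
  using A mat_trace_diag_mult[of d U U l "\<lambda>i. log 2 (l i)"] sum_overlap_self[of d U]
  unfolding von_neumann_entropy_def mat_fun_eq[OF A]
  by (simp add: diagonalizes_eq[OF A, symmetric] diagonalizes_unitary[OF A])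

lemma mat_trace_diagonalizes:
  assumes A: "diagonalizes d U l A"
  shows "mat_trace A = of_real (\<Sum>i<d. l i)"
proof -
  note u = diagonalizes_unitary[OF A]
  have "U * rdiag d (\<lambda>_. 1) * mat_adjoint U = 1\<^sub>m d" using u by (simp add: unitary_mat_def)
  moreover have "mat_trace (A * (U * rdiag d (\<lambda>_. 1) * mat_adjoint U)) = of_real (\<Sum>i<d. l i * 1)"
    using mat_trace_diag_mult[OF u u, of l "\<lambda>_. 1"] unfolding sum_overlap_self[OF u]
    by (simp only: diagonalizes_eq[OF A, symmetric])
  ultimately show ?thesis using diagonalizes_carrier[OF A] by simp
qed

section \<open>Positivity in terms of eigenvalues and Gram factors\<close>

lemma diag_conj_gram:
  assumes "U \<in> carrier_mat d d" "\<And>i. i < d \<Longrightarrow> p i = s i * s i"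
  shows "U * rdiag d p * mat_adjoint U = (U * rdiag d s) * mat_adjoint (U * rdiag d s)"
proof -
  have "rdiag d p = rdiag d s * rdiag d s"
    using assms(2) unfolding mat_diag_diag by (auto simp: mat_diag_def intro!: eq_matI)
  then show ?thesis
    using assms(1) by (simp add: mat_adjoint_mult[of _ d d _ d] square_mult_assoc[where d = d] del: mat_diag_diag)
qed

lemma positive_semidef_diag_conj:
  assumes "U \<in> carrier_mat d d" "\<And>i. i < d \<Longrightarrow> 0 \<le> p i"
  shows "positive_semidef d (U * rdiag d p * mat_adjoint U)"
  using assms by (subst diag_conj_gram[where s = "\<lambda>i. sqrt (p i)"]) (auto intro!: positive_semidef_gram[of _ d d])

text \<open>The eigenvalue is the trace of \<open>A\<close> against the rank one projection on the
  \<open>i\<close>-th column of \<open>U\<close>.\<close>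

lemma positive_semidef_eigenvalue_nonneg:
  assumes A: "diagonalizes d U l A" and psd: "positive_semidef d A" and i: "i < d"
  shows "0 \<le> l i"
proof -
  note u = diagonalizes_unitary[OF A]
  let ?e = "\<lambda>k. if k = i then 1 else 0 :: real"
  have "0 \<le> mat_trace (U * rdiag d ?e * mat_adjoint U * A)"
    using mat_trace_psd_mult_nonneg[OF _ psd, of "U * rdiag d ?e" d] u
      diag_conj_gram[OF unitary_mat_carrier[OF u], of ?e ?e] by simp
  also have "\<dots> = of_real (\<Sum>k<d. ?e k * l k)"
    using mat_trace_diag_mult[OF u u, of ?e l] sum_overlap_self[OF u, of ?e l]
    by (simp only: diagonalizes_eq[OF A, symmetric])
  also have "(\<Sum>k<d. ?e k * l k) = (\<Sum>k<d. if k = i then l k else 0)"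
    by (intro sum.cong) auto
  also have "\<dots> = l i" using i by simp
  finally show ?thesis by (simp add: less_eq_complex_def)
qed

lemma positive_semidef_diagonalizable:
  assumes "positive_semidef d A"
  obtains U l where "diagonalizes d U l A" "\<And>i. i < d \<Longrightarrow> 0 \<le> l i"
  using hermitian_diagonalizable[OF _ positive_semidef_hermitian[OF assms]]
    positive_semidef_eigenvalue_nonneg[OF _ assms] positive_semidef_carrier[OF assms] by blast

lemma positive_semidef_gram_exists:
  assumes "positive_semidef d A"
  obtains X where "X \<in> carrier_mat d d" "A = X * mat_adjoint X"
proof -
  obtain U l where A: "diagonalizes d U l A" "\<And>i. i < d \<Longrightarrow> 0 \<le> l i"
    using positive_semidef_diagonalizable[OF assms] by blast
  note u = diagonalizes_unitary[OF A(1)]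
  have "A = (U * rdiag d (\<lambda>i. sqrt (l i))) * mat_adjoint (U * rdiag d (\<lambda>i. sqrt (l i)))"
    using A u by (subst diagonalizes_eq[OF A(1)], subst diag_conj_gram[where s = "\<lambda>i. sqrt (l i)"]) auto
  with that[of "U * rdiag d (\<lambda>i. sqrt (l i))"] u show ?thesis by simp
qed

lemma mat_trace_mult_nonneg:
  assumes "positive_semidef d A" "positive_semidef d B"
  shows "0 \<le> mat_trace (A * B)"
  using positive_semidef_gram_exists[OF assms(1)] mat_trace_psd_mult_nonneg[OF _ assms(2)] by metis

section \<open>Density operators and the range of the entropy\<close>

lemma density_diagonalizable:
  assumes "\<rho> \<in> density_operators d"
  obtains U l where "diagonalizes d U l \<rho>" "\<And>i. i < d \<Longrightarrow> 0 \<le> l i" "(\<Sum>i<d. l i) = 1"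
proof -
  have "positive_semidef d \<rho>" "mat_trace \<rho> = 1" using assms by (auto simp: density_operators_def)
  then show ?thesis using that positive_semidef_diagonalizable mat_trace_diagonalizes
    by (metis of_real_eq_1_iff)
qed

lemma density_carrier: "\<rho> \<in> density_operators d \<Longrightarrow> \<rho> \<in> carrier_mat d d"
  by (simp add: density_operators_def)

lemma density_psd: "\<rho> \<in> density_operators d \<Longrightarrow> positive_semidef d \<rho>"
  by (simp add: density_operators_def)

lemma density_dim_pos: "\<rho> \<in> density_operators d \<Longrightarrow> 0 < d"
  by (rule ccontr) (auto simp: density_operators_def mat_trace_def dest!: positive_semidef_carrier)

lemma von_neumann_entropy_bounds:
  assumes "\<rho> \<in> density_operators d"
  shows "0 \<le> von_neumann_entropy \<rho>" "von_neumann_entropy \<rho> \<le> log 2 (real d)"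
proof -
  obtain U l where l: "diagonalizes d U l \<rho>" "\<And>i. i < d \<Longrightarrow> 0 \<le> l i" "(\<Sum>i<d. l i) = 1"
    using density_diagonalizable[OF assms] by blast
  have d: "0 < d" using density_dim_pos[OF assms] .
  have le1: "l i \<le> 1" if "i < d" for i
    using member_le_sum[of i "{..<d}" l] l that by auto
  have "l i * log 2 (l i) \<le> 0" if "i < d" for i
    using l(2)[OF that] le1[OF that] by (cases "l i = 0") (auto intro!: mult_nonneg_nonpos)
  then show "0 \<le> von_neumann_entropy \<rho>"
    unfolding von_neumann_entropy_eq[OF l(1)] by (auto intro!: sum_nonpos)
  \<comment> \<open>Gibbs' inequality against the uniform distribution, letter by letter; the
    correction \<open>1 / real d - l i\<close> sums to zero.\<close>
  have "- (l i * ln (l i)) \<le> l i * ln (real d) + (1 / real d - l i)" if "i < d" for i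
  proof (cases "l i = 0")
    case False
    then have pos: "l i > 0" using l(2)[OF that] by simp
    have "ln (1 / (l i * real d)) \<le> 1 / (l i * real d) - 1"
      using pos d by (intro ln_le_minus_one) simp
    then have "- ln (l i) \<le> ln (real d) + (1 / (l i * real d) - 1)"
      using pos d by (simp add: ln_div ln_mult)
    then have "l i * (- ln (l i)) \<le> l i * (ln (real d) + (1 / (l i * real d) - 1))"
      using pos by (intro mult_left_mono) auto
    also have "\<dots> = l i * ln (real d) + (1 / real d - l i)"
      using pos d by (simp add: field_simps)
    finally show ?thesis by simp
  qed (use d in simp)
  then have "(\<Sum>i<d. - (l i * ln (l i))) \<le> (\<Sum>i<d. l i * ln (real d) + (1 / real d - l i))"
    by (intro sum_mono) simp
  also have "\<dots> = ln (real d)"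
    using d l(3) by (simp add: sum.distrib sum_subtractf sum_distrib_right[symmetric])
  finally have "- (\<Sum>i<d. l i * ln (l i)) \<le> ln (real d)" by (simp add: sum_negf)
  then show "von_neumann_entropy \<rho> \<le> log 2 (real d)"
    using divide_right_mono[of "- (\<Sum>i<d. l i * ln (l i))" "ln (real d)" "ln 2"]
    unfolding von_neumann_entropy_eq[OF l(1)] log_def
    by (simp add: sum_divide_distrib[symmetric])
qed

section \<open>Mixtures\<close>

lemma mixture_carrier [simp]: "mixture d Q F \<in> carrier_mat d d"
  by (simp add: mixture_def mat_sum_def)

lemma mixture_index:
  assumes "\<And>x. x \<in> set_pmf Q \<Longrightarrow> F x \<in> carrier_mat d d" "i < d" "j < d"
  shows "mixture d Q F $$ (i, j) = (\<Sum>x\<in>set_pmf Q. of_real (pmf Q x) * F x $$ (i, j))"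
  unfolding mixture_def mat_sum_def using assms(2,3) carrier_matD[OF assms(1)]
  by (auto intro!: sum.cong index_smult_mat(1))

lemma mat_trace_mixture_mult:
  assumes F: "\<And>x. x \<in> set_pmf Q \<Longrightarrow> F x \<in> carrier_mat d d" and B: "B \<in> carrier_mat d d"
  shows "mat_trace (mixture d Q F * B) = (\<Sum>x\<in>set_pmf Q. of_real (pmf Q x) * mat_trace (F x * B))"
proof -
  have "mat_trace (mixture d Q F * B)
    = (\<Sum>i<d. \<Sum>j<d. \<Sum>x\<in>set_pmf Q. of_real (pmf Q x) * (F x $$ (i, j) * B $$ (j, i)))"
    using B F by (subst mat_trace_mult[of _ d d]) (auto simp: mixture_index sum_distrib_right mult.assoc intro!: sum.cong)
  also have "\<dots> = (\<Sum>i<d. \<Sum>x\<in>set_pmf Q. \<Sum>j<d. of_real (pmf Q x) * (F x $$ (i, j) * B $$ (j, i)))"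
    by (rule sum.cong[OF refl], rule sum.swap)
  also have "\<dots> = (\<Sum>x\<in>set_pmf Q. \<Sum>i<d. \<Sum>j<d. of_real (pmf Q x) * (F x $$ (i, j) * B $$ (j, i)))"
    by (rule sum.swap)
  also have "\<dots> = (\<Sum>x\<in>set_pmf Q. of_real (pmf Q x) * mat_trace (F x * B))"
    using F B by (intro sum.cong refl) (simp add: mat_trace_mult[of _ d d] sum_distrib_left)
  finally show ?thesis .
qed

lemma sum_pmf_support: "finite (set_pmf Q) \<Longrightarrow> (\<Sum>x\<in>set_pmf Q. pmf Q x) = 1"
  by (simp add: sum_pmf_eq_1)

lemma mixture_density:
  assumes "finite (set_pmf Q)" and F: "\<And>x. x \<in> set_pmf Q \<Longrightarrow> F x \<in> density_operators d"
  shows "mixture d Q F \<in> density_operators d"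
proof -
  have Fc: "F x \<in> carrier_mat d d" if "x \<in> set_pmf Q" for x using F[OF that] by (rule density_carrier)
  have "0 \<le> quad d (mixture d Q F) f" for f
  proof -
    have "quad d (mixture d Q F) f
      = (\<Sum>i<d. \<Sum>j<d. \<Sum>x\<in>set_pmf Q. of_real (pmf Q x) * (cnj (f i) * F x $$ (i, j) * f j))"
      unfolding quad_def
      by (intro sum.cong refl) (auto simp: mixture_index[OF Fc] sum_distrib_left sum_distrib_right mult_ac intro!: sum.cong)
    also have "\<dots> = (\<Sum>i<d. \<Sum>x\<in>set_pmf Q. \<Sum>j<d. of_real (pmf Q x) * (cnj (f i) * F x $$ (i, j) * f j))"
      by (rule sum.cong[OF refl], rule sum.swap)
    also have "\<dots> = (\<Sum>x\<in>set_pmf Q. \<Sum>i<d. \<Sum>j<d. of_real (pmf Q x) * (cnj (f i) * F x $$ (i, j) * f j))"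
      by (rule sum.swap)
    also have "\<dots> = (\<Sum>x\<in>set_pmf Q. of_real (pmf Q x) * quad d (F x) f)"
      by (simp add: quad_def sum_distrib_left)
    moreover have "0 \<le> complex_of_real (pmf Q x)" for x by (simp add: less_eq_complex_def)
    ultimately show ?thesis
      using F by (auto intro!: sum_nonneg mult_nonneg_nonneg positive_semidef_quad density_psd)
  qed
  moreover have "mat_trace (mixture d Q F) = 1"
  proof -
    have "mat_trace (mixture d Q F) = mat_trace (mixture d Q F * 1\<^sub>m d)" by simp
    also have "\<dots> = (\<Sum>x\<in>set_pmf Q. of_real (pmf Q x) * mat_trace (F x * 1\<^sub>m d))"
      using Fc by (rule mat_trace_mixture_mult) simp_all
    also have "\<dots> = of_real (\<Sum>x\<in>set_pmf Q. pmf Q x)"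
      unfolding of_real_sum using Fc F by (intro sum.cong refl) (auto simp: density_operators_def)
    finally show ?thesis using assms by (simp add: sum_pmf_support)
  qed
  ultimately show ?thesis by (simp add: density_operators_def positive_semidef_iff_quad)
qed

section \<open>Joint convexity of the relative entropy\<close>

text \<open>
  In eigenbases of \<open>\<rho>\<close> and \<open>\<sigma>\<close> the relative entropy is \<open>\<integral>\<^sub>0\<^sup>1 (1 - s) G s ds\<close> with \<open>G\<close> the function
  \<open>div_int\<close> below; this is Taylor's formula for \<open>p ln p\<close>. For fixed \<open>s\<close>, \<open>G s\<close> is a maximum over \<open>Y\<close>
  of functions \<open>div_lower\<close> that are affine in \<open>(\<rho>, \<sigma>)\<close>, so it is jointly convex.
\<close>

definition div_int :: "nat \<Rightarrow> complex mat \<Rightarrow> (nat \<Rightarrow> real) \<Rightarrow> complex mat \<Rightarrow> (nat \<Rightarrow> real) \<Rightarrow> real \<Rightarrow> real" where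
  "div_int d U p V q s =
     (\<Sum>i<d. \<Sum>j<d. overlap U V i j * ((p i - q j)\<^sup>2 / ((1 - s) * q j + s * p i)))"

definition div_lower :: "real \<Rightarrow> complex mat \<Rightarrow> complex mat \<Rightarrow> complex mat \<Rightarrow> real" where
  "div_lower s Y \<rho> \<sigma> =
     2 * (Re (mat_trace (\<rho> * mat_adjoint Y)) - Re (mat_trace (\<sigma> * mat_adjoint Y)))
     - (1 - s) * Re (mat_trace (\<sigma> * (mat_adjoint Y * Y)))
     - s * Re (mat_trace (\<rho> * (Y * mat_adjoint Y)))"

text \<open>With \<open>Y\<close> expanded between the two eigenbases, all four traces become sums
  over the same pairs \<open>(i, j)\<close>. The maximization over \<open>Y\<close> thus decouples
  into one scalar quadratic problem for each entry of \<open>N\<close>.\<close>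

lemma div_lower_eq:
  assumes U: "unitary_mat d U" and V: "unitary_mat d V" and N: "N \<in> carrier_mat d d"
  defines "Y \<equiv> U * N * mat_adjoint V" and "M \<equiv> mat_adjoint U * V"
  shows "div_lower s Y (U * rdiag d p * mat_adjoint U) (V * rdiag d q * mat_adjoint V)
    = (\<Sum>i<d. \<Sum>j<d. 2 * (p i - q j) * Re (cnj (N $$ (i, j)) * M $$ (i, j))
         - ((1 - s) * q j + s * p i) * (cmod (N $$ (i, j)))\<^sup>2)"
proof -
  note c = unitary_mat_carrier[OF U] unitary_mat_carrier[OF V]
  note assoc = square_mult_assoc[where d = d] and adj = mat_adjoint_mult[of _ d d _ d]
  have M: "M \<in> carrier_mat d d" using c by (simp add: M_def)
  have M': "mat_adjoint V * U = mat_adjoint M" using c by (simp add: M_def adj)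
  have Y': "mat_adjoint Y = V * (mat_adjoint N * mat_adjoint U)"
    using c N by (simp add: Y_def adj assoc)
  have Yc: "Y \<in> carrier_mat d d" using c N by (simp add: Y_def)
  have UU: "mat_adjoint U * U = 1\<^sub>m d" "mat_adjoint V * V = 1\<^sub>m d"
    using U V by (auto simp: unitary_mat_def)
  have conj: "mat_trace (X * A * mat_adjoint X * B) = mat_trace (A * (mat_adjoint X * B * X))"
    if "X \<in> carrier_mat d d" "A \<in> carrier_mat d d" "B \<in> carrier_mat d d" for X A B :: "complex mat"
    using mat_trace_comm[of X d d "A * mat_adjoint X * B"] that by (simp add: assoc)
  have 1: "mat_trace (U * rdiag d p * mat_adjoint U * mat_adjoint Y)
    = (\<Sum>i<d. \<Sum>j<d. of_real (p i) * (cnj (N $$ (i, j)) * M $$ (i, j)))"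
  proof -
    have "mat_adjoint U * mat_adjoint Y * U = M * mat_adjoint N"
      using c N UU M by (simp add: Y' assoc M_def)
    then have "mat_trace (U * rdiag d p * mat_adjoint U * mat_adjoint Y) = mat_trace (rdiag d p * M * mat_adjoint N)"
      using conj[of U "rdiag d p" "mat_adjoint Y"] square_mult_assoc[of "rdiag d p" d "M" "mat_adjoint N"] c N Yc M by simp
    also have "\<dots> = (\<Sum>i<d. \<Sum>j<d. of_real (p i) * (cnj (N $$ (i, j)) * M $$ (i, j)))"
      using M N by (subst mat_trace_mult[of _ d d]) (auto simp: mat_diag_mult_left[of _ d d] intro!: sum.cong)
    finally show ?thesis .
  qed
  have 2: "mat_trace (V * rdiag d q * mat_adjoint V * mat_adjoint Y)
    = (\<Sum>i<d. \<Sum>j<d. of_real (q j) * (cnj (N $$ (i, j)) * M $$ (i, j)))"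
  proof -
    have "mat_adjoint V * mat_adjoint Y * V = mat_adjoint N * M"
      using c N UU M unitary_mat_cancel[OF V] by (simp add: Y' assoc M_def)
    then have "mat_trace (V * rdiag d q * mat_adjoint V * mat_adjoint Y) = mat_trace (rdiag d q * mat_adjoint N * M)"
      using conj[of V "rdiag d q" "mat_adjoint Y"] square_mult_assoc[of "rdiag d q" d "mat_adjoint N" "M"] c N Yc M by simp
    also have "\<dots> = (\<Sum>j<d. \<Sum>i<d. of_real (q j) * (cnj (N $$ (i, j)) * M $$ (i, j)))"
      using M N by (subst mat_trace_mult[of _ d d]) (auto simp: mat_diag_mult_left[of _ d d] intro!: sum.cong)
    also have "\<dots> = (\<Sum>i<d. \<Sum>j<d. of_real (q j) * (cnj (N $$ (i, j)) * M $$ (i, j)))"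
      by (rule sum.swap)
    finally show ?thesis .
  qed
  have 3: "mat_trace (V * rdiag d q * mat_adjoint V * (mat_adjoint Y * Y))
    = (\<Sum>i<d. \<Sum>j<d. of_real (q j * (cmod (N $$ (i, j)))\<^sup>2))"
  proof -
    have "mat_adjoint V * (mat_adjoint Y * Y) * V = mat_adjoint N * N"
      unfolding Y' using c N UU unitary_mat_cancel[OF V] unitary_mat_cancel[OF U] by (simp add: Y_def assoc)
    then have "mat_trace (V * rdiag d q * mat_adjoint V * (mat_adjoint Y * Y)) = mat_trace (rdiag d q * mat_adjoint N * N)"
      using conj[of V "rdiag d q" "mat_adjoint Y * Y"] square_mult_assoc[of "rdiag d q" d "mat_adjoint N" "N"] c N Yc by simp
    also have "\<dots> = (\<Sum>j<d. \<Sum>i<d. of_real (q j * (cmod (N $$ (i, j)))\<^sup>2))"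
      using N by (subst mat_trace_mult[of _ d d])
        (auto simp: mat_diag_mult_left[of _ d d] complex_norm_square mult_ac simp del: of_real_power intro!: sum.cong)
    also have "\<dots> = (\<Sum>i<d. \<Sum>j<d. of_real (q j * (cmod (N $$ (i, j)))\<^sup>2))"
      by (rule sum.swap)
    finally show ?thesis .
  qed
  have 4: "mat_trace (U * rdiag d p * mat_adjoint U * (Y * mat_adjoint Y))
    = (\<Sum>i<d. \<Sum>j<d. of_real (p i * (cmod (N $$ (i, j)))\<^sup>2))"
  proof -
    have "mat_adjoint U * (Y * mat_adjoint Y) * U = N * mat_adjoint N"
      unfolding Y' using c N UU unitary_mat_cancel[OF V] unitary_mat_cancel[OF U] by (simp add: Y_def assoc)
    then have "mat_trace (U * rdiag d p * mat_adjoint U * (Y * mat_adjoint Y)) = mat_trace (rdiag d p * N * mat_adjoint N)"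
      using conj[of U "rdiag d p" "Y * mat_adjoint Y"] square_mult_assoc[of "rdiag d p" d "N" "mat_adjoint N"] c N Yc by simp
    also have "\<dots> = (\<Sum>i<d. \<Sum>j<d. of_real (p i * (cmod (N $$ (i, j)))\<^sup>2))"
      using N by (subst mat_trace_mult[of _ d d])
        (auto simp: mat_diag_mult_left[of _ d d] complex_norm_square mult_ac simp del: of_real_power intro!: sum.cong)
    finally show ?thesis .
  qed
  show ?thesis
    unfolding div_lower_def 1 2 3 4
    by (simp add: algebra_simps sum.distrib sum_subtractf sum_distrib_left)
qed

text \<open>Completing the square: for \<open>r > 0\<close> the difference of the two sides is the
  squared modulus of \<open>a * m - r * y\<close>, divided by \<open>r\<close>. For
  \<open>r = 0\<close> the quotient on the right is \<open>0\<close> by convention, and the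
  hypothesis makes the left side vanish as well.\<close>

lemma weighted_square_le:
  fixes y m :: complex
  assumes "r = 0 \<Longrightarrow> a = 0" "0 \<le> r"
  shows "2 * a * Re (cnj y * m) - r * (cmod y)\<^sup>2 \<le> (cmod m)\<^sup>2 * (a\<^sup>2 / r)"
proof (cases "r = 0")
  case False
  then have r: "r > 0" using assms by simp
  have "0 \<le> (cmod (of_real a * m - of_real r * y))\<^sup>2" by simp
  also have "\<dots> = a\<^sup>2 * (cmod m)\<^sup>2 - 2 * a * r * Re (cnj y * m) + r\<^sup>2 * (cmod y)\<^sup>2"
    unfolding cmod_power2 by (simp add: algebra_simps power2_eq_square)
  finally have "r * (2 * a * Re (cnj y * m) - r * (cmod y)\<^sup>2) \<le> a\<^sup>2 * (cmod m)\<^sup>2"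
    by (simp add: algebra_simps power2_eq_square)
  then show ?thesis using r by (simp add: field_simps)
qed (use assms in simp)

lemma div_lower_le:
  assumes \<rho>: "diagonalizes d U p \<rho>" and \<sigma>: "diagonalizes d V q \<sigma>"
    and pos: "\<And>i. i < d \<Longrightarrow> 0 \<le> p i" "\<And>i. i < d \<Longrightarrow> 0 \<le> q i" and s: "0 < s" "s < 1"
    and Y: "Y \<in> carrier_mat d d"
  shows "div_lower s Y \<rho> \<sigma> \<le> div_int d U p V q s"
proof -
  note u = diagonalizes_unitary[OF \<rho>] diagonalizes_unitary[OF \<sigma>]
  define N where "N = mat_adjoint U * Y * V"
  have N: "N \<in> carrier_mat d d" using u Y by (simp add: N_def)
  have "U * N * mat_adjoint V = Y"
    using u Y unitary_mat_cancel[OF u(1)] by (simp add: N_def square_mult_assoc[where d = d]) (simp add: unitary_mat_def)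
  then have "div_lower s Y \<rho> \<sigma> = (\<Sum>i<d. \<Sum>j<d. 2 * (p i - q j) * Re (cnj (N $$ (i, j)) * (mat_adjoint U * V) $$ (i, j))
         - ((1 - s) * q j + s * p i) * (cmod (N $$ (i, j)))\<^sup>2)"
    using div_lower_eq[OF u N, of s p q] by (simp add: diagonalizes_eq[OF \<rho>] diagonalizes_eq[OF \<sigma>])
  also have "\<dots> \<le> div_int d U p V q s"
    unfolding div_int_def overlap_def
  proof (intro sum_mono weighted_square_le)
    fix i j assume "i \<in> {..<d}" "j \<in> {..<d}"
    then have *: "0 \<le> (1 - s) * q j" "0 \<le> s * p i" using pos s by auto
    then show "0 \<le> (1 - s) * q j + s * p i" by simp
    assume "(1 - s) * q j + s * p i = 0"
    with * have "(1 - s) * q j = 0" "s * p i = 0" by linarith+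
    with s show "p i - q j = 0" by simp
  qed
  finally show ?thesis .
qed

text \<open>The maximizer makes the square behind \<open>weighted_square_le\<close> vanish for every
  pair: its entries are \<open>(p i - q j) / r i j\<close> times the inner products of the
  eigenvectors. A zero denominator gives the entry \<open>0\<close>, which is the right value there
  too.\<close>

lemma div_lower_attained:
  assumes \<rho>: "diagonalizes d U p \<rho>" and \<sigma>: "diagonalizes d V q \<sigma>"
  shows "\<exists>Y\<in>carrier_mat d d. div_lower s Y \<rho> \<sigma> = div_int d U p V q s"
proof -
  note u = diagonalizes_unitary[OF \<rho>] diagonalizes_unitary[OF \<sigma>]
  define r where "r i j = (1 - s) * q j + s * p i" for i j
  define N where "N = Matrix.mat d d (\<lambda>(i, j). of_real ((p i - q j) / r i j) * (mat_adjoint U * V) $$ (i, j))"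
  have N: "N \<in> carrier_mat d d" by (simp add: N_def)
  have "div_lower s (U * N * mat_adjoint V) \<rho> \<sigma> = div_int d U p V q s"
    unfolding diagonalizes_eq[OF \<rho>] diagonalizes_eq[OF \<sigma>] div_lower_eq[OF u N] div_int_def
      overlap_def r_def[symmetric]
  proof (intro sum.cong refl)
    fix i j assume ij: "i \<in> {..<d}" "j \<in> {..<d}"
    define m where "m = (mat_adjoint U * V) $$ (i, j)"
    define x where "x = (p i - q j) / r i j"
    have n: "N $$ (i, j) = of_real x * m" using ij by (simp add: N_def m_def x_def)
    have R: "Re (cnj (of_real x * m) * m) = x * (cmod m)\<^sup>2"
      unfolding cmod_power2 by (simp add: algebra_simps power2_eq_square)
    have "2 * (p i - q j) * (x * (cmod m)\<^sup>2) - r i j * (x\<^sup>2 * (cmod m)\<^sup>2)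
        = (cmod m)\<^sup>2 * ((p i - q j)\<^sup>2 / r i j)"
    proof (cases "r i j = 0")
      case False
      then have "r i j * x\<^sup>2 = (p i - q j) * x" by (simp add: x_def power2_eq_square)
      then have "2 * (p i - q j) * (x * (cmod m)\<^sup>2) - r i j * (x\<^sup>2 * (cmod m)\<^sup>2) = (p i - q j) * x * (cmod m)\<^sup>2"
        by (simp only: mult.assoc[symmetric])
      then show ?thesis by (simp add: x_def power2_eq_square)
    qed (simp add: x_def)
    then show "2 * (p i - q j) * Re (cnj (N $$ (i, j)) * (mat_adjoint U * V) $$ (i, j)) - r i j * (cmod (N $$ (i, j)))\<^sup>2
      = (cmod ((mat_adjoint U * V) $$ (i, j)))\<^sup>2 * ((p i - q j)\<^sup>2 / r i j)"
      unfolding n m_def[symmetric] R by (simp add: norm_mult power_mult_distrib)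
  qed
  with N u show ?thesis by (intro bexI[of _ "U * N * mat_adjoint V"]) auto
qed

lemma div_lower_mixture:
  assumes "\<And>x. x \<in> set_pmf G \<Longrightarrow> \<rho> x \<in> carrier_mat d d" "\<And>x. x \<in> set_pmf G \<Longrightarrow> \<sigma> x \<in> carrier_mat d d"
    and Y: "Y \<in> carrier_mat d d"
  shows "div_lower s Y (mixture d G \<rho>) (mixture d G \<sigma>) = (\<Sum>x\<in>set_pmf G. pmf G x * div_lower s Y (\<rho> x) (\<sigma> x))"
  unfolding div_lower_def using assms
  by (simp add: mat_trace_mixture_mult sum_distrib_left sum_subtractf[symmetric] algebra_simps)

text \<open>The maximizer for the mixtures is one competitor for each component, and
  \<open>div_lower\<close> is affine for fixed \<open>Y\<close>.\<close>

lemma div_int_mixture_le: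
  assumes \<rho>: "\<And>x. x \<in> set_pmf G \<Longrightarrow> diagonalizes d (U x) (p x) (\<rho> x)"
    and \<sigma>: "\<And>x. x \<in> set_pmf G \<Longrightarrow> diagonalizes d (V x) (q x) (\<sigma> x)"
    and pos: "\<And>x i. x \<in> set_pmf G \<Longrightarrow> i < d \<Longrightarrow> 0 \<le> p x i" "\<And>x i. x \<in> set_pmf G \<Longrightarrow> i < d \<Longrightarrow> 0 \<le> q x i"
    and mix: "diagonalizes d U' p' (mixture d G \<rho>)" "diagonalizes d V' q' (mixture d G \<sigma>)"
    and s: "0 < s" "s < 1"
  shows "div_int d U' p' V' q' s \<le> (\<Sum>x\<in>set_pmf G. pmf G x * div_int d (U x) (p x) (V x) (q x) s)"
proof -
  obtain Y where Y: "Y \<in> carrier_mat d d"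
    "div_lower s Y (mixture d G \<rho>) (mixture d G \<sigma>) = div_int d U' p' V' q' s"
    using div_lower_attained[OF mix] by blast
  have "div_int d U' p' V' q' s = (\<Sum>x\<in>set_pmf G. pmf G x * div_lower s Y (\<rho> x) (\<sigma> x))"
    unfolding Y(2)[symmetric] using \<rho> \<sigma> Y(1) by (intro div_lower_mixture) (auto intro: diagonalizes_carrier)
  also have "\<dots> \<le> (\<Sum>x\<in>set_pmf G. pmf G x * div_int d (U x) (p x) (V x) (q x) s)"
    using div_lower_le[OF \<rho> \<sigma> _ _ s Y(1)] pos by (intro sum_mono mult_left_mono) auto
  finally show ?thesis .
qed

text \<open>Along the segment \<open>r\<close> from \<open>q\<close> to \<open>p\<close> an
  antiderivative is \<open>c * (p * ln (r s) - r s)\<close>. If \<open>p = 0\<close>, the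
  singularity of the logarithm at \<open>s = 1\<close> carries the factor \<open>p\<close>. If
  \<open>q = 0\<close>, the singularity at \<open>s = 0\<close> is excluded by
  \<open>p * c = 0\<close>, and the integrand vanishes.\<close>

lemma div_int_term_integral:
  fixes p q c :: real
  assumes "0 \<le> p" "0 \<le> q" "q = 0 \<Longrightarrow> p * c = 0"
  shows "((\<lambda>s. (1 - s) * (c * ((p - q)\<^sup>2 / ((1 - s) * q + s * p)))) has_integral
           c * (p * ln p - p * ln q - p + q)) {0..1}"
proof (cases "c = 0 \<or> q = 0")
  case True
  then have "c = 0 \<or> (p = 0 \<and> q = 0)" using assms(3) by auto
  then show ?thesis by auto
next
  case False
  then have q: "q > 0" using assms by simp
  define r where "r s = (1 - s) * q + s * p" for s
  have r: "r s > 0" if "0 \<le> s" "s < 1 \<or> p > 0" "s \<le> 1" for s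
    using that q assms(1) unfolding r_def
    by (cases "s = 1") (auto intro!: add_pos_nonneg mult_pos_pos)
  define F where "F s = c * (p * ln (r s) - r s)" for s
  have cont_r: "continuous_on {0..1} r" unfolding r_def by (intro continuous_intros)
  have "continuous_on {0..1} F"
  proof (cases "p = 0")
    case True
    then show ?thesis unfolding F_def by (auto intro!: continuous_intros cont_r)
  next
    case False
    then have "r s \<noteq> 0" if "s \<in> {0..1}" for s using r[of s] that assms(1) by auto
    then show ?thesis unfolding F_def by (intro continuous_intros cont_r) auto
  qed
  moreover have "(F has_vector_derivative (1 - s) * (c * ((p - q)\<^sup>2 / r s))) (at s)" if "s \<in> {0<..<1}" for s
  proof -
    have rs: "r s > 0" using r[of s] that by auto
    have "(r has_real_derivative (p - q)) (at s)"
      unfolding r_def by (auto intro!: derivative_eq_intros)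
    then have "(F has_real_derivative c * (p * ((p - q) / r s) - (p - q))) (at s)"
      unfolding F_def using rs by (auto intro!: derivative_eq_intros simp: divide_inverse)
    moreover have "c * (p * ((p - q) / r s) - (p - q)) = (1 - s) * (c * ((p - q)\<^sup>2 / r s))"
    proof -
      have "p - r s = (1 - s) * (p - q)" by (simp add: r_def algebra_simps)
      then have "(p - r s) * ((p - q) / r s) = (1 - s) * ((p - q)\<^sup>2 / r s)" by (simp add: power2_eq_square)
      moreover have "p * ((p - q) / r s) - (p - q) = (p - r s) * ((p - q) / r s)"
        using rs by (simp add: field_simps)
      ultimately have "p * ((p - q) / r s) - (p - q) = (1 - s) * ((p - q)\<^sup>2 / r s)" by (rule trans[rotated])
      then show ?thesis by (simp only: mult.left_commute)
    qed
    ultimately show ?thesis by (simp add: has_real_derivative_iff_has_vector_derivative)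
  qed
  ultimately have "((\<lambda>s. (1 - s) * (c * ((p - q)\<^sup>2 / r s))) has_integral F 1 - F 0) {0..1}"
    by (intro fundamental_theorem_of_calculus_interior) auto
  also have "F 1 - F 0 = c * (p * ln p - p * ln q - p + q)"
    by (simp add: F_def r_def algebra_simps)
  finally show ?thesis by (simp add: r_def)
qed

text \<open>Natural logarithms suit the integral formula; the factor \<open>ln 2\<close> comes back
  in \<open>holevo_eq_relative_entropy\<close>. Because of \<open>ln 0 = 0\<close>, this is the
  usual quantity only if the support of \<open>\<rho>\<close> lies in that of
  \<open>\<sigma>\<close>.\<close>

definition relative_entropy :: "complex mat \<Rightarrow> complex mat \<Rightarrow> real" where
  "relative_entropy \<rho> \<sigma> = Re (mat_trace (\<rho> * mat_fun ln \<rho>)) - Re (mat_trace (\<rho> * mat_fun ln \<sigma>))"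

text \<open>Inclusion of supports, stated through traces against positive matrices: in this form it
  passes to mixtures by linearity of the trace.\<close>

definition support_le :: "nat \<Rightarrow> complex mat \<Rightarrow> complex mat \<Rightarrow> bool" where
  "support_le d \<rho> \<sigma> \<longleftrightarrow> (\<forall>P. positive_semidef d P \<longrightarrow> mat_trace (\<sigma> * P) = 0 \<longrightarrow> mat_trace (\<rho> * P) = 0)"

lemma mat_fun_carrier: "diagonalizes d U l A \<Longrightarrow> mat_fun f A \<in> carrier_mat d d"
  using diagonalizes_unitary[of d U l A] by (simp add: mat_fun_eq)

lemma relative_entropy_integral:
  assumes \<rho>: "diagonalizes d U p \<rho>" "\<And>i. i < d \<Longrightarrow> 0 \<le> p i" "(\<Sum>i<d. p i) = 1"
    and \<sigma>: "diagonalizes d V q \<sigma>" "\<And>i. i < d \<Longrightarrow> 0 \<le> q i" "(\<Sum>i<d. q i) = 1"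
    and supp: "support_le d \<rho> \<sigma>"
  shows "((\<lambda>s. (1 - s) * div_int d U p V q s) has_integral relative_entropy \<rho> \<sigma>) {0..1}"
proof -
  note u = diagonalizes_unitary[OF \<rho>(1)] diagonalizes_unitary[OF \<sigma>(1)]
  let ?c = "overlap U V"
  \<comment> \<open>The projection on the \<open>j\<close>-th eigenvector of \<open>\<sigma>\<close>
    has trace zero against \<open>\<sigma>\<close>, hence against \<open>\<rho>\<close>. In the
    eigenbasis of \<open>\<rho>\<close> the latter trace is a sum of nonnegative terms, so each of
    them is zero.\<close>
  have zero: "p i * ?c i j = 0" if ij: "i < d" "j < d" and q: "q j = 0" for i j
  proof -
    let ?e = "\<lambda>k. if k = j then 1 else 0 :: real"
    let ?P = "V * rdiag d ?e * mat_adjoint V"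
    have e: "(\<Sum>k<d. f k * ?e k) = f j" for f
      using ij by (simp add: if_distrib cong: if_cong)
    have P: "positive_semidef d ?P" using u by (intro positive_semidef_diag_conj) auto
    have "mat_trace (\<sigma> * ?P) = of_real (\<Sum>k<d. q k * ?e k)"
      by (subst diagonalizes_eq[OF \<sigma>(1)], subst mat_trace_diag_mult[OF u(2,2)], subst sum_overlap_self[OF u(2)]) simp
    then have "mat_trace (\<sigma> * ?P) = 0" by (simp only: e q of_real_0)
    then have "mat_trace (\<rho> * ?P) = 0" using supp P unfolding support_le_def by blast
    also have "mat_trace (\<rho> * ?P) = of_real (\<Sum>i<d. \<Sum>k<d. ?c i k * p i * ?e k)"
      by (subst diagonalizes_eq[OF \<rho>(1)], subst mat_trace_diag_mult[OF u]) simp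
    also have "\<dots> = of_real (\<Sum>i<d. ?c i j * p i)"
      by (simp only: e)
    finally have "(\<Sum>i<d. ?c i j * p i) = 0" by (simp only: of_real_eq_0_iff)
    then show ?thesis using ij \<rho>(2) by (subst (asm) sum_nonneg_eq_0_iff) auto
  qed
  have "((\<lambda>s. \<Sum>i<d. \<Sum>j<d. (1 - s) * (?c i j * ((p i - q j)\<^sup>2 / ((1 - s) * q j + s * p i)))) has_integral
     (\<Sum>i<d. \<Sum>j<d. ?c i j * (p i * ln (p i) - p i * ln (q j) - p i + q j))) {0..1}"
    using zero \<rho>(2) \<sigma>(2) by (intro has_integral_sum div_int_term_integral) auto
  moreover have "(\<Sum>i<d. \<Sum>j<d. ?c i j * (p i * ln (p i) - p i * ln (q j) - p i + q j)) = relative_entropy \<rho> \<sigma>"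
  proof -
    have 1: "Re (mat_trace (\<rho> * mat_fun ln \<rho>)) = (\<Sum>i<d. p i * ln (p i))"
      using mat_trace_diag_mult[OF u(1,1), of p "\<lambda>i. ln (p i)"] unfolding sum_overlap_self[OF u(1)]
      by (simp add: mat_fun_eq[OF \<rho>(1)] diagonalizes_eq[OF \<rho>(1), symmetric])
    have 2: "Re (mat_trace (\<rho> * mat_fun ln \<sigma>)) = (\<Sum>i<d. \<Sum>j<d. ?c i j * p i * ln (q j))"
      using mat_trace_diag_mult[OF u, of p "\<lambda>i. ln (q i)"]
      by (simp only: mat_fun_eq[OF \<sigma>(1)] diagonalizes_eq[OF \<rho>(1), symmetric] Re_complex_of_real)
    \<comment> \<open>As the overlaps are doubly stochastic, the two linear terms reduce to the
      traces of \<open>\<rho>\<close> and \<open>\<sigma>\<close>; both are \<open>1\<close> and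
      they cancel.\<close>
    have row: "(\<Sum>i<d. \<Sum>j<d. ?c i j * g i) = (\<Sum>i<d. g i)" for g
      using overlap_sums(1)[OF u] by (simp add: sum_distrib_right[symmetric])
    have col: "(\<Sum>i<d. \<Sum>j<d. ?c i j * g j) = (\<Sum>j<d. g j)" for g
      using overlap_sums(2)[OF u] by (subst sum.swap) (simp add: sum_distrib_right[symmetric])
    have "(\<Sum>i<d. \<Sum>j<d. ?c i j * (p i * ln (p i) - p i * ln (q j) - p i + q j))
      = (\<Sum>i<d. \<Sum>j<d. ?c i j * (p i * ln (p i))) - (\<Sum>i<d. \<Sum>j<d. ?c i j * p i * ln (q j))
        - (\<Sum>i<d. \<Sum>j<d. ?c i j * p i) + (\<Sum>i<d. \<Sum>j<d. ?c i j * q j)"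
      by (simp add: algebra_simps sum.distrib sum_subtractf)
    then show ?thesis unfolding row col relative_entropy_def 1 2 by (simp add: \<rho>(3) \<sigma>(3))
  qed
  ultimately show ?thesis by (simp add: div_int_def sum_distrib_left)
qed

text \<open>A sum of nonnegative traces with positive weights is zero only if each trace is. The
  second claim says that a mixture dominates its components, which supplies the support condition
  for Holevo quantities.\<close>

lemma support_le_mixture:
  assumes fin: "finite (set_pmf G)"
    and d: "\<And>x. x \<in> set_pmf G \<Longrightarrow> \<sigma> x \<in> density_operators d" "\<And>x. x \<in> set_pmf G \<Longrightarrow> \<rho> x \<in> carrier_mat d d"
    and supp: "\<And>x. x \<in> set_pmf G \<Longrightarrow> support_le d (\<rho> x) (\<sigma> x)"
  shows "support_le d (mixture d G \<rho>) (mixture d G \<sigma>)"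
    and "x \<in> set_pmf G \<Longrightarrow> support_le d (\<sigma> x) (mixture d G \<sigma>)"
proof -
  have 1: "mat_trace (\<sigma> x * P) = 0"
    if P: "positive_semidef d P" and z: "mat_trace (mixture d G \<sigma> * P) = 0" and x: "x \<in> set_pmf G" for P x
  proof -
    have "(\<Sum>x\<in>set_pmf G. complex_of_real (pmf G x) * mat_trace (\<sigma> x * P)) = 0"
      using z P d(1) by (subst (asm) mat_trace_mixture_mult) (auto intro: density_carrier)
    moreover have "0 \<le> complex_of_real (pmf G x) * mat_trace (\<sigma> x * P)" if "x \<in> set_pmf G" for x
      using d(1)[OF that] P
      by (intro mult_nonneg_nonneg mat_trace_mult_nonneg) (auto intro: density_psd simp: less_eq_complex_def)
    ultimately have "complex_of_real (pmf G x) * mat_trace (\<sigma> x * P) = 0"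
      using fin x by (subst (asm) sum_nonneg_eq_0_iff) auto
    then show ?thesis using x by (simp add: set_pmf_iff)
  qed
  then show "x \<in> set_pmf G \<Longrightarrow> support_le d (\<sigma> x) (mixture d G \<sigma>)"
    by (simp add: support_le_def)
  show "support_le d (mixture d G \<rho>) (mixture d G \<sigma>)"
    unfolding support_le_def
  proof (intro allI impI)
    fix P assume P: "positive_semidef d P" "mat_trace (mixture d G \<sigma> * P) = 0"
    have "mat_trace (\<rho> x * P) = 0" if "x \<in> set_pmf G" for x
      using supp[OF that] 1[OF P that] P(1) by (simp add: support_le_def)
    then show "mat_trace (mixture d G \<rho> * P) = 0"
      using P(1) d(2) by (subst mat_trace_mixture_mult) auto
  qed
qed

theorem relative_entropy_mixture_le:
  assumes fin: "finite (set_pmf G)"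
    and \<rho>: "\<And>x. x \<in> set_pmf G \<Longrightarrow> \<rho> x \<in> density_operators d"
    and \<sigma>: "\<And>x. x \<in> set_pmf G \<Longrightarrow> \<sigma> x \<in> density_operators d"
    and supp: "\<And>x. x \<in> set_pmf G \<Longrightarrow> support_le d (\<rho> x) (\<sigma> x)"
  shows "relative_entropy (mixture d G \<rho>) (mixture d G \<sigma>) \<le> (\<Sum>x\<in>set_pmf G. pmf G x * relative_entropy (\<rho> x) (\<sigma> x))"
proof -
  have "\<forall>x\<in>set_pmf G. \<exists>U l. diagonalizes d U l (\<rho> x) \<and> (\<forall>i<d. 0 \<le> l i) \<and> (\<Sum>i<d. l i) = 1"
    using density_diagonalizable[OF \<rho>] by metis
  then obtain U p where P: "\<And>x. x \<in> set_pmf G \<Longrightarrow> diagonalizes d (U x) (p x) (\<rho> x)"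
    "\<And>x i. x \<in> set_pmf G \<Longrightarrow> i < d \<Longrightarrow> 0 \<le> p x i" "\<And>x. x \<in> set_pmf G \<Longrightarrow> (\<Sum>i<d. p x i) = 1"
    by metis
  have "\<forall>x\<in>set_pmf G. \<exists>U l. diagonalizes d U l (\<sigma> x) \<and> (\<forall>i<d. 0 \<le> l i) \<and> (\<Sum>i<d. l i) = 1"
    using density_diagonalizable[OF \<sigma>] by metis
  then obtain V q where Q: "\<And>x. x \<in> set_pmf G \<Longrightarrow> diagonalizes d (V x) (q x) (\<sigma> x)"
    "\<And>x i. x \<in> set_pmf G \<Longrightarrow> i < d \<Longrightarrow> 0 \<le> q x i" "\<And>x. x \<in> set_pmf G \<Longrightarrow> (\<Sum>i<d. q x i) = 1"
    by metis
  have mix: "mixture d G \<rho> \<in> density_operators d" "mixture d G \<sigma> \<in> density_operators d"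
    using mixture_density[OF fin, of \<rho> d] mixture_density[OF fin, of \<sigma> d] \<rho> \<sigma> by auto
  obtain U' p' where P': "diagonalizes d U' p' (mixture d G \<rho>)" "\<And>i. i < d \<Longrightarrow> 0 \<le> p' i" "(\<Sum>i<d. p' i) = 1"
    using density_diagonalizable[OF mix(1)] by blast
  obtain V' q' where Q': "diagonalizes d V' q' (mixture d G \<sigma>)" "\<And>i. i < d \<Longrightarrow> 0 \<le> q' i" "(\<Sum>i<d. q' i) = 1"
    using density_diagonalizable[OF mix(2)] by blast
  \<comment> \<open>The endpoints are removed because the integrands are compared only for
    \<open>0 < s < 1\<close>.\<close>
  have mix_int: "((\<lambda>s. (1 - s) * div_int d U' p' V' q' s) has_integral relative_entropy (mixture d G \<rho>) (mixture d G \<sigma>)) {0<..<1}"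
    using relative_entropy_integral[OF P' Q' support_le_mixture(1)[OF fin \<sigma> density_carrier[OF \<rho>] supp]]
    by (simp add: has_integral_Icc_iff_Ioo)
  have "((\<lambda>s. \<Sum>x\<in>set_pmf G. pmf G x * ((1 - s) * div_int d (U x) (p x) (V x) (q x) s)) has_integral
      (\<Sum>x\<in>set_pmf G. pmf G x * relative_entropy (\<rho> x) (\<sigma> x))) {0<..<1}"
    using relative_entropy_integral[OF P Q supp] fin
    by (intro has_integral_sum has_integral_mult_right) (auto simp: has_integral_Icc_iff_Ioo)
  with mix_int show ?thesis
  proof (rule has_integral_le)
    fix s :: real assume s: "s \<in> {0<..<1}"
    have "div_int d U' p' V' q' s \<le> (\<Sum>x\<in>set_pmf G. pmf G x * div_int d (U x) (p x) (V x) (q x) s)"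
      using P Q P'(1) Q'(1) s by (intro div_int_mixture_le) auto
    then have "(1 - s) * div_int d U' p' V' q' s \<le> (1 - s) * (\<Sum>x\<in>set_pmf G. pmf G x * div_int d (U x) (p x) (V x) (q x) s)"
      using s by (intro mult_left_mono) auto
    then show "(1 - s) * div_int d U' p' V' q' s \<le> (\<Sum>x\<in>set_pmf G. pmf G x * ((1 - s) * div_int d (U x) (p x) (V x) (q x) s))"
      by (simp add: sum_distrib_left mult_ac)
  qed
qed

section \<open>The Holevo quantity\<close>

lemma von_neumann_entropy_ln:
  assumes "diagonalizes d U l \<rho>"
  shows "von_neumann_entropy \<rho> = - Re (mat_trace (\<rho> * mat_fun ln \<rho>)) / ln 2"
proof -
  note u = diagonalizes_unitary[OF assms]
  have 1: "Re (mat_trace (\<rho> * mat_fun ln \<rho>)) = (\<Sum>i<d. l i * ln (l i))"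
    using mat_trace_diag_mult[OF u u, of l "\<lambda>i. ln (l i)"] unfolding sum_overlap_self[OF u]
    by (simp add: mat_fun_eq[OF assms] diagonalizes_eq[OF assms, symmetric])
  show ?thesis unfolding von_neumann_entropy_eq[OF assms] 1
    by (simp add: log_def sum_divide_distrib)
qed

text \<open>The cross term is linear in its first argument, so its average is the entropy term of
  the mixture.\<close>

lemma holevo_eq_relative_entropy:
  assumes fin: "finite (set_pmf Q)" and \<rho>: "\<And>x. x \<in> set_pmf Q \<Longrightarrow> \<rho> x \<in> density_operators d"
  shows "holevo d Q \<rho> = (\<Sum>x\<in>set_pmf Q. pmf Q x * relative_entropy (\<rho> x) (mixture d Q \<rho>)) / ln 2"
proof -
  have "mixture d Q \<rho> \<in> density_operators d" using mixture_density[OF fin, of \<rho> d] \<rho> by blast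
  then obtain V q where V: "diagonalizes d V q (mixture d Q \<rho>)"
    using density_diagonalizable by blast
  let ?L = "mat_fun ln (mixture d Q \<rho>)"
  have "(\<Sum>x\<in>set_pmf Q. pmf Q x * von_neumann_entropy (\<rho> x))
      = (\<Sum>x\<in>set_pmf Q. pmf Q x * (- Re (mat_trace (\<rho> x * mat_fun ln (\<rho> x))) / ln 2))"
  proof (intro sum.cong refl)
    fix x assume "x \<in> set_pmf Q"
    then obtain U l where "diagonalizes d U l (\<rho> x)" using density_diagonalizable[OF \<rho>] by blast
    from von_neumann_entropy_ln[OF this]
    show "pmf Q x * von_neumann_entropy (\<rho> x) = pmf Q x * (- Re (mat_trace (\<rho> x * mat_fun ln (\<rho> x))) / ln 2)"
      by simp
  qed
  moreover have "Re (mat_trace (mixture d Q \<rho> * ?L)) = (\<Sum>x\<in>set_pmf Q. pmf Q x * Re (mat_trace (\<rho> x * ?L)))"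
    using mat_fun_carrier[OF V] density_carrier[OF \<rho>] by (subst mat_trace_mixture_mult) simp_all
  ultimately show ?thesis
    unfolding holevo_def von_neumann_entropy_ln[OF V] relative_entropy_def
    by (simp add: sum_divide_distrib[symmetric] sum_negf right_diff_distrib sum_subtractf diff_divide_distrib)
qed

lemma mixture_swap:
  assumes "\<And>x y. x \<in> set_pmf Q \<Longrightarrow> y \<in> set_pmf G \<Longrightarrow> \<rho> x y \<in> carrier_mat d d"
  shows "mixture d Q (\<lambda>x. mixture d G (\<rho> x)) = mixture d G (\<lambda>y. mixture d Q (\<lambda>x. \<rho> x y))"
proof (rule eq_matI)
  fix i j assume "i < dim_row (mixture d G (\<lambda>y. mixture d Q (\<lambda>x. \<rho> x y)))"
    "j < dim_col (mixture d G (\<lambda>y. mixture d Q (\<lambda>x. \<rho> x y)))"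
  then have ij: "i < d" "j < d" by (auto simp: mixture_def mat_sum_def)
  have "mixture d Q (\<lambda>x. mixture d G (\<rho> x)) $$ (i, j)
    = (\<Sum>x\<in>set_pmf Q. \<Sum>y\<in>set_pmf G. of_real (pmf Q x) * (of_real (pmf G y) * \<rho> x y $$ (i, j)))"
    using assms by (subst mixture_index[OF _ ij], simp)
      (auto intro!: sum.cong simp: mixture_index[OF _ ij] sum_distrib_left)
  also have "\<dots> = (\<Sum>y\<in>set_pmf G. \<Sum>x\<in>set_pmf Q. of_real (pmf Q x) * (of_real (pmf G y) * \<rho> x y $$ (i, j)))"
    by (rule sum.swap)
  also have "\<dots> = mixture d G (\<lambda>y. mixture d Q (\<lambda>x. \<rho> x y)) $$ (i, j)"
    using assms by (subst mixture_index[OF _ ij], simp)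
      (auto intro!: sum.cong simp: mixture_index[OF _ ij] sum_distrib_left mult_ac)
  finally show "mixture d Q (\<lambda>x. mixture d G (\<rho> x)) $$ (i, j) = mixture d G (\<lambda>y. mixture d Q (\<lambda>x. \<rho> x y)) $$ (i, j)" .
qed (auto simp: mixture_def mat_sum_def)

lemma mixture_cong: "(\<And>x. x \<in> set_pmf Q \<Longrightarrow> F x = G x) \<Longrightarrow> mixture d Q F = mixture d Q G"
  by (simp add: mixture_def mat_sum_def)

text \<open>For each \<open>x\<close>, joint convexity is applied to the pairs of
  \<open>\<rho> x y\<close> and the average output at \<open>y\<close>. Since \<open>G\<close> does
  not depend on \<open>x\<close>, the two averages commute, and the second argument becomes the
  overall average output that the Holevo quantity on the left asks for.\<close>

theorem holevo_mixture_le: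
  assumes fin: "finite (set_pmf Q)" "finite (set_pmf G)"
    and \<rho>: "\<And>x y. x \<in> set_pmf Q \<Longrightarrow> y \<in> set_pmf G \<Longrightarrow> \<rho> x y \<in> density_operators d"
  shows "holevo d Q (\<lambda>x. mixture d G (\<rho> x)) \<le> (\<Sum>y\<in>set_pmf G. pmf G y * holevo d Q (\<lambda>x. \<rho> x y))"
proof -
  let ?m = "\<lambda>y. mixture d Q (\<lambda>x. \<rho> x y)"
  have m: "?m y \<in> density_operators d" if "y \<in> set_pmf G" for y
    using \<rho> that by (intro mixture_density fin) auto
  have "(\<Sum>x\<in>set_pmf Q. pmf Q x * relative_entropy (mixture d G (\<rho> x)) (mixture d G ?m))
     \<le> (\<Sum>x\<in>set_pmf Q. pmf Q x * (\<Sum>y\<in>set_pmf G. pmf G y * relative_entropy (\<rho> x y) (?m y)))"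
  proof (intro sum_mono mult_left_mono relative_entropy_mixture_le fin m \<rho>)
    fix x y assume xy: "x \<in> set_pmf Q" "y \<in> set_pmf G"
    show "support_le d (\<rho> x y) (?m y)"
      using support_le_mixture(2)[of Q "\<lambda>x. \<rho> x y" d "\<lambda>x. \<rho> x y" x] fin \<rho> xy
      by (auto intro: density_carrier simp: support_le_def)
  qed auto
  also have "\<dots> = (\<Sum>y\<in>set_pmf G. pmf G y * (\<Sum>x\<in>set_pmf Q. pmf Q x * relative_entropy (\<rho> x y) (?m y)))"
    unfolding sum_distrib_left by (subst sum.swap) (simp add: mult_ac)
  finally have *: "(\<Sum>x\<in>set_pmf Q. pmf Q x * relative_entropy (mixture d G (\<rho> x)) (mixture d G ?m))
     \<le> (\<Sum>y\<in>set_pmf G. pmf G y * (\<Sum>x\<in>set_pmf Q. pmf Q x * relative_entropy (\<rho> x y) (?m y)))" .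
  have "holevo d Q (\<lambda>x. mixture d G (\<rho> x))
    = (\<Sum>x\<in>set_pmf Q. pmf Q x * relative_entropy (mixture d G (\<rho> x)) (mixture d G ?m)) / ln 2"
  proof -
    have swap: "mixture d Q (\<lambda>x. mixture d G (\<rho> x)) = mixture d G ?m"
      by (rule mixture_swap) (auto intro: density_carrier \<rho>)
    have "mixture d G (\<rho> x) \<in> density_operators d" if "x \<in> set_pmf Q" for x
      using \<rho> that by (intro mixture_density fin) auto
    from holevo_eq_relative_entropy[OF fin(1), of "\<lambda>x. mixture d G (\<rho> x)" d, OF this]
    show ?thesis unfolding swap .
  qed
  also have "\<dots> \<le> (\<Sum>y\<in>set_pmf G. pmf G y * (\<Sum>x\<in>set_pmf Q. pmf Q x * relative_entropy (\<rho> x y) (?m y))) / ln 2"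
    by (rule divide_right_mono[OF *]) simp
  also have "\<dots> = (\<Sum>y\<in>set_pmf G. pmf G y * holevo d Q (\<lambda>x. \<rho> x y))"
    unfolding sum_divide_distrib using \<rho>
    by (intro sum.cong refl) (simp add: holevo_eq_relative_entropy[OF fin(1), of "\<lambda>x. \<rho> x _" d])
  finally show ?thesis .
qed

text \<open>A crude bound on both sides, whose purpose is to bring the leakage into a bounded range
  before sampling.\<close>

lemma holevo_bounds:
  assumes fin: "finite (set_pmf Q)" and \<rho>: "\<And>x. x \<in> set_pmf Q \<Longrightarrow> \<rho> x \<in> density_operators d"
  shows "\<bar>holevo d Q \<rho>\<bar> \<le> log 2 (real d)"
proof -
  have 1: "0 \<le> von_neumann_entropy (mixture d Q \<rho>)" "von_neumann_entropy (mixture d Q \<rho>) \<le> log 2 (real d)"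
    using von_neumann_entropy_bounds[OF mixture_density[OF fin \<rho>]] by auto
  have 2: "0 \<le> (\<Sum>x\<in>set_pmf Q. pmf Q x * von_neumann_entropy (\<rho> x))"
    using von_neumann_entropy_bounds[OF \<rho>] by (intro sum_nonneg) auto
  have "(\<Sum>x\<in>set_pmf Q. pmf Q x * von_neumann_entropy (\<rho> x)) \<le> (\<Sum>x\<in>set_pmf Q. pmf Q x * log 2 (real d))"
    using von_neumann_entropy_bounds[OF \<rho>] by (intro sum_mono mult_left_mono) auto
  also have "\<dots> = log 2 (real d)"
    using sum_pmf_support[OF fin] by (simp add: sum_distrib_right[symmetric])
  finally show ?thesis using 1 2 unfolding holevo_def by linarith
qed

section \<open>Tensor products\<close>

lemma tensor_mat_carrier [simp]:
  "A \<in> carrier_mat n m \<Longrightarrow> B \<in> carrier_mat k l \<Longrightarrow> tensor_mat A B \<in> carrier_mat (n * k) (m * l)"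
  by (auto simp: tensor_mat_def)

lemma tensor_mat_dim [simp]:
  "dim_row (tensor_mat A B) = dim_row A * dim_row B" "dim_col (tensor_mat A B) = dim_col A * dim_col B"
  by (auto simp: tensor_mat_def)

lemma tensor_mat_index:
  assumes "A \<in> carrier_mat n m" "B \<in> carrier_mat k l" "i < n * k" "j < m * l"
  shows "tensor_mat A B $$ (i, j) = A $$ (i div k, j div l) * B $$ (i mod k, j mod l)"
  using assms by (auto simp: tensor_mat_def)

lemma div_mod_less:
  fixes i n k :: nat
  assumes "i < n * k"
  shows "i div k < n" "i mod k < k"
  using assms by (auto simp: less_mult_imp_div_less intro!: mod_less_divisor gr0I)

text \<open>Pairs in lexicographic numbering, as in \<open>tensor_mat\<close>.\<close>

lemma sum_div_mod:
  fixes f :: "nat \<Rightarrow> nat \<Rightarrow> 'b::comm_monoid_add"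
  shows "(\<Sum>i<n * k. f (i div k) (i mod k)) = (\<Sum>a<n. \<Sum>b<k. f a b)"
proof -
  have "(\<Sum>i<n * k. f (i div k) (i mod k)) = (\<Sum>a<n. \<Sum>i = a * k..<a * k + k. f (i div k) (i mod k))"
    by (rule sum.nat_group[symmetric])
  also have "\<dots> = (\<Sum>a<n. \<Sum>b<k. f a b)"
  proof (rule sum.cong[OF refl])
    fix a
    have "(\<Sum>i = a * k..<a * k + k. f (i div k) (i mod k)) = (\<Sum>b<k. f ((b + a * k) div k) ((b + a * k) mod k))"
      using sum.shift_bounds_nat_ivl[of "\<lambda>i. f (i div k) (i mod k)" 0 "a * k" k]
      by (simp add: lessThan_atLeast0 add.commute)
    also have "\<dots> = (\<Sum>b<k. f a b)" by (intro sum.cong) auto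
    finally show "(\<Sum>i = a * k..<a * k + k. f (i div k) (i mod k)) = (\<Sum>b<k. f a b)" .
  qed
  finally show ?thesis .
qed

lemma tensor_mat_mult:
  assumes A: "A \<in> carrier_mat n m" and B: "B \<in> carrier_mat k l" and C: "C \<in> carrier_mat m p" and D: "D \<in> carrier_mat l q"
  shows "tensor_mat A B * tensor_mat C D = tensor_mat (A * C) (B * D)"
proof (rule eq_matI)
  fix i j assume "i < dim_row (tensor_mat (A * C) (B * D))" "j < dim_col (tensor_mat (A * C) (B * D))"
  then have ij: "i < n * k" "j < p * q" using assms by auto
  note b = div_mod_less[OF ij(1)] div_mod_less[OF ij(2)]
  have "(tensor_mat A B * tensor_mat C D) $$ (i, j)
    = (\<Sum>s<m * l. (A $$ (i div k, s div l) * B $$ (i mod k, s mod l)) * (C $$ (s div l, j div q) * D $$ (s mod l, j mod q)))"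
    using assms ij
    by (subst mult_mat_index[of _ "n * k" "m * l" _ "p * q"])
      (auto simp: tensor_mat_index[OF A B] tensor_mat_index[OF C D] intro!: sum.cong)
  also have "\<dots> = (\<Sum>a<m. \<Sum>b<l. (A $$ (i div k, a) * B $$ (i mod k, b)) * (C $$ (a, j div q) * D $$ (b, j mod q)))"
    by (rule sum_div_mod)
  also have "\<dots> = (\<Sum>a<m. A $$ (i div k, a) * C $$ (a, j div q)) * (\<Sum>b<l. B $$ (i mod k, b) * D $$ (b, j mod q))"
    by (simp add: sum_product mult_ac)
  also have "\<dots> = tensor_mat (A * C) (B * D) $$ (i, j)"
    using assms ij b by (subst tensor_mat_index[of _ n p _ k q])
      (auto simp: mult_mat_index[OF A C] mult_mat_index[OF B D])
  finally show "(tensor_mat A B * tensor_mat C D) $$ (i, j) = tensor_mat (A * C) (B * D) $$ (i, j)" .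
qed (use assms in auto)

lemma tensor_mat_adjoint: "mat_adjoint (tensor_mat A B) = tensor_mat (mat_adjoint A) (mat_adjoint B)"
proof (rule eq_matI)
  fix i j assume "i < dim_row (tensor_mat (mat_adjoint A) (mat_adjoint B))" "j < dim_col (tensor_mat (mat_adjoint A) (mat_adjoint B))"
  then have ij: "i < dim_col A * dim_col B" "j < dim_row A * dim_row B" by auto
  note b = div_mod_less[OF ij(1)] div_mod_less[OF ij(2)]
  show "mat_adjoint (tensor_mat A B) $$ (i, j) = tensor_mat (mat_adjoint A) (mat_adjoint B) $$ (i, j)"
    using ij b by (auto simp: tensor_mat_def)
qed auto

lemma tensor_mat_one: "tensor_mat (1\<^sub>m n) (1\<^sub>m k) = (1\<^sub>m (n * k) :: complex mat)"
proof (rule eq_matI)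
  fix i j assume "i < dim_row (1\<^sub>m (n * k) :: complex mat)" "j < dim_col (1\<^sub>m (n * k) :: complex mat)"
  then have ij: "i < n * k" "j < n * k" by auto
  note b = div_mod_less[OF ij(1)] div_mod_less[OF ij(2)]
  have "i = j \<longleftrightarrow> i div k = j div k \<and> i mod k = j mod k" by (metis div_mult_mod_eq)
  then show "tensor_mat (1\<^sub>m n) (1\<^sub>m k) $$ (i, j) = (1\<^sub>m (n * k) :: complex mat) $$ (i, j)"
    using ij b by (auto simp: tensor_mat_def)
qed auto

lemma tensor_mat_one_left [simp]: "tensor_mat (1\<^sub>m 1) A = A"
  by (rule eq_matI) (auto simp: tensor_mat_def)

lemma tensor_mat_assoc: "tensor_mat (tensor_mat A B) C = tensor_mat A (tensor_mat B C)"
proof (rule eq_matI)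
  fix i j assume "i < dim_row (tensor_mat A (tensor_mat B C))" "j < dim_col (tensor_mat A (tensor_mat B C))"
  then have ij: "i < (dim_row A * dim_row B) * dim_row C" "j < (dim_col A * dim_col B) * dim_col C" by (auto simp: mult.assoc)
  then have ij': "i < dim_row A * (dim_row B * dim_row C)" "j < dim_col A * (dim_col B * dim_col C)" by (auto simp: mult.assoc)
  note b = div_mod_less[OF ij(1)] div_mod_less[OF ij(2)] div_mod_less[OF ij'(1)] div_mod_less[OF ij'(2)]
  have m: "x mod (y * z) div z = x div z mod y" "x mod (y * z) mod z = x mod z" "x div (y * z) = x div z div y" for x y z :: nat
  proof -
    show "x div (y * z) = x div z div y" by (simp add: div_mult2_eq mult.commute[of y z])
    show "x mod (y * z) div z = x div z mod y"
      by (cases "z = 0") (simp_all add: mod_mult2_eq mult.commute[of y z])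
    show "x mod (y * z) mod z = x mod z" by (simp add: mod_mult2_eq mult.commute[of y z])
  qed
  show "tensor_mat (tensor_mat A B) C $$ (i, j) = tensor_mat A (tensor_mat B C) $$ (i, j)"
    using ij ij' b by (simp add: tensor_mat_def m mult.assoc[of "A $$ _"])
qed (auto simp: mult.assoc)

lemma mat_trace_tensor:
  assumes "A \<in> carrier_mat n n" "B \<in> carrier_mat k k"
  shows "mat_trace (tensor_mat A B) = mat_trace A * mat_trace B"
proof -
  have "mat_trace (tensor_mat A B) = (\<Sum>i<n * k. A $$ (i div k, i div k) * B $$ (i mod k, i mod k))"
    using assms by (auto simp: mat_trace_def tensor_mat_index[OF assms] intro!: sum.cong)
  also have "\<dots> = (\<Sum>a<n. \<Sum>b<k. A $$ (a, a) * B $$ (b, b))" by (rule sum_div_mod)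
  also have "\<dots> = mat_trace A * mat_trace B" using assms by (auto simp: mat_trace_def sum_product)
  finally show ?thesis .
qed

text \<open>Gram factors multiply: a Gram factor of the product is the product of Gram
  factors.\<close>

lemma positive_semidef_tensor:
  assumes "positive_semidef n A" "positive_semidef k B"
  shows "positive_semidef (n * k) (tensor_mat A B)"
proof -
  obtain X where X: "X \<in> carrier_mat n n" "A = X * mat_adjoint X" using positive_semidef_gram_exists[OF assms(1)] .
  obtain Y where Y: "Y \<in> carrier_mat k k" "B = Y * mat_adjoint Y" using positive_semidef_gram_exists[OF assms(2)] .
  have "tensor_mat A B = tensor_mat X Y * mat_adjoint (tensor_mat X Y)"
    unfolding X(2) Y(2) tensor_mat_adjoint using X(1) Y(1) by (subst tensor_mat_mult[of _ n n _ k k _ n _ k]) auto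
  then show ?thesis using X(1) Y(1) by (auto intro!: positive_semidef_gram[of _ _ "n * k"])
qed

lemma density_tensor:
  "\<rho> \<in> density_operators n \<Longrightarrow> \<sigma> \<in> density_operators k \<Longrightarrow> tensor_mat \<rho> \<sigma> \<in> density_operators (n * k)"
  using mat_trace_tensor[of \<rho> n \<sigma> k]
  by (auto simp: density_operators_def positive_semidef_tensor)

lemma unitary_tensor:
  assumes "unitary_mat n U" "unitary_mat k V"
  shows "unitary_mat (n * k) (tensor_mat U V)"
  using assms tensor_mat_mult[of U n n V k k "mat_adjoint U" n "mat_adjoint V" k]
    tensor_mat_mult[of "mat_adjoint U" n n "mat_adjoint V" k k U n V k]
  by (auto simp: unitary_mat_def tensor_mat_adjoint tensor_mat_one)

lemma rdiag_tensor: "tensor_mat (rdiag n p) (rdiag k q) = rdiag (n * k) (\<lambda>i. p (i div k) * q (i mod k))"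
proof (rule eq_matI)
  fix i j assume "i < dim_row (rdiag (n * k) (\<lambda>i. p (i div k) * q (i mod k)))" "j < dim_col (rdiag (n * k) (\<lambda>i. p (i div k) * q (i mod k)))"
  then have ij: "i < n * k" "j < n * k" by (auto simp: mat_diag_def)
  note b = div_mod_less[OF ij(1)] div_mod_less[OF ij(2)]
  have "i = j \<longleftrightarrow> i div k = j div k \<and> i mod k = j mod k" by (metis div_mult_mod_eq)
  then show "tensor_mat (rdiag n p) (rdiag k q) $$ (i, j) = rdiag (n * k) (\<lambda>i. p (i div k) * q (i mod k)) $$ (i, j)"
    using ij b by (auto simp: tensor_mat_def mat_diag_def)
qed (auto simp: mat_diag_def)

lemma diagonalizes_tensor:
  assumes A: "diagonalizes n U p A" and B: "diagonalizes k V q B"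
  shows "diagonalizes (n * k) (tensor_mat U V) (\<lambda>i. p (i div k) * q (i mod k)) (tensor_mat A B)"
proof -
  note u = diagonalizes_unitary[OF A] diagonalizes_unitary[OF B]
  have "tensor_mat A B = tensor_mat U V * tensor_mat (rdiag n p) (rdiag k q) * tensor_mat (mat_adjoint U) (mat_adjoint V)"
    unfolding diagonalizes_eq[OF A] diagonalizes_eq[OF B] using u
    by (simp add: tensor_mat_mult[of _ n n _ k k _ n _ k])
  then show ?thesis using unitary_tensor[OF u] by (simp add: diagonalizes_def tensor_mat_adjoint rdiag_tensor)
qed

lemma von_neumann_entropy_tensor:
  assumes "\<rho> \<in> density_operators n" "\<sigma> \<in> density_operators k"
  shows "von_neumann_entropy (tensor_mat \<rho> \<sigma>) = von_neumann_entropy \<rho> + von_neumann_entropy \<sigma>"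
proof -
  obtain U p where p: "diagonalizes n U p \<rho>" "\<And>i. i < n \<Longrightarrow> 0 \<le> p i" "(\<Sum>i<n. p i) = 1"
    using density_diagonalizable[OF assms(1)] by blast
  obtain V q where q: "diagonalizes k V q \<sigma>" "\<And>i. i < k \<Longrightarrow> 0 \<le> q i" "(\<Sum>i<k. q i) = 1"
    using density_diagonalizable[OF assms(2)] by blast
  have "(\<Sum>i<n * k. (p (i div k) * q (i mod k)) * log 2 (p (i div k) * q (i mod k)))
    = (\<Sum>a<n. \<Sum>b<k. (p a * q b) * log 2 (p a * q b))" by (rule sum_div_mod)
  also have "\<dots> = (\<Sum>a<n. \<Sum>b<k. (p a * log 2 (p a)) * q b + p a * (q b * log 2 (q b)))"
  proof (intro sum.cong refl)
    fix a b assume "a \<in> {..<n}" "b \<in> {..<k}"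
    then have "0 \<le> p a" "0 \<le> q b" using p q by auto
    then show "(p a * q b) * log 2 (p a * q b) = (p a * log 2 (p a)) * q b + p a * (q b * log 2 (q b))"
      by (cases "p a = 0 \<or> q b = 0") (auto simp: log_mult algebra_simps)
  qed
  also have "\<dots> = (\<Sum>a<n. p a * log 2 (p a)) * (\<Sum>b<k. q b) + (\<Sum>a<n. p a) * (\<Sum>b<k. q b * log 2 (q b))"
    by (simp add: sum.distrib sum_product)
  finally show ?thesis
    unfolding von_neumann_entropy_eq[OF diagonalizes_tensor[OF p(1) q(1)]] von_neumann_entropy_eq[OF p(1)]
      von_neumann_entropy_eq[OF q(1)] by (simp add: p(3) q(3))
qed

lemma mixture_tensor_left:
  assumes "\<omega> \<in> carrier_mat n n" and F: "\<And>x. x \<in> set_pmf Q \<Longrightarrow> F x \<in> carrier_mat k k"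
  shows "mixture (n * k) Q (\<lambda>x. tensor_mat \<omega> (F x)) = tensor_mat \<omega> (mixture k Q F)"
proof (rule eq_matI)
  fix i j assume "i < dim_row (tensor_mat \<omega> (mixture k Q F))" "j < dim_col (tensor_mat \<omega> (mixture k Q F))"
  then have ij: "i < n * k" "j < n * k" using assms(1) by (auto simp: mixture_def mat_sum_def)
  note b = div_mod_less[OF ij(1)] div_mod_less[OF ij(2)]
  show "mixture (n * k) Q (\<lambda>x. tensor_mat \<omega> (F x)) $$ (i, j) = tensor_mat \<omega> (mixture k Q F) $$ (i, j)"
    using assms ij b
    by (subst mixture_index[OF _ ij], simp, subst tensor_mat_index[OF assms(1) mixture_carrier ij], subst mixture_index)
      (auto simp: tensor_mat_index[OF assms(1) F] sum_distrib_left mult_ac intro!: sum.cong)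
qed (use assms(1) in \<open>auto simp: mixture_def mat_sum_def\<close>)

text \<open>Entropy is additive, so the entropy of \<open>\<omega>\<close> enters the mixture and
  the average alike and cancels.\<close>

lemma holevo_tensor:
  assumes fin: "finite (set_pmf Q)" and \<omega>: "\<omega> \<in> density_operators n"
    and \<rho>: "\<And>x. x \<in> set_pmf Q \<Longrightarrow> \<rho> x \<in> density_operators k"
  shows "holevo (n * k) Q (\<lambda>x. tensor_mat \<omega> (\<rho> x)) = holevo k Q \<rho>"
proof -
  have "(\<Sum>x\<in>set_pmf Q. pmf Q x * von_neumann_entropy (tensor_mat \<omega> (\<rho> x)))
    = (\<Sum>x\<in>set_pmf Q. pmf Q x * (von_neumann_entropy \<omega> + von_neumann_entropy (\<rho> x)))"
    using von_neumann_entropy_tensor[OF \<omega> \<rho>] by simp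
  also have "\<dots> = von_neumann_entropy \<omega> + (\<Sum>x\<in>set_pmf Q. pmf Q x * von_neumann_entropy (\<rho> x))"
    using sum_pmf_support[OF fin] by (simp add: algebra_simps sum.distrib sum_distrib_left[symmetric])
  finally show ?thesis
    unfolding holevo_def using von_neumann_entropy_tensor[OF \<omega> mixture_density[OF fin \<rho>]]
    by (simp add: mixture_tensor_left[OF density_carrier[OF \<omega>] density_carrier[OF \<rho>]])
qed

section \<open>Products of lists of matrices\<close>

lemma tensor_list_Nil [simp]: "tensor_list [] = 1\<^sub>m 1"
  by (simp add: tensor_list_def)

lemma tensor_list_Cons [simp]: "tensor_list (A # As) = tensor_mat A (tensor_list As)"
  by (simp add: tensor_list_def)

lemma tensor_list_append: "tensor_list (As @ Bs) = tensor_mat (tensor_list As) (tensor_list Bs)"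
  by (induction As) (auto simp: tensor_mat_assoc simp del: One_nat_def)

lemma tensor_list_carrier:
  "(\<And>A. A \<in> set As \<Longrightarrow> A \<in> carrier_mat d d) \<Longrightarrow> tensor_list As \<in> carrier_mat (d ^ length As) (d ^ length As)"
  by (induction As) auto

lemma positive_semidef_one: "positive_semidef d (1\<^sub>m d)"
proof -
  have "positive_semidef d (1\<^sub>m d * mat_adjoint (1\<^sub>m d))" by (rule positive_semidef_gram) auto
  moreover have "mat_adjoint (1\<^sub>m d) = (1\<^sub>m d :: complex mat)" by (rule eq_matI) auto
  ultimately show ?thesis by simp
qed

lemma positive_semidef_tensor_list:
  "(\<And>A. A \<in> set As \<Longrightarrow> positive_semidef d A) \<Longrightarrow> positive_semidef (d ^ length As) (tensor_list As)"
  by (induction As) (auto intro: positive_semidef_tensor positive_semidef_one simp del: One_nat_def)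

lemma density_one: "1\<^sub>m 1 \<in> density_operators 1"
  by (simp add: density_operators_def positive_semidef_one mat_trace_def del: One_nat_def)

lemma density_tensor_list:
  "(\<And>A. A \<in> set As \<Longrightarrow> A \<in> density_operators d) \<Longrightarrow> tensor_list As \<in> density_operators (d ^ length As)"
  by (induction As) (auto intro: density_tensor density_one simp del: One_nat_def)

lemma mat_trace_tensor_list_mult:
  assumes "length As = length Bs" "\<And>A. A \<in> set As \<Longrightarrow> A \<in> carrier_mat d d" "\<And>B. B \<in> set Bs \<Longrightarrow> B \<in> carrier_mat d d"
  shows "mat_trace (tensor_list As * tensor_list Bs) = (\<Prod>k<length As. mat_trace (As ! k * Bs ! k))"
  using assms
proof (induction As Bs rule: list_induct2)
  case Nil
  then show ?case by (simp add: mat_trace_def)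
next
  case (Cons A As B Bs)
  have c: "tensor_list As \<in> carrier_mat (d ^ length As) (d ^ length As)" "tensor_list Bs \<in> carrier_mat (d ^ length As) (d ^ length As)"
    using Cons.prems Cons.hyps tensor_list_carrier[of As d] tensor_list_carrier[of Bs d] by auto
  have "mat_trace (tensor_list (A # As) * tensor_list (B # Bs)) = mat_trace (A * B) * mat_trace (tensor_list As * tensor_list Bs)"
    using Cons.prems c by (simp add: tensor_mat_mult[of A d d _ _ _ B d _ _, OF _ c(1) _ c(2)] mat_trace_tensor[of _ d _ "d ^ length As"])
  then show ?case using Cons by (simp add: prod.lessThan_Suc_shift del: prod.lessThan_Suc)
qed

lemma words_0 [simp]: "words X 0 = {[]}"
  by (auto simp: words_def)

lemma words_Suc: "words X (Suc n) = (\<lambda>(x, xs). x # xs) ` (X \<times> words X n)"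
  by (auto simp: words_def length_Suc_conv image_iff)

lemma finite_words [simp]: "finite X \<Longrightarrow> finite (words X n)"
  unfolding words_def by (rule finite_lists_length_eq)

lemma words_nonempty: "X \<noteq> {} \<Longrightarrow> words X n \<noteq> {}"
  by (induction n) (auto simp: words_Suc)

lemma length_words: "xs \<in> words X n \<Longrightarrow> length xs = n"
  by (simp add: words_def)

lemma set_words: "xs \<in> words X n \<Longrightarrow> x \<in> set xs \<Longrightarrow> x \<in> X"
  by (auto simp: words_def)

lemma sum_words_Suc:
  "(\<Sum>xs\<in>words X (Suc n). f xs) = (\<Sum>x\<in>X. \<Sum>xs\<in>words X n. f (x # xs))"
  unfolding words_Suc sum.cartesian_product by (subst sum.reindex) (auto simp: inj_on_def case_prod_beta)

lemma sum_prod_words: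
  fixes f :: "nat \<Rightarrow> 'x \<Rightarrow> 'b::comm_semiring_1"
  shows "(\<Sum>xs\<in>words X n. \<Prod>k<n. f k (xs ! k)) = (\<Prod>k<n. \<Sum>x\<in>X. f k x)"
proof (induction n arbitrary: f)
  case (Suc n)
  have "(\<Sum>xs\<in>words X (Suc n). \<Prod>k<Suc n. f k (xs ! k))
    = (\<Sum>x\<in>X. \<Sum>xs\<in>words X n. f 0 x * (\<Prod>k<n. f (Suc k) (xs ! k)))"
    unfolding sum_words_Suc by (simp add: prod.lessThan_Suc_shift del: prod.lessThan_Suc)
  also have "\<dots> = (\<Sum>x\<in>X. f 0 x) * (\<Prod>k<n. \<Sum>x\<in>X. f (Suc k) x)"
    using Suc.IH[of "\<lambda>k. f (Suc k)"] by (simp add: sum_product[symmetric] sum_distrib_left[symmetric] sum_distrib_right[symmetric])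
  finally show ?case by (simp add: prod.lessThan_Suc_shift del: prod.lessThan_Suc)
qed simp

section \<open>Concentration on words\<close>

lemma nth_words: "xs \<in> words X n \<Longrightarrow> k < n \<Longrightarrow> xs ! k \<in> X"
  by (auto simp: words_def)

lemma exp_le_quadratic:
  fixes z :: real
  assumes "\<bar>z\<bar> \<le> 1"
  shows "exp z \<le> 1 + z + z\<^sup>2"
proof (cases "z \<ge> 0")
  case True
  then show ?thesis using exp_bound[of z] assms by simp
next
  case False
  have "exp z \<le> 1 + z + z\<^sup>2 / 2"
  proof -
    let ?F = "\<lambda>x. 1 + x + x\<^sup>2 / 2 - exp x :: real"
    have "\<exists>y. (?F has_real_derivative y) (at x) \<and> y \<le> 0" for x
    proof -
      have "(?F has_real_derivative 1 + x - exp x) (at x)"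
        by (auto intro!: derivative_eq_intros)
      moreover have "1 + x - exp x \<le> 0" using exp_ge_add_one_self[of x] by simp
      ultimately show ?thesis by blast
    qed
    then have "?F 0 \<le> ?F z" using False by (intro DERIV_nonpos_imp_nonincreasing[of z 0 ?F]) auto
    then show ?thesis by simp
  qed
  then show ?thesis by (simp add: order_trans)
qed

text \<open>Chernoff's bound for independent letters whose laws depend on the position. Since each
  \<open>g k\<close> is centred, the linear term of the quadratic bound on the exponential
  disappears, and every letter contributes at most \<open>exp (l\<^sup>2)\<close>. The optimal
  \<open>l\<close> is \<open>\<eta> / 2\<close>, and \<open>\<eta> \<le> 2\<close> keeps it in the
  range of that quadratic bound.\<close>

lemma words_tail_bound:
  fixes w g :: "nat \<Rightarrow> 'y \<Rightarrow> real"
  assumes Y: "finite Y" and w: "\<And>k y. k < n \<Longrightarrow> y \<in> Y \<Longrightarrow> 0 \<le> w k y" "\<And>k. k < n \<Longrightarrow> (\<Sum>y\<in>Y. w k y) = 1"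
    and g: "\<And>k y. k < n \<Longrightarrow> y \<in> Y \<Longrightarrow> \<bar>g k y\<bar> \<le> 1" "\<And>k. k < n \<Longrightarrow> (\<Sum>y\<in>Y. w k y * g k y) = 0"
    and eta: "0 \<le> \<eta>" "\<eta> \<le> 2"
  shows "(\<Sum>ys | ys \<in> words Y n \<and> \<eta> * n \<le> (\<Sum>k<n. g k (ys ! k)). \<Prod>k<n. w k (ys ! k)) \<le> exp (- \<eta>\<^sup>2 / 4 * n)"
proof -
  define l where "l = \<eta> / 2"
  have l: "0 \<le> l" "l \<le> 1" using eta by (auto simp: l_def)
  have wnn: "0 \<le> (\<Prod>k<n. w k (ys ! k))" if "ys \<in> words Y n" for ys
    using that by (intro prod_nonneg w(1) nth_words[of ys]) auto
  have "(\<Sum>ys | ys \<in> words Y n \<and> \<eta> * n \<le> (\<Sum>k<n. g k (ys ! k)). \<Prod>k<n. w k (ys ! k))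
    \<le> (\<Sum>ys | ys \<in> words Y n \<and> \<eta> * n \<le> (\<Sum>k<n. g k (ys ! k)). (\<Prod>k<n. w k (ys ! k)) * exp (l * ((\<Sum>k<n. g k (ys ! k)) - \<eta> * n)))"
  proof (rule sum_mono)
    fix ys assume "ys \<in> {ys. ys \<in> words Y n \<and> \<eta> * n \<le> (\<Sum>k<n. g k (ys ! k))}"
    then have ys: "ys \<in> words Y n" and "0 \<le> l * ((\<Sum>k<n. g k (ys ! k)) - \<eta> * n)" using l by auto
    then have "1 \<le> exp (l * ((\<Sum>k<n. g k (ys ! k)) - \<eta> * n))" by simp
    from mult_left_mono[OF this wnn[OF ys]]
    show "(\<Prod>k<n. w k (ys ! k)) \<le> (\<Prod>k<n. w k (ys ! k)) * exp (l * ((\<Sum>k<n. g k (ys ! k)) - \<eta> * n))" by simp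
  qed
  also have "\<dots> \<le> (\<Sum>ys\<in>words Y n. (\<Prod>k<n. w k (ys ! k)) * exp (l * ((\<Sum>k<n. g k (ys ! k)) - \<eta> * n)))"
    using wnn Y by (intro sum_mono2) auto
  also have "\<dots> = (\<Sum>ys\<in>words Y n. \<Prod>k<n. w k (ys ! k) * exp (l * g k (ys ! k))) * exp (- l * \<eta> * n)"
    by (simp add: sum_distrib_right prod.distrib exp_sum[symmetric] sum_distrib_left right_diff_distrib exp_diff exp_minus divide_inverse mult_ac)
  also have "\<dots> = (\<Prod>k<n. \<Sum>y\<in>Y. w k y * exp (l * g k y)) * exp (- l * \<eta> * n)"
    by (simp only: sum_prod_words[where f = "\<lambda>k y. w k y * exp (l * g k y)"])
  also have "\<dots> \<le> (\<Prod>k<n. exp (l\<^sup>2)) * exp (- l * \<eta> * n)"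
  proof (intro mult_right_mono prod_mono conjI)
    fix k assume "k \<in> {..<n}"
    then have k: "k < n" by simp
    show "0 \<le> (\<Sum>y\<in>Y. w k y * exp (l * g k y))" using w(1)[OF k] by (intro sum_nonneg) auto
    have "(\<Sum>y\<in>Y. w k y * exp (l * g k y)) \<le> (\<Sum>y\<in>Y. w k y * (1 + l * g k y + l\<^sup>2))"
    proof (intro sum_mono mult_left_mono w(1)[OF k])
      fix y assume y: "y \<in> Y"
      have le: "\<bar>l * g k y\<bar> \<le> 1" using g(1)[OF k y] l by (auto simp: abs_mult intro: mult_le_one)
      have "(g k y)\<^sup>2 \<le> 1" using g(1)[OF k y] by (simp add: abs_square_le_1)
      then have "(l * g k y)\<^sup>2 \<le> l\<^sup>2" by (simp add: power_mult_distrib mult_left_le)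
      then show "exp (l * g k y) \<le> 1 + l * g k y + l\<^sup>2" using exp_le_quadratic[OF le] by simp
    qed
    also have "\<dots> = (\<Sum>y\<in>Y. w k y) + l * (\<Sum>y\<in>Y. w k y * g k y) + l\<^sup>2 * (\<Sum>y\<in>Y. w k y)"
      by (simp add: algebra_simps sum.distrib sum_distrib_left sum_distrib_right)
    also have "\<dots> = 1 + l\<^sup>2" using w(2)[OF k] g(2)[OF k] by simp
    also have "\<dots> \<le> exp (l\<^sup>2)" by (rule exp_ge_add_one_self)
    finally show "(\<Sum>y\<in>Y. w k y * exp (l * g k y)) \<le> exp (l\<^sup>2)" .
  qed auto
  also have "\<dots> = exp (- \<eta>\<^sup>2 / 4 * n)"
    by (simp add: exp_of_nat_mult[symmetric] exp_add[symmetric] l_def power2_eq_square field_simps)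
  finally show ?thesis .
qed

lemma words_tail_bound_abs:
  fixes w g :: "nat \<Rightarrow> 'y \<Rightarrow> real"
  assumes Y: "finite Y" and w: "\<And>k y. k < n \<Longrightarrow> y \<in> Y \<Longrightarrow> 0 \<le> w k y" "\<And>k. k < n \<Longrightarrow> (\<Sum>y\<in>Y. w k y) = 1"
    and g: "\<And>k y. k < n \<Longrightarrow> y \<in> Y \<Longrightarrow> \<bar>g k y\<bar> \<le> 1" "\<And>k. k < n \<Longrightarrow> (\<Sum>y\<in>Y. w k y * g k y) = 0"
    and eta: "0 \<le> \<eta>" "\<eta> \<le> 2"
  shows "(\<Sum>ys | ys \<in> words Y n \<and> \<eta> * n < \<bar>\<Sum>k<n. g k (ys ! k)\<bar>. \<Prod>k<n. w k (ys ! k)) \<le> 2 * exp (- \<eta>\<^sup>2 / 4 * n)"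
proof -
  let ?A = "\<lambda>g. {ys. ys \<in> words Y n \<and> \<eta> * n \<le> (\<Sum>k<n. g k (ys ! k))}"
  have fin: "finite (?A h)" for h by (rule finite_subset[OF _ finite_words[OF Y]]) auto
  have nn: "0 \<le> (\<Prod>k<n. w k (ys ! k))" if "ys \<in> words Y n" for ys
    using that by (intro prod_nonneg w(1) nth_words[of ys]) auto
  have "(\<Sum>ys | ys \<in> words Y n \<and> \<eta> * n < \<bar>\<Sum>k<n. g k (ys ! k)\<bar>. \<Prod>k<n. w k (ys ! k))
     \<le> (\<Sum>ys\<in>?A g \<union> ?A (\<lambda>k y. - g k y). \<Prod>k<n. w k (ys ! k))"
    using fin[of g] fin[of "\<lambda>k y. - g k y"] nn by (intro sum_mono2) (auto simp: sum_negf)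
  also have "\<dots> \<le> (\<Sum>ys\<in>?A g. \<Prod>k<n. w k (ys ! k)) + (\<Sum>ys\<in>?A (\<lambda>k y. - g k y). \<Prod>k<n. w k (ys ! k))"
    using fin nn by (subst sum.union_inter[symmetric]) (auto intro!: sum_nonneg)
  also have "\<dots> \<le> exp (- \<eta>\<^sup>2 / 4 * n) + exp (- \<eta>\<^sup>2 / 4 * n)"
    using g by (intro add_mono words_tail_bound assms) (auto simp: sum_negf)
  finally show ?thesis by simp
qed

section \<open>Random codebooks\<close>

text \<open>
  A codeword is bad if it is related by \<open>B\<close> to another one. The number \<open>spoiled B xs\<close> of codewords
  that are related to a later one is controlled by averaging \<open>2 ^ spoiled B xs\<close> over all codebooks;
  reversing the codebook takes care of the earlier ones.
\<close>

fun spoiled :: "('x \<Rightarrow> 'x \<Rightarrow> bool) \<Rightarrow> 'x list \<Rightarrow> nat" where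
  "spoiled B [] = 0"
| "spoiled B (x # xs) = (if \<exists>x'\<in>set xs. B x x' then 1 else 0) + spoiled B xs"

lemma card_spoiled_later:
  "card {i. i < length xs \<and> (\<exists>j<length xs. i < j \<and> B (xs ! i) (xs ! j))} \<le> spoiled B xs"
proof (induction xs)
  case (Cons x xs)
  let ?S = "\<lambda>xs. {i. i < length xs \<and> (\<exists>j<length xs. i < j \<and> B (xs ! i) (xs ! j))}"
  have "?S (x # xs) \<subseteq> (if \<exists>x'\<in>set xs. B x x' then {0} else {}) \<union> Suc ` ?S xs"
  proof
    fix i assume "i \<in> ?S (x # xs)"
    then obtain j where ij: "j < Suc (length xs)" "i < j" "B ((x # xs) ! i) ((x # xs) ! j)" by auto
    then obtain j' where j': "j = Suc j'" by (cases j) auto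
    show "i \<in> (if \<exists>x'\<in>set xs. B x x' then {0} else {}) \<union> Suc ` ?S xs"
    proof (cases i)
      case 0
      then have "B x (xs ! j')" "xs ! j' \<in> set xs" using ij j' by auto
      then show ?thesis using 0 by auto
    next
      case (Suc i')
      then show ?thesis using ij j' by auto
    qed
  qed
  then have "card (?S (x # xs)) \<le> card ((if \<exists>x'\<in>set xs. B x x' then {0} else {}) \<union> Suc ` ?S xs)"
    by (intro card_mono) auto
  also have "\<dots> \<le> (if \<exists>x'\<in>set xs. B x x' then 1 else 0) + card (?S xs)"
    by (rule order_trans[OF card_Un_le]) (auto simp: card_image)
  finally show ?case using Cons.IH by simp
qed simp

lemma card_spoiled_earlier:
  "card {i. i < length xs \<and> (\<exists>j<length xs. j < i \<and> B (xs ! i) (xs ! j))} \<le> spoiled B (rev xs)"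
proof -
  let ?S = "{i. i < length xs \<and> (\<exists>j<length xs. j < i \<and> B (xs ! i) (xs ! j))}"
  let ?R = "{i. i < length (rev xs) \<and> (\<exists>j<length (rev xs). i < j \<and> B (rev xs ! i) (rev xs ! j))}"
  have "?S \<subseteq> (\<lambda>i. length xs - Suc i) ` ?R"
  proof
    fix i assume "i \<in> ?S"
    then obtain j where ij: "i < length xs" "j < i" "B (xs ! i) (xs ! j)" by auto
    then have "length xs - Suc i \<in> ?R"
      by (auto simp: rev_nth intro!: exI[of _ "length xs - Suc j"])
    moreover have "i = length xs - Suc (length xs - Suc i)" using ij by simp
    ultimately show "i \<in> (\<lambda>i. length xs - Suc i) ` ?R" by (rule image_eqI[rotated])
  qed
  then have "card ?S \<le> card ?R" by (rule surj_card_le[rotated]) simp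
  also have "\<dots> \<le> spoiled B (rev xs)" by (rule card_spoiled_later)
  finally show ?thesis .
qed

text \<open>The first codeword is averaged with the later ones fixed: at most a fraction
  \<open>N * q\<close> of its values is related to one of them, and those values double the
  summand.\<close>

lemma sum_spoiled_le:
  fixes q :: real
  assumes X: "finite X" and q: "0 \<le> q" "\<And>x'. x' \<in> X \<Longrightarrow> card {x\<in>X. B x x'} \<le> q * card X" and "m \<le> N"
  shows "(\<Sum>xs\<in>words X m. 2 ^ spoiled B xs) \<le> (card X * (1 + N * q)) ^ m"
  using \<open>m \<le> N\<close>
proof (induction m)
  case (Suc m)
  have step: "(\<Sum>x\<in>X. 2 ^ spoiled B (x # xs)) \<le> (card X * (1 + N * q)) * 2 ^ spoiled B xs"
    if xs: "xs \<in> words X m" for xs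
  proof -
    have "card {x\<in>X. \<exists>x'\<in>set xs. B x x'} \<le> card (\<Union>x'\<in>set xs. {x\<in>X. B x x'})"
      using X by (intro card_mono) auto
    also have "\<dots> \<le> (\<Sum>x'\<in>set xs. card {x\<in>X. B x x'})"
      by (intro card_UN_le) simp
    finally have "real (card {x\<in>X. \<exists>x'\<in>set xs. B x x'}) \<le> (\<Sum>x'\<in>set xs. real (card {x\<in>X. B x x'}))"
      by (simp flip: of_nat_sum)
    also have "\<dots> \<le> (\<Sum>x'\<in>set xs. q * card X)"
      using xs by (intro sum_mono q(2)) (auto simp: words_def)
    also have "\<dots> = card (set xs) * (q * card X)" by simp
    also have "\<dots> \<le> N * (q * card X)"
      using q(1) xs Suc.prems card_length[of xs] by (intro mult_right_mono) (auto simp: words_def)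
    finally have c: "real (card {x\<in>X. \<exists>x'\<in>set xs. B x x'}) \<le> N * (q * card X)" .
    have "(\<Sum>x\<in>X. 2 ^ spoiled B (x # xs)) = (\<Sum>x\<in>X. (1 + (if \<exists>x'\<in>set xs. B x x' then 1 else 0)) * 2 ^ spoiled B xs :: real)"
      by (intro sum.cong) auto
    also have "\<dots> = (card X + real (card {x\<in>X. \<exists>x'\<in>set xs. B x x'})) * 2 ^ spoiled B xs"
      using X by (simp add: sum_distrib_right[symmetric] sum.distrib sum.If_cases Int_def)
    also have "\<dots> \<le> (card X + N * (q * card X)) * 2 ^ spoiled B xs"
      using c by (intro mult_right_mono) auto
    finally show ?thesis by (simp add: algebra_simps)
  qed
  have "(\<Sum>xs\<in>words X (Suc m). 2 ^ spoiled B xs) = (\<Sum>xs\<in>words X m. \<Sum>x\<in>X. 2 ^ spoiled B (x # xs) :: real)"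
    unfolding sum_words_Suc by (rule sum.swap)
  also have "\<dots> \<le> (\<Sum>xs\<in>words X m. (card X * (1 + N * q)) * 2 ^ spoiled B xs)"
    by (intro sum_mono step)
  also have "\<dots> \<le> (card X * (1 + N * q)) * (card X * (1 + N * q)) ^ m"
    unfolding sum_distrib_left[symmetric] using Suc q(1) by (intro mult_left_mono) auto
  finally show ?case by simp
qed simp

lemma rev_words: "bij_betw rev (words X n) (words X n)"
  by (rule bij_betwI[where g = rev]) (auto simp: words_def)

text \<open>Exponential moments make the union over \<open>S\<close> cheap: the number of bad
  codewords is bounded by a logarithm of \<open>card S\<close> plus a multiple of
  \<open>N * (N * q)\<close>. With the state sequences for \<open>S\<close>, that logarithm is
  linear in the block length.\<close>

lemma codebook_exists:
  fixes q :: real and B :: "'s \<Rightarrow> 'x \<Rightarrow> 'x \<Rightarrow> bool"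
  assumes X: "finite X" "X \<noteq> {}" and S: "finite S"
    and q: "0 \<le> q" "\<And>s x'. s \<in> S \<Longrightarrow> x' \<in> X \<Longrightarrow> card {x\<in>X. B s x x'} \<le> q * card X"
  shows "\<exists>xs\<in>words X N. \<forall>s\<in>S.
    2 powr (card {i. i < N \<and> (\<exists>j<N. j \<noteq> i \<and> B s (xs ! i) (xs ! j))} / 2) \<le> 2 * card S * exp (N * (N * q))"
proof (cases "S = {}")
  case False
  let ?K = "(1 + N * q) ^ N"
  let ?f = "\<lambda>xs. \<Sum>s\<in>S. 2 ^ spoiled (B s) xs + 2 ^ spoiled (B s) (rev xs) :: real"
  have "(\<Sum>xs\<in>words X N. ?f xs) = (\<Sum>s\<in>S. (\<Sum>xs\<in>words X N. 2 ^ spoiled (B s) xs) + (\<Sum>xs\<in>words X N. 2 ^ spoiled (B s) (rev xs)))"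
    by (subst sum.swap) (simp add: sum.distrib)
  also have "\<dots> = (\<Sum>s\<in>S. 2 * (\<Sum>xs\<in>words X N. 2 ^ spoiled (B s) xs))"
    by (intro sum.cong refl) (simp add: sum.reindex_bij_betw[OF rev_words, where g = "\<lambda>xs. 2 ^ spoiled (B _) xs"])
  also have "\<dots> \<le> (\<Sum>s\<in>S. 2 * (card X * (1 + N * q)) ^ N)"
    using q X by (intro sum_mono mult_left_mono sum_spoiled_le) auto
  also have "\<dots> = (\<Sum>xs\<in>words X N. 2 * card S * ?K)"
  proof -
    have "card (words X N) = card X ^ N"
      unfolding words_def using X by (simp add: card_lists_length_eq)
    then show ?thesis by (simp add: power_mult_distrib)
  qed
  finally have "\<not> (\<forall>xs\<in>words X N. ?f xs > 2 * card S * ?K)"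
    using sum_strict_mono[of "words X N" "\<lambda>_. 2 * card S * ?K" ?f] X words_nonempty[OF X(2)] by fastforce
  then obtain xs where xs: "xs \<in> words X N" "?f xs \<le> 2 * card S * ?K" by (auto simp: not_less)
  have K: "?K \<le> exp (N * (N * q))"
    using power_mono[OF exp_ge_add_one_self[of "N * q"], of N] q(1) by (simp add: exp_of_nat_mult)
  have "2 powr (card {i. i < N \<and> (\<exists>j<N. j \<noteq> i \<and> B s (xs ! i) (xs ! j))} / 2) \<le> 2 * card S * exp (N * (N * q))"
    if s: "s \<in> S" for s
  proof -
    let ?a = "spoiled (B s) xs" and ?b = "spoiled (B s) (rev xs)"
    have len: "length xs = N" using xs(1) by (rule length_words)
    have "{i. i < N \<and> (\<exists>j<N. j \<noteq> i \<and> B s (xs ! i) (xs ! j))}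
      = {i. i < N \<and> (\<exists>j<N. i < j \<and> B s (xs ! i) (xs ! j))} \<union> {i. i < N \<and> (\<exists>j<N. j < i \<and> B s (xs ! i) (xs ! j))}"
      by (auto simp: neq_iff)
    then have "card {i. i < N \<and> (\<exists>j<N. j \<noteq> i \<and> B s (xs ! i) (xs ! j))} \<le> ?a + ?b"
      using card_spoiled_later[of xs "B s"] card_spoiled_earlier[of xs "B s"] unfolding len
      by (metis (no_types, lifting) add_mono card_Un_le order_trans)
    \<comment> \<open>The two counts, for later and for earlier partners, are not controlled
      jointly; half of their sum is at most the larger one, hence the division by
      \<open>2\<close>.\<close>
    then have "2 powr (card {i. i < N \<and> (\<exists>j<N. j \<noteq> i \<and> B s (xs ! i) (xs ! j))} / 2) \<le> 2 powr (max ?a ?b)"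
      by (intro powr_mono) auto
    also have "\<dots> \<le> 2 ^ ?a + 2 ^ ?b"
      by (auto simp: powr_realpow max_def)
    also have "\<dots> \<le> ?f xs"
      using S s by (intro member_le_sum[of s S "\<lambda>s. 2 ^ spoiled (B s) xs + 2 ^ spoiled (B s) (rev xs) :: real"]) auto
    also have "\<dots> \<le> 2 * card S * exp (N * (N * q))"
      by (rule order_trans[OF xs(2)]) (intro mult_left_mono K, simp)
    finally show ?thesis .
  qed
  with xs(1) show ?thesis by blast
qed (use words_nonempty[OF X(2)] in auto)

section \<open>Classical arbitrarily varying channels\<close>

lemma finite_family_convergent_subsequence:
  fixes f :: "nat \<Rightarrow> 'i \<Rightarrow> real"
  assumes "finite I" "\<And>n i. i \<in> I \<Longrightarrow> f n i \<in> {0..1}"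
  shows "\<exists>r l. strict_mono (r :: nat \<Rightarrow> nat) \<and> (\<forall>i\<in>I. (\<lambda>n. f (r n) i) \<longlonglongrightarrow> l i)"
  using assms
proof (induction I)
  case empty
  then show ?case by (auto intro: exI[of _ id] simp: strict_mono_def)
next
  case (insert i I)
  then obtain r l where r: "strict_mono (r :: nat \<Rightarrow> nat)" "\<And>i. i \<in> I \<Longrightarrow> (\<lambda>n. f (r n) i) \<longlonglongrightarrow> l i"
    by (metis insertCI)
  have "seq_compact {0..1::real}" by (intro compact_imp_seq_compact compact_Icc)
  then obtain c r' where r': "strict_mono (r' :: nat \<Rightarrow> nat)" "((\<lambda>n. f (r n) i) \<circ> r') \<longlonglongrightarrow> c"
    using insert.prems[of i] unfolding seq_compact_def by (metis insertI1)
  have "(\<lambda>n. f ((r \<circ> r') n) j) \<longlonglongrightarrow> (l(i := c)) j" if "j \<in> insert i I" for j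
    using r(2)[of j, THEN LIMSEQ_subseq_LIMSEQ, OF _ r'(1)] r'(2) that insert.hyps by (auto simp: o_def)
  moreover have "strict_mono (r \<circ> r')" using r(1) r'(1) by (rule strict_mono_o)
  ultimately show ?case by blast
qed

lemma sum_UN_le:
  fixes f :: "'i \<Rightarrow> real"
  assumes "finite I" "\<And>i. i \<in> I \<Longrightarrow> finite (A i)" "\<And>x. 0 \<le> f x"
  shows "sum f (\<Union>i\<in>I. A i) \<le> (\<Sum>i\<in>I. sum f (A i))"
  using assms(1,2)
proof (induction I)
  case (insert i I)
  have "sum f (\<Union>j\<in>insert i I. A j) \<le> sum f (A i) + sum f (\<Union>j\<in>I. A j)"
    using sum.union_inter[of "A i" "\<Union>j\<in>I. A j" f] insert.prems insert.hyps(1)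
      sum_nonneg[of "A i \<inter> (\<Union>j\<in>I. A j)" f] assms(3) by simp
  then show ?case using insert by simp
qed simp

locale finite_avc =
  fixes \<theta> :: "'t set" and Y :: "'y set" and w :: "'t \<Rightarrow> 'a::finite \<Rightarrow> 'y \<Rightarrow> real"
  assumes finite_states: "finite \<theta>" and finite_outputs: "finite Y"
    and w_nonneg: "t \<in> \<theta> \<Longrightarrow> y \<in> Y \<Longrightarrow> 0 \<le> w t a y"
    and w_sum: "t \<in> \<theta> \<Longrightarrow> (\<Sum>y\<in>Y. w t a y) = 1"
begin

text \<open>The weights are real functions instead of distributions, so that they can be averaged
  and obtained as limits directly.\<close>

definition symmetrized :: "('a \<Rightarrow> 't \<Rightarrow> real) \<Rightarrow> bool" where
  "symmetrized \<tau> \<longleftrightarrow> (\<forall>a. \<forall>t\<in>\<theta>. 0 \<le> \<tau> a t) \<and> (\<forall>a. (\<Sum>t\<in>\<theta>. \<tau> a t) = 1) \<and>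
     (\<forall>a a'. \<forall>y\<in>Y. (\<Sum>t\<in>\<theta>. \<tau> a t * w t a' y) = (\<Sum>t\<in>\<theta>. \<tau> a' t * w t a y))"

definition joint_states :: "('a \<Rightarrow> 't \<Rightarrow> real) \<Rightarrow> bool" where
  "joint_states U \<longleftrightarrow> (\<forall>b. \<forall>t\<in>\<theta>. 0 \<le> U b t) \<and> (\<Sum>b\<in>UNIV. \<Sum>t\<in>\<theta>. U b t) = 1"

text \<open>Summing the equation over \<open>y\<close> shows that the letter marginals of
  \<open>L\<close> and \<open>L'\<close> agree and are constant, so both are uniform and
  multiplication by \<open>CARD('a)\<close> conditions on the letter. Exchanging the two letters in
  the equation exchanges \<open>L\<close> and \<open>L'\<close>, so it is their average that is
  symmetric.\<close>

lemma symmetrized_average: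
  assumes L: "joint_states L" and L': "joint_states L'"
    and eq: "\<And>a b y. y \<in> Y \<Longrightarrow> (\<Sum>t\<in>\<theta>. L b t * w t a y) = (\<Sum>t\<in>\<theta>. L' a t * w t b y)"
  shows "symmetrized (\<lambda>a t. CARD('a) * ((L a t + L' a t) / 2))"
proof -
  have sums: "(\<Sum>t\<in>\<theta>. L b t) = (\<Sum>t\<in>\<theta>. L' a t)" for a b
  proof -
    have sw: "(\<Sum>y\<in>Y. \<Sum>t\<in>\<theta>. f t * w t a y) = (\<Sum>t\<in>\<theta>. f t)" for f a
      using w_sum by (subst sum.swap) (simp add: sum_distrib_left[symmetric])
    have "(\<Sum>y\<in>Y. \<Sum>t\<in>\<theta>. L b t * w t a y) = (\<Sum>y\<in>Y. \<Sum>t\<in>\<theta>. L' a t * w t b y)"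
      by (intro sum.cong refl eq)
    then show ?thesis by (simp only: sw)
  qed
  define c where "c = (\<Sum>t\<in>\<theta>. L' undefined t)"
  have Lc: "(\<Sum>t\<in>\<theta>. L b t) = c" for b unfolding c_def by (rule sums)
  have L'c: "(\<Sum>t\<in>\<theta>. L' b t) = c" for b using sums[of undefined b] Lc by simp
  have c: "CARD('a) * c = 1" using L by (simp add: joint_states_def Lc)
  show ?thesis
    unfolding symmetrized_def
  proof (intro conjI allI ballI)
    fix a t assume "t \<in> \<theta>"
    then show "0 \<le> CARD('a) * ((L a t + L' a t) / 2)"
      using L L' by (auto simp: joint_states_def)
  next
    fix a
    have "(\<Sum>t\<in>\<theta>. CARD('a) * ((L a t + L' a t) / 2)) = CARD('a) * (((\<Sum>t\<in>\<theta>. L a t) + (\<Sum>t\<in>\<theta>. L' a t)) / 2)"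
      by (simp add: sum_distrib_left[symmetric] sum_divide_distrib[symmetric] sum.distrib)
    then show "(\<Sum>t\<in>\<theta>. CARD('a) * ((L a t + L' a t) / 2)) = 1" using c by (simp add: Lc L'c)
  next
    fix a a' y assume y: "y \<in> Y"
    have lin: "(\<Sum>t\<in>\<theta>. CARD('a) * ((L a t + L' a t) / 2) * w t a' y)
      = CARD('a) / 2 * ((\<Sum>t\<in>\<theta>. L a t * w t a' y) + (\<Sum>t\<in>\<theta>. L' a t * w t a' y))" for a a'
    proof -
      have "CARD('a) * ((L a t + L' a t) / 2) * w t a' y
        = CARD('a) / 2 * (L a t * w t a' y) + CARD('a) / 2 * (L' a t * w t a' y)" for t
        by (simp add: field_simps)
      then show ?thesis by (simp only: sum.distrib sum_distrib_left[symmetric] distrib_left[symmetric])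
    qed
    show "(\<Sum>t\<in>\<theta>. CARD('a) * ((L a t + L' a t) / 2) * w t a' y) = (\<Sum>t\<in>\<theta>. CARD('a) * ((L a' t + L' a' t) / 2) * w t a y)"
      unfolding lin using eq[OF y, of a a'] eq[OF y, of a' a] by simp
  qed
qed

text \<open>By compactness, approximate solutions for every precision would have an exact solution
  as a limit point. The resulting gap is uniform over all pairs of joint distributions, so it can be
  compared with the fluctuations of empirical types at every block length.\<close>

lemma not_symmetrizable_gap:
  assumes ns: "\<nexists>\<tau>. symmetrized \<tau>"
  shows "\<exists>\<eta>>0. \<forall>U U'. joint_states U \<longrightarrow> joint_states U' \<longrightarrow>
    \<not> (\<forall>a b. \<forall>y\<in>Y. \<bar>(\<Sum>t\<in>\<theta>. U b t * w t a y) - (\<Sum>t\<in>\<theta>. U' a t * w t b y)\<bar> \<le> \<eta>)"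
proof (rule ccontr)
  assume "\<not> ?thesis"
  then have "\<forall>\<eta>>0. \<exists>U U'. joint_states U \<and> joint_states U' \<and>
     (\<forall>a b. \<forall>y\<in>Y. \<bar>(\<Sum>t\<in>\<theta>. U b t * w t a y) - (\<Sum>t\<in>\<theta>. U' a t * w t b y)\<bar> \<le> \<eta>)" by blast
  then have "\<forall>n. \<exists>U U'. joint_states U \<and> joint_states U' \<and>
     (\<forall>a b. \<forall>y\<in>Y. \<bar>(\<Sum>t\<in>\<theta>. U b t * w t a y) - (\<Sum>t\<in>\<theta>. U' a t * w t b y)\<bar> \<le> inverse (real (Suc n)))" by simp
  then have "\<exists>U U'. \<forall>n. joint_states (U n) \<and> joint_states (U' n) \<and>
     (\<forall>a b. \<forall>y\<in>Y. \<bar>(\<Sum>t\<in>\<theta>. U n b t * w t a y) - (\<Sum>t\<in>\<theta>. U' n a t * w t b y)\<bar> \<le> inverse (real (Suc n)))"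
    by (simp only: choice_iff)
  then obtain U U' where U: "\<And>n. joint_states (U n)" "\<And>n. joint_states (U' n)"
    "\<And>n a b y. y \<in> Y \<Longrightarrow> \<bar>(\<Sum>t\<in>\<theta>. U n b t * w t a y) - (\<Sum>t\<in>\<theta>. U' n a t * w t b y)\<bar> \<le> inverse (real (Suc n))"
    by blast
  have unit: "V b t \<in> {0..1}" if "joint_states V" "t \<in> \<theta>" for V b t
  proof -
    have nn: "0 \<le> V b t" if "t \<in> \<theta>" for b t using \<open>joint_states V\<close> that by (simp add: joint_states_def)
    have "V b t \<le> (\<Sum>t\<in>\<theta>. V b t)" using that nn finite_states by (intro member_le_sum) auto
    also have "\<dots> \<le> (\<Sum>b\<in>UNIV. \<Sum>t\<in>\<theta>. V b t)"
      using nn by (intro member_le_sum[of b UNIV "\<lambda>b. \<Sum>t\<in>\<theta>. V b t"] sum_nonneg) auto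
    also have "\<dots> = 1" using that by (simp add: joint_states_def)
    finally show ?thesis using nn that by simp
  qed
  \<comment> \<open>Both sequences are packed into one family, with a flag choosing between them, so
    that one subsequence serves for all coordinates.\<close>
  define h where "h n i = (case i of (b, t, s) \<Rightarrow> if s then U n b t else U' n b t)" for n and i :: "'a \<times> 't \<times> bool"
  let ?I = "(UNIV :: 'a set) \<times> \<theta> \<times> (UNIV :: bool set)"
  have "h n i \<in> {0..1}" if "i \<in> ?I" for n i
    using that unit[OF U(1)] unit[OF U(2)] by (cases i) (simp add: h_def)
  then have "\<exists>r l. strict_mono (r :: nat \<Rightarrow> nat) \<and> (\<forall>i\<in>?I. (\<lambda>n. h (r n) i) \<longlonglongrightarrow> l i)"
    using finite_states by (intro finite_family_convergent_subsequence) auto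
  then obtain r where "\<exists>l. strict_mono (r :: nat \<Rightarrow> nat) \<and> (\<forall>i\<in>?I. (\<lambda>n. h (r n) i) \<longlonglongrightarrow> l i)" ..
  then obtain l where rl: "strict_mono r \<and> (\<forall>i\<in>?I. (\<lambda>n. h (r n) i) \<longlonglongrightarrow> l i)" ..
  note r = rl[THEN conjunct1] rl[THEN conjunct2, rule_format]
  define L where "L b t = l (b, t, True)" for b t
  define L' where "L' b t = l (b, t, False)" for b t
  have lim: "(\<lambda>n. U (r n) b t) \<longlonglongrightarrow> L b t" "(\<lambda>n. U' (r n) b t) \<longlonglongrightarrow> L' b t" if "t \<in> \<theta>" for b t
    using r(2)[of "(b, t, True)"] r(2)[of "(b, t, False)"] that by (auto simp: L_def L'_def h_def)
  have js: "joint_states M" if V: "\<And>n. joint_states (V n)" and lim: "\<And>b t. t \<in> \<theta> \<Longrightarrow> (\<lambda>n. V n b t) \<longlonglongrightarrow> M b t" for V M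
    unfolding joint_states_def
  proof (intro conjI allI ballI)
    fix b t assume "t \<in> \<theta>"
    then show "0 \<le> M b t" using V by (intro LIMSEQ_le_const[OF lim]) (auto simp: joint_states_def)
  next
    have "(\<lambda>n. \<Sum>b\<in>UNIV. \<Sum>t\<in>\<theta>. V n b t) \<longlonglongrightarrow> (\<Sum>b\<in>UNIV. \<Sum>t\<in>\<theta>. M b t)"
      by (intro tendsto_sum lim)
    moreover have "(\<lambda>n. \<Sum>b\<in>UNIV. \<Sum>t\<in>\<theta>. V n b t) = (\<lambda>_. 1)"
      using V by (auto simp: joint_states_def)
    ultimately show "(\<Sum>b\<in>UNIV. \<Sum>t\<in>\<theta>. M b t) = 1" by (simp add: LIMSEQ_const_iff)
  qed
  have "symmetrized (\<lambda>a t. CARD('a) * ((L a t + L' a t) / 2))"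
  proof (rule symmetrized_average)
    show "joint_states L" by (rule js[of "\<lambda>n. U (r n)"]) (auto intro: U lim)
    show "joint_states L'" by (rule js[of "\<lambda>n. U' (r n)"]) (auto intro: U lim)
    fix a b y assume y: "y \<in> Y"
    have "(\<lambda>n. \<bar>(\<Sum>t\<in>\<theta>. U (r n) b t * w t a y) - (\<Sum>t\<in>\<theta>. U' (r n) a t * w t b y)\<bar>)
       \<longlonglongrightarrow> \<bar>(\<Sum>t\<in>\<theta>. L b t * w t a y) - (\<Sum>t\<in>\<theta>. L' a t * w t b y)\<bar>"
      by (intro tendsto_intros lim)
    moreover have "(\<lambda>n. inverse (real (Suc (r n)))) \<longlonglongrightarrow> 0"
      using LIMSEQ_subseq_LIMSEQ[OF LIMSEQ_inverse_real_of_nat r(1)] by (simp add: o_def)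
    ultimately have "\<bar>(\<Sum>t\<in>\<theta>. L b t * w t a y) - (\<Sum>t\<in>\<theta>. L' a t * w t b y)\<bar> \<le> 0"
      using U(3)[OF y] by (intro LIMSEQ_le) auto
    then show "(\<Sum>t\<in>\<theta>. L b t * w t a y) = (\<Sum>t\<in>\<theta>. L' a t * w t b y)" by simp
  qed
  with ns show False by blast
qed

text \<open>
  If \<open>x\<close> is sent, \<open>x'\<close> is another codeword and \<open>ys\<close> is received, the joint type of \<open>(x, x', ys)\<close> is close to
  one of this form: \<open>U\<close> is the joint type of \<open>x'\<close> and the state sequence, which is nearly
  independent of \<open>x\<close>.
\<close>

definition fits :: "real \<Rightarrow> nat \<Rightarrow> 'a list \<Rightarrow> 'a list \<Rightarrow> 'y list \<Rightarrow> bool" where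
  "fits \<eta> n x x' ys \<longleftrightarrow> (\<exists>U. joint_states U \<and>
     (\<forall>a b. \<forall>y\<in>Y. \<bar>(\<Sum>k<n. of_bool (x ! k = a \<and> x' ! k = b \<and> ys ! k = y))
        - n / CARD('a) * (\<Sum>t\<in>\<theta>. U b t * w t a y)\<bar> \<le> \<eta> * n))"

lemma fits_asymmetric:
  assumes ns: "\<nexists>\<tau>. symmetrized \<tau>"
  shows "\<exists>\<eta>>0. \<eta> \<le> 2 \<and> (\<forall>n>0. \<forall>x x' ys. \<not> (fits \<eta> n x x' ys \<and> fits \<eta> n x' x ys))"
proof -
  obtain \<eta> where \<eta>: "\<eta> > 0" "\<And>U U'. joint_states U \<Longrightarrow> joint_states U' \<Longrightarrow>
    \<not> (\<forall>a b. \<forall>y\<in>Y. \<bar>(\<Sum>t\<in>\<theta>. U b t * w t a y) - (\<Sum>t\<in>\<theta>. U' a t * w t b y)\<bar> \<le> \<eta>)"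
    using not_symmetrizable_gap[OF ns] by blast
  let ?A = "real CARD('a)"
  have A: "?A > 0" by simp
  \<comment> \<open>Two approximations of the same type account for the \<open>2\<close>, and the
    weight \<open>1 / CARD('a)\<close> in \<open>fits\<close> for the other factor. The cap at
    \<open>2\<close> respects the range of the tail bounds.\<close>
  define \<eta>' where "\<eta>' = min 2 (\<eta> / (2 * ?A))"
  have "\<eta>' > 0" using \<eta>(1) by (simp add: \<eta>'_def)
  moreover have "\<not> (fits \<eta>' n x x' ys \<and> fits \<eta>' n x' x ys)" if n: "n > 0" for n x x' ys
  proof
    assume "fits \<eta>' n x x' ys \<and> fits \<eta>' n x' x ys"
    then obtain U U' where U: "joint_states U" "joint_states U'"
      "\<And>a b y. y \<in> Y \<Longrightarrow> \<bar>(\<Sum>k<n. of_bool (x ! k = a \<and> x' ! k = b \<and> ys ! k = y)) - n / ?A * (\<Sum>t\<in>\<theta>. U b t * w t a y)\<bar> \<le> \<eta>' * n"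
      "\<And>a b y. y \<in> Y \<Longrightarrow> \<bar>(\<Sum>k<n. of_bool (x' ! k = a \<and> x ! k = b \<and> ys ! k = y)) - n / ?A * (\<Sum>t\<in>\<theta>. U' b t * w t a y)\<bar> \<le> \<eta>' * n"
      unfolding fits_def by blast
    have "\<bar>(\<Sum>t\<in>\<theta>. U b t * w t a y) - (\<Sum>t\<in>\<theta>. U' a t * w t b y)\<bar> \<le> \<eta>" if y: "y \<in> Y" for a b y
    proof -
      let ?S = "\<Sum>t\<in>\<theta>. U b t * w t a y" and ?S' = "\<Sum>t\<in>\<theta>. U' a t * w t b y"
      have comm: "(\<Sum>k<n. of_bool (x' ! k = b \<and> x ! k = a \<and> ys ! k = y)) = (\<Sum>k<n. of_bool (x ! k = a \<and> x' ! k = b \<and> ys ! k = y) :: real)"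
        by (intro sum.cong) auto
      have "\<bar>n / ?A * ?S - n / ?A * ?S'\<bar> \<le> 2 * \<eta>' * n"
      proof -
        have tri: "\<bar>p - r\<bar> \<le> 2 * e" if "\<bar>c - p\<bar> \<le> e" "\<bar>c - r\<bar> \<le> e" for c p r e :: real
          using that by linarith
        show ?thesis
          using tri[OF U(3)[OF y, of a b] U(4)[OF y, of b a, unfolded comm]] by (simp only: mult.assoc)
      qed
      also have "\<bar>n / ?A * ?S - n / ?A * ?S'\<bar> = n / ?A * \<bar>?S - ?S'\<bar>"
        by (simp only: right_diff_distrib[symmetric] abs_mult) simp
      finally have "\<bar>?S - ?S'\<bar> \<le> 2 * \<eta>' * ?A" using n A by (simp add: field_simps)
      also have "\<dots> \<le> 2 * (\<eta> / (2 * ?A)) * ?A" using A by (intro mult_right_mono mult_left_mono) (auto simp: \<eta>'_def)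
      also have "\<dots> = \<eta>" using A by simp
      finally show ?thesis .
    qed
    with \<eta>(2)[OF U(1,2)] show False by blast
  qed
  ultimately show ?thesis by (intro exI[of _ \<eta>']) (auto simp: \<eta>'_def)
qed

text \<open>This deviation depends on the codewords and the states but not on the output, so it is
  avoided by the choice of the codebook. The deviation in \<open>atypical\<close> depends on the
  output and is charged to the error probability. Together they make up the deviation in
  \<open>fits\<close>.\<close>

definition correlated :: "real \<Rightarrow> nat \<Rightarrow> 't list \<Rightarrow> 'a list \<Rightarrow> 'a list \<Rightarrow> bool" where
  "correlated \<eta> n s x x' \<longleftrightarrow> (\<exists>a b. \<exists>y\<in>Y.
     \<eta> * n < \<bar>\<Sum>k<n. of_bool (x' ! k = b) * w (s ! k) a y * (of_bool (x ! k = a) - 1 / CARD('a))\<bar>)"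

definition atypical :: "real \<Rightarrow> nat \<Rightarrow> 't list \<Rightarrow> 'a list \<Rightarrow> 'a list \<Rightarrow> 'y list \<Rightarrow> bool" where
  "atypical \<eta> n s x x' ys \<longleftrightarrow> (\<exists>a b. \<exists>y\<in>Y.
     \<eta> * n < \<bar>\<Sum>k<n. of_bool (x ! k = a \<and> x' ! k = b) * (of_bool (ys ! k = y) - w (s ! k) a y)\<bar>)"

lemma fits_sent:
  assumes s: "s \<in> words \<theta> n" and n: "n > 0"
    and dep: "\<not> correlated (\<eta> / 2) n s x x'" and typical: "\<not> atypical (\<eta> / 2) n s x x' ys"
  shows "fits \<eta> n x x' ys"
proof -
  define U where "U b t = (\<Sum>k<n. of_bool (x' ! k = b \<and> s ! k = t)) / n" for b t
  have pick: "(\<Sum>t\<in>\<theta>. of_bool (P \<and> s ! k = t) * f t) = of_bool P * (f (s ! k) :: real)" if "k < n" for k P f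
  proof -
    have "(\<Sum>t\<in>\<theta>. of_bool (P \<and> s ! k = t) * f t) = (\<Sum>t\<in>\<theta>. if s ! k = t then of_bool P * f t else 0)"
      by (intro sum.cong) auto
    then show ?thesis using nth_words[OF s that] finite_states by simp
  qed
  have U_sum: "n * (\<Sum>t\<in>\<theta>. U b t * f t) = (\<Sum>k<n. of_bool (x' ! k = b) * f (s ! k))" for b f
  proof -
    have "n * (\<Sum>t\<in>\<theta>. U b t * f t) = (\<Sum>t\<in>\<theta>. \<Sum>k<n. of_bool (x' ! k = b \<and> s ! k = t) * f t)"
      using n by (simp add: U_def sum_distrib_left sum_distrib_right)
    also have "\<dots> = (\<Sum>k<n. \<Sum>t\<in>\<theta>. of_bool (x' ! k = b \<and> s ! k = t) * f t)" by (rule sum.swap)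
    finally show ?thesis by (simp add: pick)
  qed
  have "joint_states U"
    unfolding joint_states_def
  proof (intro conjI allI ballI)
    have "n * (\<Sum>b\<in>UNIV. \<Sum>t\<in>\<theta>. U b t) = (\<Sum>b\<in>UNIV. n * (\<Sum>t\<in>\<theta>. U b t * 1))"
      by (simp add: sum_distrib_left)
    also have "\<dots> = (\<Sum>b\<in>UNIV. \<Sum>k<n. of_bool (x' ! k = b))" unfolding U_sum by simp
    also have "\<dots> = (\<Sum>k<n. \<Sum>b\<in>UNIV. of_bool (x' ! k = b))" by (rule sum.swap)
    also have "\<dots> = (\<Sum>k<n. \<Sum>b\<in>UNIV. if x' ! k = b then 1 else 0)" by (intro sum.cong refl) simp
    also have "\<dots> = n" by simp
    finally show "(\<Sum>b\<in>UNIV. \<Sum>t\<in>\<theta>. U b t) = 1" using n by simp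
  qed (auto simp: U_def intro!: sum_nonneg divide_nonneg_nonneg)
  moreover have "\<bar>(\<Sum>k<n. of_bool (x ! k = a \<and> x' ! k = b \<and> ys ! k = y)) - n / CARD('a) * (\<Sum>t\<in>\<theta>. U b t * w t a y)\<bar> \<le> \<eta> * n"
    if y: "y \<in> Y" for a b y
  proof -
    let ?D = "\<Sum>k<n. of_bool (x' ! k = b) * w (s ! k) a y * (of_bool (x ! k = a) - 1 / CARD('a))"
    let ?T = "\<Sum>k<n. of_bool (x ! k = a \<and> x' ! k = b) * (of_bool (ys ! k = y) - w (s ! k) a y)"
    \<comment> \<open>First the indicator of the output is replaced by its mean, at the cost
      \<open>?T\<close>, then the indicator of the sent letter by \<open>1 / CARD('a)\<close>, at
      the cost \<open>?D\<close>.\<close>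
    have "(\<Sum>k<n. of_bool (x ! k = a \<and> x' ! k = b \<and> ys ! k = y)) - (\<Sum>k<n. of_bool (x' ! k = b) * w (s ! k) a y) / CARD('a) = ?T + ?D"
      unfolding sum_divide_distrib sum_subtractf[symmetric] sum.distrib[symmetric]
      by (intro sum.cong refl) (auto simp: algebra_simps)
    moreover have "n / CARD('a) * (\<Sum>t\<in>\<theta>. U b t * w t a y) = (\<Sum>k<n. of_bool (x' ! k = b) * w (s ! k) a y) / CARD('a)"
      using U_sum[of b "\<lambda>t. w t a y"] by simp
    moreover have "\<bar>?T\<bar> \<le> \<eta> / 2 * n" using typical y unfolding atypical_def by (meson not_less)
    moreover have "\<bar>?D\<bar> \<le> \<eta> / 2 * n" using dep y unfolding correlated_def by (meson not_less)
    ultimately show ?thesis by linarith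
  qed
  ultimately show ?thesis unfolding fits_def by blast
qed

lemma w_le_1: "t \<in> \<theta> \<Longrightarrow> y \<in> Y \<Longrightarrow> w t a y \<le> 1"
  using member_le_sum[of y Y "w t a"] w_sum[of t a] w_nonneg[of t _ a] finite_outputs by auto

text \<open>The tail bound on both sides, with a union over the two letters and the output
  symbol.\<close>

definition deviation :: "real \<Rightarrow> nat \<Rightarrow> real" where
  "deviation \<eta> n = CARD('a) * CARD('a) * card Y * (2 * exp (- \<eta>\<^sup>2 / 4 * n))"

lemma sum_triples_le:
  fixes f :: "'i \<Rightarrow> real" and c :: real and P :: "'a \<Rightarrow> 'a \<Rightarrow> 'y \<Rightarrow> 'i \<Rightarrow> bool"
  assumes "finite X" "\<And>x. x \<in> X \<Longrightarrow> 0 \<le> f x" "\<And>a b y. y \<in> Y \<Longrightarrow> (\<Sum>x | x \<in> X \<and> P a b y x. f x) \<le> c"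
  shows "(\<Sum>x | x \<in> X \<and> (\<exists>a b. \<exists>y\<in>Y. P a b y x). f x) \<le> CARD('a) * CARD('a) * card Y * c"
proof -
  let ?f = "\<lambda>x. if x \<in> X then f x else 0"
  let ?I = "(UNIV :: 'a set) \<times> (UNIV :: 'a set) \<times> Y"
  let ?A = "\<lambda>(a, b, y). {x. x \<in> X \<and> P a b y x}"
  have "(\<Sum>x | x \<in> X \<and> (\<exists>a b. \<exists>y\<in>Y. P a b y x). f x) = sum ?f (\<Union>i\<in>?I. ?A i)"
    by (intro sum.cong) auto
  also have "\<dots> \<le> (\<Sum>i\<in>?I. sum ?f (?A i))"
    using finite_outputs assms by (intro sum_UN_le) auto
  also have "\<dots> \<le> (\<Sum>i\<in>?I. c)"
  proof (rule sum_mono)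
    fix i assume i: "i \<in> ?I"
    obtain a b y where i': "i = (a, b, y)" by (cases i)
    have "sum ?f (?A i) = sum f (?A i)" unfolding i' by (intro sum.cong) auto
    then show "sum ?f (?A i) \<le> c" using assms(3)[of y a b] i by (simp add: i')
  qed
  finally show ?thesis by (simp add: card_cartesian_product mult_ac)
qed

text \<open>With \<open>x'\<close> and the states fixed, the letters of a uniformly drawn
  \<open>x\<close> are independent, and every summand in \<open>correlated\<close> is
  centred.\<close>

lemma card_correlated_le:
  assumes s: "s \<in> words \<theta> n" and \<eta>: "0 \<le> \<eta>" "\<eta> \<le> 2"
  shows "card {x \<in> words UNIV n. correlated \<eta> n s x x'} \<le> deviation \<eta> n * card (words (UNIV :: 'a set) n)"
proof -
  let ?A = "real CARD('a)"
  have A: "?A > 0" by simp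
  have cw: "card (words (UNIV :: 'a set) n) = CARD('a) ^ n"
    using card_lists_length_eq[of "UNIV :: 'a set" n] by (simp add: words_def)
  have "(\<Sum>x | x \<in> words UNIV n \<and> correlated \<eta> n s x x'. \<Prod>k<n. 1 / ?A) \<le> deviation \<eta> n"
    unfolding correlated_def deviation_def
  proof (rule sum_triples_le)
    fix a b :: 'a and y assume y: "y \<in> Y"
    show "(\<Sum>x | x \<in> words UNIV n \<and> \<eta> * n < \<bar>\<Sum>k<n. of_bool (x' ! k = b) * w (s ! k) a y * (of_bool (x ! k = a) - 1 / ?A)\<bar>. \<Prod>k<n. 1 / ?A)
       \<le> 2 * exp (- \<eta>\<^sup>2 / 4 * n)"
    proof (rule words_tail_bound_abs)
      fix k x assume k: "k < n"
      have 1: "\<bar>w (s ! k) a y\<bar> \<le> 1" using nth_words[OF s k] y w_le_1 w_nonneg by auto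
      have 2: "\<bar>of_bool (x = a) - 1 / ?A\<bar> \<le> 1" using A by (auto simp: field_simps)
      show "\<bar>of_bool (x' ! k = b) * w (s ! k) a y * (of_bool (x = a) - 1 / ?A)\<bar> \<le> 1"
        using mult_mono[OF 1 2] by (auto simp: abs_mult)
    next
      fix k
      have "(\<Sum>x\<in>UNIV. of_bool (x = a) - 1 / ?A) = 0"
        by (simp add: sum_subtractf of_bool_def)
      then have "(\<Sum>x\<in>UNIV. (1 / ?A * (of_bool (x' ! k = b) * w (s ! k) a y)) * (of_bool (x = a) - 1 / ?A)) = 0"
        unfolding sum_distrib_left[symmetric] by simp
      then show "(\<Sum>x\<in>UNIV. 1 / ?A * (of_bool (x' ! k = b) * w (s ! k) a y * (of_bool (x = a) - 1 / ?A))) = 0"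
        by (simp add: mult.assoc)
    qed (use \<eta> in auto)
  qed auto
  then show ?thesis using A by (simp add: cw power_one_over field_simps)
qed

text \<open>With both codewords and the states fixed, the output letters are independent; where
  \<open>x\<close> has the letter \<open>a\<close>, the mean of the indicator of \<open>y\<close> is
  \<open>w (s ! k) a y\<close>.\<close>

lemma prob_atypical_le:
  assumes s: "s \<in> words \<theta> n" and \<eta>: "0 \<le> \<eta>" "\<eta> \<le> 2"
  shows "(\<Sum>ys | ys \<in> words Y n \<and> atypical \<eta> n s x x' ys. \<Prod>k<n. w (s ! k) (x ! k) (ys ! k)) \<le> deviation \<eta> n"
  unfolding atypical_def deviation_def
proof (rule sum_triples_le)
  show "finite (words Y n)" using finite_outputs by simp
next
  fix ys assume "ys \<in> words Y n"
  then show "0 \<le> (\<Prod>k<n. w (s ! k) (x ! k) (ys ! k))"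
    using s by (intro prod_nonneg w_nonneg nth_words ballI) auto
next
  fix a b :: 'a and y assume y: "y \<in> Y"
  show "(\<Sum>ys | ys \<in> words Y n \<and> \<eta> * n < \<bar>\<Sum>k<n. of_bool (x ! k = a \<and> x' ! k = b) * (of_bool (ys ! k = y) - w (s ! k) a y)\<bar>.
       \<Prod>k<n. w (s ! k) (x ! k) (ys ! k)) \<le> 2 * exp (- \<eta>\<^sup>2 / 4 * n)"
  proof (rule words_tail_bound_abs)
    fix k z assume k: "k < n"
    have "0 \<le> w (s ! k) a y" "w (s ! k) a y \<le> 1" using nth_words[OF s k] y w_le_1 w_nonneg by auto
    then show "\<bar>of_bool (x ! k = a \<and> x' ! k = b) * (of_bool (z = y) - w (s ! k) a y)\<bar> \<le> 1"
      by (auto simp: of_bool_def)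
  next
    fix k assume k: "k < n"
    show "(\<Sum>z\<in>Y. w (s ! k) (x ! k) z * (of_bool (x ! k = a \<and> x' ! k = b) * (of_bool (z = y) - w (s ! k) a y))) = 0"
    proof (cases "x ! k = a \<and> x' ! k = b")
      case True
      have "(\<Sum>z\<in>Y. w (s ! k) a z * (of_bool (z = y) - w (s ! k) a y))
        = (\<Sum>z\<in>Y. if z = y then w (s ! k) a z else 0) - (\<Sum>z\<in>Y. w (s ! k) a z) * w (s ! k) a y"
        unfolding sum_distrib_right sum_subtractf[symmetric] by (intro sum.cong) (auto simp: right_diff_distrib)
      then show ?thesis using True y finite_outputs w_sum[OF nth_words[OF s k]] by simp
    qed auto
  qed (use \<eta> finite_outputs w_nonneg w_sum nth_words[OF s] in auto)
qed

lemma sum_prod_w: "s \<in> words \<theta> n \<Longrightarrow> (\<Sum>ys\<in>words Y n. \<Prod>k<n. w (s ! k) (x ! k) (ys ! k)) = 1"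
  using w_sum nth_words[of s \<theta> n] by (subst sum_prod_words[where f = "\<lambda>k. w (s ! k) (x ! k)"]) simp

text \<open>For one state sequence the bad codewords number about
  \<open>n * ln (card \<theta>)\<close> up to a constant factor, a vanishing fraction of
  \<open>n ^ 4\<close>. A good codeword fails only if the output is atypical with respect to one of
  the other codewords, and a union over polynomially many of them still has exponentially small
  probability.\<close>

theorem classical_code_exists:
  fixes \<epsilon> :: real
  assumes ns: "\<nexists>\<tau>. symmetrized \<tau>" and \<theta>: "\<theta> \<noteq> {}" and \<epsilon>: "\<epsilon> > 0"
  shows "\<forall>\<^sub>F n in sequentially. \<exists>xs\<in>words (words (UNIV :: 'a set) n) (n ^ 4). \<exists>dec. \<forall>s\<in>words \<theta> n.
     (\<Sum>i<n ^ 4. \<Sum>ys | ys \<in> words Y n \<and> dec ys \<noteq> i. \<Prod>k<n. w (s ! k) (xs ! i ! k) (ys ! k)) \<le> \<epsilon> * n ^ 4"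
proof -
  obtain \<eta> where \<eta>: "\<eta> > 0" "\<eta> \<le> 2" "\<And>n x x' ys. n > 0 \<Longrightarrow> \<not> (fits \<eta> n x x' ys \<and> fits \<eta> n x' x ys)"
    using fits_asymmetric[OF ns] by blast
  define c where "c = (\<eta> / 2)\<^sup>2 / 4"
  define K where "K = CARD('a) * CARD('a) * card Y * (2::real)"
  define L where "L = ln (card \<theta>)"
  have c: "c > 0" using \<eta>(1) by (simp add: c_def)
  have q: "deviation (\<eta> / 2) n = K * exp (- c * n)" for n
    by (simp add: deviation_def c_def K_def)
  have L: "card \<theta> > 0" using \<theta> finite_states by (simp add: card_gt_0_iff)
  have "((\<lambda>n. 2 * (ln 2 + n * L + n ^ 4 * (n ^ 4 * (K * exp (- c * n)))) / ln 2 / n ^ 4 + n ^ 4 * (K * exp (- c * n))) \<longlongrightarrow> 0) at_top"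
    using c by real_asymp
  then have "((\<lambda>n::nat. 2 * (ln 2 + n * L + n ^ 4 * (n ^ 4 * (K * exp (- c * n)))) / ln 2 / n ^ 4 + n ^ 4 * (K * exp (- c * n))) \<longlongrightarrow> 0) sequentially"
    by (rule filterlim_compose[OF _ filterlim_real_sequentially])
  then have "\<forall>\<^sub>F n in sequentially. 2 * (ln 2 + real n * L + real n ^ 4 * (real n ^ 4 * (K * exp (- c * real n)))) / ln 2 / real n ^ 4 + real n ^ 4 * (K * exp (- c * real n)) < \<epsilon>"
    by (rule order_tendstoD(2)) (rule \<epsilon>)
  then show ?thesis
    using eventually_gt_at_top[of 0]
  proof eventually_elim
    case (elim n)
    let ?N = "n ^ 4" and ?q = "deviation (\<eta> / 2) n"
    let ?P = "\<lambda>s x ys. \<Prod>k<n. w (s ! k) (x ! k) (ys ! k)"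
    have q0: "?q \<ge> 0" by (simp add: deviation_def)
    obtain xs where xs: "xs \<in> words (words (UNIV :: 'a set) n) ?N" "\<And>s. s \<in> words \<theta> n \<Longrightarrow>
      2 powr (card {i. i < ?N \<and> (\<exists>j<?N. j \<noteq> i \<and> correlated (\<eta> / 2) n s (xs ! i) (xs ! j))} / 2)
        \<le> 2 * card (words \<theta> n) * exp (?N * (?N * ?q))"
      using codebook_exists[of "words (UNIV :: 'a set) n" "words \<theta> n" ?q "correlated (\<eta> / 2) n" ?N]
        card_correlated_le[of _ n "\<eta> / 2"] \<eta>(1,2) q0 finite_states words_nonempty[of "UNIV :: 'a set" n] by auto
    define accept where "accept ys i \<longleftrightarrow> i < ?N \<and> (\<forall>j<?N. j \<noteq> i \<longrightarrow> fits \<eta> n (xs ! i) (xs ! j) ys)" for ys i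
    \<comment> \<open>At most one index is accepted, by \<open>fits_asymmetric\<close>. If none is,
      the value is arbitrary and may lie outside the range of messages; the error estimate counts
      all such outputs as failures.\<close>
    define dec where "dec ys = (THE i. accept ys i)" for ys
    have dec: "dec ys = i" if "accept ys i" for ys i
      unfolding dec_def
    proof (rule the_equality[where P = "accept ys"])
      show "accept ys i" by fact
    next
      fix j assume "accept ys j"
      with that \<eta>(3)[of n "xs ! i" "xs ! j" ys] elim(2) show "j = i" unfolding accept_def by metis
    qed
    have "(\<Sum>i<?N. \<Sum>ys | ys \<in> words Y n \<and> dec ys \<noteq> i. ?P s (xs ! i) ys) \<le> \<epsilon> * ?N" if s: "s \<in> words \<theta> n" for s
    proof -
      let ?bad = "{i. i < ?N \<and> (\<exists>j<?N. j \<noteq> i \<and> correlated (\<eta> / 2) n s (xs ! i) (xs ! j))}"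
      have Pnn: "0 \<le> ?P s x ys" if "ys \<in> words Y n" for x ys
        using s that by (intro prod_nonneg w_nonneg nth_words ballI) auto
      have "(\<Sum>ys | ys \<in> words Y n \<and> dec ys \<noteq> i. ?P s (xs ! i) ys) \<le> of_bool (i \<in> ?bad) + ?N * ?q" if i: "i < ?N" for i
      proof (cases "i \<in> ?bad")
        case True
        have "(\<Sum>ys | ys \<in> words Y n \<and> dec ys \<noteq> i. ?P s (xs ! i) ys) \<le> (\<Sum>ys\<in>words Y n. ?P s (xs ! i) ys)"
          using Pnn finite_outputs by (intro sum_mono2) auto
        also have "\<dots> = 1" by (rule sum_prod_w[OF s])
        finally have le: "(\<Sum>ys | ys \<in> words Y n \<and> dec ys \<noteq> i. ?P s (xs ! i) ys) \<le> 1" .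
        have "0 \<le> ?N * ?q" using q0 by (intro mult_nonneg_nonneg) auto
        moreover have "of_bool (i \<in> ?bad) = (1 :: real)" using True by (simp only: of_bool_eq)
        ultimately show ?thesis using le by linarith
      next
        case False
        let ?A = "\<lambda>j. {ys. ys \<in> words Y n \<and> atypical (\<eta> / 2) n s (xs ! i) (xs ! j) ys}"
        let ?f = "\<lambda>ys. if ys \<in> words Y n then ?P s (xs ! i) ys else 0"
        have "(\<Sum>ys | ys \<in> words Y n \<and> dec ys \<noteq> i. ?P s (xs ! i) ys) = sum ?f {ys. ys \<in> words Y n \<and> dec ys \<noteq> i}"
          by (intro sum.cong) auto
        also have "\<dots> \<le> sum ?f (\<Union>j\<in>{..<?N}. ?A j)"
        proof (rule sum_mono2)
          show "{ys. ys \<in> words Y n \<and> dec ys \<noteq> i} \<subseteq> (\<Union>j\<in>{..<?N}. ?A j)"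
          proof
            fix ys assume "ys \<in> {ys. ys \<in> words Y n \<and> dec ys \<noteq> i}"
            then have ys: "ys \<in> words Y n" "\<not> accept ys i" using dec by auto
            then obtain j where j: "j < ?N" "j \<noteq> i" "\<not> fits \<eta> n (xs ! i) (xs ! j) ys" using i unfolding accept_def by auto
            then have "\<not> correlated (\<eta> / 2) n s (xs ! i) (xs ! j)" using False i by auto
            with fits_sent[OF s elim(2)] j have "atypical (\<eta> / 2) n s (xs ! i) (xs ! j) ys" by blast
            with ys j show "ys \<in> (\<Union>j\<in>{..<?N}. ?A j)" by auto
          qed
        qed (use Pnn finite_outputs in auto)
        also have "\<dots> \<le> (\<Sum>j<?N. sum ?f (?A j))"
          using Pnn finite_outputs by (intro sum_UN_le) auto
        also have "\<dots> \<le> (\<Sum>j<?N. ?q)"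
        proof (rule sum_mono)
          fix j
          have "sum ?f (?A j) = (\<Sum>ys\<in>?A j. ?P s (xs ! i) ys)" by (intro sum.cong) auto
          then show "sum ?f (?A j) \<le> ?q" using prob_atypical_le[OF s, of "\<eta> / 2" "xs ! i" "xs ! j"] \<eta>(1,2) by simp
        qed
        finally show ?thesis by simp
      qed
      then have "(\<Sum>i<?N. \<Sum>ys | ys \<in> words Y n \<and> dec ys \<noteq> i. ?P s (xs ! i) ys) \<le> (\<Sum>i<?N. of_bool (i \<in> ?bad) + ?N * ?q)"
        by (intro sum_mono) simp
      also have "\<dots> = card ?bad + ?N * (?N * ?q)"
      proof -
        have "(\<Sum>i<m. of_bool (i \<in> B) :: real) = card ({..<m} \<inter> B)" for B and m :: nat
          by (simp add: of_bool_def sum.If_cases)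
        then have "(\<Sum>i<?N. of_bool (i \<in> ?bad) :: real) = card ({..<?N} \<inter> ?bad)" .
        also have "{..<?N} \<inter> ?bad = ?bad" by auto
        finally show ?thesis by (simp add: sum.distrib)
      qed
      also have "card ?bad \<le> 2 * (ln 2 + n * L + ?N * (?N * ?q)) / ln 2"
      proof -
        have l: "m * ln 2 \<le> ln z" if "2 powr m \<le> z" for m z :: real
        proof -
          have "0 < 2 powr m" "0 < z" using that less_le_trans[OF _ that, of 0] by auto
          then have "ln (2 powr m) \<le> ln z" using that by (subst ln_le_cancel_iff)
          then show ?thesis by (simp add: ln_powr)
        qed
        have 1: "card ?bad / 2 * ln 2 \<le> ln (2 * card (words \<theta> n) * exp (?N * (?N * ?q)))"
          by (rule l[OF xs(2)[OF s]])
        have 2: "card (words \<theta> n) = card \<theta> ^ n"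
          unfolding words_def using finite_states by (simp add: card_lists_length_eq)
        have "ln (2 * real (card \<theta> ^ n) * exp (?N * (?N * ?q))) = ln 2 + n * L + ?N * (?N * ?q)"
          using L by (simp add: ln_mult ln_realpow L_def)
        with 1 have "card ?bad / 2 * ln 2 \<le> ln 2 + n * L + ?N * (?N * ?q)" unfolding 2 by simp
        then show ?thesis by (simp add: field_simps)
      qed
      finally have "(\<Sum>i<?N. \<Sum>ys | ys \<in> words Y n \<and> dec ys \<noteq> i. ?P s (xs ! i) ys)
        \<le> 2 * (ln 2 + n * L + ?N * (?N * ?q)) / ln 2 + ?N * (?N * ?q)" by simp
      also have "\<dots> = (2 * (ln 2 + real n * L + real n ^ 4 * (real n ^ 4 * (K * exp (- c * real n)))) / ln 2 / real n ^ 4 + real n ^ 4 * (K * exp (- c * real n))) * real n ^ 4"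
        unfolding q using elim(2) by (simp add: add_divide_distrib distrib_right)
      also have "\<dots> \<le> \<epsilon> * ?N" using elim(1) by (simp add: mult_right_mono)
      finally show ?thesis .
    qed
    with xs(1) show ?case by blast
  qed
qed

end

section \<open>Sums of matrices\<close>

lemma mat_sum_carrier [simp]: "mat_sum d X F \<in> carrier_mat d d"
  by (simp add: mat_sum_def)

lemma mat_sum_dim [simp]: "dim_row (mat_sum d X F) = d" "dim_col (mat_sum d X F) = d"
  by (simp_all add: mat_sum_def)

lemma mat_sum_index: "i < d \<Longrightarrow> j < d \<Longrightarrow> mat_sum d X F $$ (i, j) = (\<Sum>x\<in>X. F x $$ (i, j))"
  by (simp add: mat_sum_def)

lemma mat_trace_mult_mat_sum:
  assumes A: "A \<in> carrier_mat d d" and F: "\<And>x. x \<in> X \<Longrightarrow> F x \<in> carrier_mat d d"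
  shows "mat_trace (A * mat_sum d X F) = (\<Sum>x\<in>X. mat_trace (A * F x))"
proof -
  have "mat_trace (A * mat_sum d X F) = (\<Sum>i<d. \<Sum>j<d. \<Sum>x\<in>X. A $$ (i, j) * F x $$ (j, i))"
    using A by (subst mat_trace_mult[of _ d d]) (auto simp: mat_sum_index sum_distrib_left)
  also have "\<dots> = (\<Sum>i<d. \<Sum>x\<in>X. \<Sum>j<d. A $$ (i, j) * F x $$ (j, i))"
    by (rule sum.cong[OF refl], rule sum.swap)
  also have "\<dots> = (\<Sum>x\<in>X. \<Sum>i<d. \<Sum>j<d. A $$ (i, j) * F x $$ (j, i))"
    by (rule sum.swap)
  also have "\<dots> = (\<Sum>x\<in>X. mat_trace (A * F x))"
    using A F by (intro sum.cong refl) (simp add: mat_trace_mult[of _ d d])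
  finally show ?thesis .
qed

lemma positive_semidef_mat_sum:
  assumes "\<And>x. x \<in> X \<Longrightarrow> positive_semidef d (F x)"
  shows "positive_semidef d (mat_sum d X F)"
  unfolding positive_semidef_iff_quad
proof (intro conjI allI)
  fix f
  have "quad d (mat_sum d X F) f = (\<Sum>i<d. \<Sum>j<d. \<Sum>x\<in>X. cnj (f i) * F x $$ (i, j) * f j)"
    unfolding quad_def by (intro sum.cong refl) (auto simp: mat_sum_index sum_distrib_left sum_distrib_right)
  also have "\<dots> = (\<Sum>i<d. \<Sum>x\<in>X. \<Sum>j<d. cnj (f i) * F x $$ (i, j) * f j)"
    by (rule sum.cong[OF refl], rule sum.swap)
  also have "\<dots> = (\<Sum>x\<in>X. quad d (F x) f)"
    unfolding quad_def by (rule sum.swap)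
  finally show "0 \<le> quad d (mat_sum d X F) f"
    using assms by (auto intro!: sum_nonneg positive_semidef_quad)
qed simp

lemma tensor_mat_sum:
  assumes F: "\<And>x. x \<in> X \<Longrightarrow> F x \<in> carrier_mat n n" and G: "\<And>z. z \<in> Z \<Longrightarrow> G z \<in> carrier_mat k k"
  shows "tensor_mat (mat_sum n X F) (mat_sum k Z G) = mat_sum (n * k) (X \<times> Z) (\<lambda>(x, z). tensor_mat (F x) (G z))"
proof (rule eq_matI)
  fix i j assume "i < dim_row (mat_sum (n * k) (X \<times> Z) (\<lambda>(x, z). tensor_mat (F x) (G z)))"
    "j < dim_col (mat_sum (n * k) (X \<times> Z) (\<lambda>(x, z). tensor_mat (F x) (G z)))"
  then have ij: "i < n * k" "j < n * k" by auto
  note b = div_mod_less[OF ij(1)] div_mod_less[OF ij(2)]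
  have "tensor_mat (mat_sum n X F) (mat_sum k Z G) $$ (i, j)
    = (\<Sum>x\<in>X. F x $$ (i div k, j div k)) * (\<Sum>z\<in>Z. G z $$ (i mod k, j mod k))"
    using ij b by (subst tensor_mat_index[of _ n n _ k k]) (simp_all add: mat_sum_index)
  also have "\<dots> = (\<Sum>x\<in>X. \<Sum>z\<in>Z. tensor_mat (F x) (G z) $$ (i, j))"
    unfolding sum_product using ij by (intro sum.cong refl) (simp add: tensor_mat_index[OF F G])
  finally show "tensor_mat (mat_sum n X F) (mat_sum k Z G) $$ (i, j)
    = mat_sum (n * k) (X \<times> Z) (\<lambda>(x, z). tensor_mat (F x) (G z)) $$ (i, j)"
    using ij by (simp add: mat_sum_index sum.cartesian_product case_prod_beta)
qed auto

text \<open>The summed family may vary with the position through \<open>ps\<close>. A product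
  measurement uses the same family everywhere, while for a product jamming distribution it depends
  on the letters at that position.\<close>

lemma tensor_list_mat_sum:
  assumes "\<And>p x. p \<in> set ps \<Longrightarrow> x \<in> X \<Longrightarrow> F p x \<in> carrier_mat d d"
  shows "mat_sum (d ^ length ps) (words X (length ps)) (\<lambda>xs. tensor_list (map2 F ps xs))
    = tensor_list (map (\<lambda>p. mat_sum d X (F p)) ps)"
  using assms
proof (induction ps)
  case Nil
  show ?case by (rule eq_matI) (auto simp: mat_sum_index)
next
  case (Cons p ps)
  let ?m = "length ps"
  have c: "tensor_list (map2 F ps xs) \<in> carrier_mat (d ^ ?m) (d ^ ?m)" if xs: "xs \<in> words X ?m" for xs
  proof -
    have "A \<in> carrier_mat d d" if A: "A \<in> set (map2 F ps xs)" for A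
    proof -
      obtain p x where px: "A = F p x" "(p, x) \<in> set (zip ps xs)" using A by auto
      then show ?thesis
        using Cons.prems set_zip_leftD[OF px(2)] set_words[OF xs set_zip_rightD[OF px(2)]] by simp
    qed
    from tensor_list_carrier[of "map2 F ps xs" d, OF this] show ?thesis
      using length_words[OF xs] by simp
  qed
  have "tensor_list (map (\<lambda>p. mat_sum d X (F p)) (p # ps))
    = tensor_mat (mat_sum d X (F p)) (mat_sum (d ^ ?m) (words X ?m) (\<lambda>xs. tensor_list (map2 F ps xs)))"
    using Cons by simp
  also have "\<dots> = mat_sum (d ^ length (p # ps)) (X \<times> words X ?m) (\<lambda>(x, xs). tensor_mat (F p x) (tensor_list (map2 F ps xs)))"
    using Cons.prems c by (subst tensor_mat_sum) auto
  also have "\<dots> = mat_sum (d ^ length (p # ps)) (words X (Suc ?m)) (\<lambda>xs. tensor_list (map2 F (p # ps) xs))"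
    unfolding mat_sum_def words_Suc by (subst sum.reindex) (auto simp: inj_on_def case_prod_beta)
  finally show ?case by simp
qed

section \<open>An informationally complete measurement\<close>

text \<open>
  By polarization, the numbers \<open>v\<^sup>* A v\<close> for the vectors \<open>v = \<i>\<^sup>k e\<^sub>a + e\<^sub>b\<close> determine \<open>A\<close>. Summation over
  \<open>k < 4\<close> cancels the mixed terms of \<open>v v\<^sup>*\<close>, so the normalized projections add up to the identity.
\<close>

definition pol_vec :: "nat \<times> nat \<times> nat \<Rightarrow> nat \<Rightarrow> complex" where
  "pol_vec = (\<lambda>(a, b, k) j. (if j = a then \<i> ^ k else 0) + (if j = b then 1 else 0))"

text \<open>Each basis vector occurs in \<open>d\<close> pairs as the first and in \<open>d\<close>
  pairs as the second component, each time for four values of \<open>k\<close>; this accounts for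
  \<open>8 * d\<close>.\<close>

definition pol_effect :: "nat \<Rightarrow> nat \<times> nat \<times> nat \<Rightarrow> complex mat" where
  "pol_effect d y = Matrix.mat d d (\<lambda>(i, j). pol_vec y i * cnj (pol_vec y j) / of_nat (8 * d))"

abbreviation pol_outcomes :: "nat \<Rightarrow> (nat \<times> nat \<times> nat) set" where
  "pol_outcomes d \<equiv> {..<d} \<times> {..<d} \<times> {..<4}"

lemma pol_effect_carrier [simp]: "pol_effect d y \<in> carrier_mat d d"
  by (simp add: pol_effect_def)

lemma of_real_nonneg_complex: "0 \<le> r \<Longrightarrow> 0 \<le> complex_of_real r"
  by (simp add: less_eq_complex_def)

lemma positive_semidef_pol_effect: "positive_semidef d (pol_effect d y)"
  unfolding positive_semidef_iff_quad
proof (intro conjI allI)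
  fix f
  define z where "z = (\<Sum>i<d. cnj (f i) * pol_vec y i)"
  have "quad d (pol_effect d y) f = (\<Sum>i<d. \<Sum>j<d. (cnj (f i) * pol_vec y i) * (f j * cnj (pol_vec y j))) / of_nat (8 * d)"
    unfolding quad_def by (auto simp: pol_effect_def sum_divide_distrib mult_ac intro!: sum.cong)
  also have "\<dots> = z * cnj z / of_nat (8 * d)"
    by (simp add: z_def sum_product)
  also have "\<dots> = complex_of_real ((cmod z)\<^sup>2 / real (8 * d))"
    by (simp add: complex_norm_square[symmetric] del: of_real_power)
  finally show "0 \<le> quad d (pol_effect d y) f"
    by (simp only:) (rule of_real_nonneg_complex, simp)
qed simp

lemma mat_trace_pol_effect:
  assumes "A \<in> carrier_mat d d"
  shows "mat_trace (A * pol_effect d y) = quad d A (pol_vec y) / of_nat (8 * d)"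
  using assms unfolding quad_def
  by (subst mat_trace_mult[of _ d d]) (auto simp: pol_effect_def sum_divide_distrib mult_ac intro!: sum.cong)

lemma mat_sum_pol_effect:
  assumes d: "d > 0"
  shows "mat_sum d (pol_outcomes d) (pol_effect d) = 1\<^sub>m d"
proof (rule eq_matI)
  fix i j assume "i < dim_row (1\<^sub>m d :: complex mat)" "j < dim_col (1\<^sub>m d :: complex mat)"
  then have ij: "i < d" "j < d" by auto
  have set4: "{..<4} = {0, 1, 2, 3::nat}" by auto
  have k: "(\<Sum>k<4. pol_vec (a, b, k) i * cnj (pol_vec (a, b, k) j))
     = (if a = i then (if i = j then 4 else 0) else 0) + (if b = i then (if i = j then 4 else 0) else 0)" for a b
    unfolding set4 by (auto simp: pol_vec_def power2_eq_square power3_eq_cube algebra_simps)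
  have "mat_sum d (pol_outcomes d) (pol_effect d) $$ (i, j)
    = (\<Sum>a<d. \<Sum>b<d. \<Sum>k<4. pol_vec (a, b, k) i * cnj (pol_vec (a, b, k) j)) / of_nat (8 * d)"
    using ij by (simp add: mat_sum_index pol_effect_def sum.cartesian_product case_prod_beta sum_divide_distrib)
  also have "(\<Sum>a<d. \<Sum>b<d. \<Sum>k<4. pol_vec (a, b, k) i * cnj (pol_vec (a, b, k) j)) = of_nat (8 * d) * (if i = j then 1 else 0)"
    unfolding k using ij by (simp add: sum.distrib sum_distrib_left[symmetric])
  finally show "mat_sum d (pol_outcomes d) (pol_effect d) $$ (i, j) = 1\<^sub>m d $$ (i, j)"
    using d ij by simp
qed auto

lemma pol_effect_separates:
  assumes A: "A \<in> carrier_mat d d" and B: "B \<in> carrier_mat d d"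
    and eq: "\<And>y. y \<in> pol_outcomes d \<Longrightarrow> mat_trace (A * pol_effect d y) = mat_trace (B * pol_effect d y)"
  shows "A = B"
proof (rule eq_matI)
  fix i j assume "i < dim_row B" "j < dim_col B"
  then have ij: "i < d" "j < d" using B by auto
  have "quad d A (pol_vec (i, j, k)) = quad d B (pol_vec (i, j, k))" if "k < 4" for k
    using eq[of "(i, j, k)"] ij that by (simp add: mat_trace_pol_effect[OF A] mat_trace_pol_effect[OF B])
  then have "4 * A $$ (i, j) = 4 * B $$ (i, j)"
    unfolding polarization[OF ij] by (simp add: pol_vec_def)
  then show "A $$ (i, j) = B $$ (i, j)" by simp
qed (use A B in auto)

section \<open>Words sent through a channel family\<close>

definition word_state :: "('t \<Rightarrow> 'a::finite pmf \<Rightarrow> complex mat) \<Rightarrow> 't list \<Rightarrow> 'a list \<Rightarrow> complex mat" where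
  "word_state W ts as = tensor_list (map2 (\<lambda>t a. at_letter (W t) a) ts as)"

lemma cq_channel_density: "cq_channel d W \<Longrightarrow> W P \<in> density_operators d"
  by (simp add: cq_channel_def)

lemma word_state_density:
  assumes W: "\<And>t. t \<in> \<theta> \<Longrightarrow> cq_channel d (W t)" and ts: "ts \<in> words \<theta> n" and as: "length as = n"
  shows "word_state W ts as \<in> density_operators (d ^ n)"
proof -
  have "A \<in> density_operators d" if "A \<in> set (map2 (\<lambda>t a. at_letter (W t) a) ts as)" for A
    using that cq_channel_density[OF W] set_words[OF ts] by (auto dest!: set_zip_leftD)
  from density_tensor_list[of "map2 (\<lambda>t a. at_letter (W t) a) ts as" d, OF this] show ?thesis
    using length_words[OF ts] as by (simp add: word_state_def)
qed

lemma channel_ext_word_state: "channel_ext d W ts P = mixture (d ^ length ts) P (word_state W ts)"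
  by (simp add: channel_ext_def word_state_def[abs_def])

lemma finite_set_pmf_words: "set_pmf P \<subseteq> words (UNIV :: 'a::finite set) n \<Longrightarrow> finite (set_pmf P)"
  by (rule finite_subset[of _ "words UNIV n"]) auto

lemma channel_ext_density:
  assumes W: "\<And>t. t \<in> \<theta> \<Longrightarrow> cq_channel d (W t)" and ts: "ts \<in> words \<theta> n"
    and P: "set_pmf P \<subseteq> words UNIV n"
  shows "channel_ext d W ts P \<in> density_operators (d ^ n)"
  unfolding channel_ext_word_state length_words[OF ts]
  using word_state_density[of \<theta> d W ts n] W ts P
  by (intro mixture_density finite_set_pmf_words[OF P]) (auto simp: words_def)

lemma mixture_return:
  assumes "F x \<in> carrier_mat d d"
  shows "mixture d (return_pmf x) F = F x"
  using assms by (intro eq_matI) (auto simp: mixture_def mat_sum_def)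

lemma mat_trace_density_psd:
  assumes "\<rho> \<in> density_operators d" "positive_semidef d D"
  shows "mat_trace (\<rho> * D) = of_real (Re (mat_trace (\<rho> * D)))" "0 \<le> Re (mat_trace (\<rho> * D))"
  using mat_trace_mult_nonneg[OF density_psd[OF assms(1)] assms(2)]
  by (auto simp: less_eq_complex_def complex_eq_iff)

lemma mixture_eq_mat_sum:
  assumes S: "finite S" "set_pmf Q \<subseteq> S" and F: "\<And>x. x \<in> S \<Longrightarrow> F x \<in> carrier_mat d d"
  shows "mixture d Q F = mat_sum d S (\<lambda>x. complex_of_real (pmf Q x) \<cdot>\<^sub>m F x)"
proof (rule eq_matI)
  fix i j assume "i < dim_row (mat_sum d S (\<lambda>x. complex_of_real (pmf Q x) \<cdot>\<^sub>m F x))"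
    "j < dim_col (mat_sum d S (\<lambda>x. complex_of_real (pmf Q x) \<cdot>\<^sub>m F x))"
  then have ij: "i < d" "j < d" by auto
  have "(\<Sum>x\<in>set_pmf Q. complex_of_real (pmf Q x) * F x $$ (i, j)) = (\<Sum>x\<in>S. complex_of_real (pmf Q x) * F x $$ (i, j))"
    using S by (intro sum.mono_neutral_left) (auto simp: set_pmf_iff)
  also have "\<dots> = (\<Sum>x\<in>S. (complex_of_real (pmf Q x) \<cdot>\<^sub>m F x) $$ (i, j))"
    using carrier_matD[OF F] ij by (intro sum.cong) auto
  finally show "mixture d Q F $$ (i, j) = mat_sum d S (\<lambda>x. complex_of_real (pmf Q x) \<cdot>\<^sub>m F x) $$ (i, j)"
    using ij F S(2) by (subst mixture_index) (auto simp: mat_sum_index)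
qed (auto simp: mixture_def)

lemma mat_trace_mixture_mult':
  assumes S: "finite S" "set_pmf Q \<subseteq> S" and F: "\<And>x. x \<in> S \<Longrightarrow> F x \<in> carrier_mat d d" and B: "B \<in> carrier_mat d d"
  shows "mat_trace (mixture d Q F * B) = (\<Sum>x\<in>S. of_real (pmf Q x) * mat_trace (F x * B))"
proof -
  have "mat_trace (mixture d Q F * B) = (\<Sum>x\<in>set_pmf Q. of_real (pmf Q x) * mat_trace (F x * B))"
    using S F B by (intro mat_trace_mixture_mult) auto
  also have "\<dots> = (\<Sum>x\<in>S. of_real (pmf Q x) * mat_trace (F x * B))"
    using S by (intro sum.mono_neutral_left) (auto simp: set_pmf_iff)
  finally show ?thesis .
qed

section \<open>A code for a nonsymmetrizable channel\<close>

lemma embed_pmf_finite: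
  fixes f :: "'t \<Rightarrow> real"
  assumes S: "finite S" and f: "\<And>t. t \<in> S \<Longrightarrow> 0 \<le> f t" "(\<Sum>t\<in>S. f t) = 1"
  obtains Q where "set_pmf Q \<subseteq> S" "\<And>t. t \<in> S \<Longrightarrow> pmf Q t = f t"
proof -
  let ?g = "\<lambda>t. if t \<in> S then f t else 0"
  have nn: "(\<integral>\<^sup>+t. ennreal (?g t) \<partial>count_space UNIV) = 1"
  proof -
    have "(\<integral>\<^sup>+t. ennreal (?g t) \<partial>count_space UNIV) = (\<Sum>t\<in>S. ennreal (?g t))"
      using S by (intro nn_integral_count_space') auto
    also have "\<dots> = ennreal (\<Sum>t\<in>S. f t)" using f by (subst sum_ennreal[symmetric]) auto
    finally show ?thesis using f by simp
  qed
  have pmf: "pmf (embed_pmf ?g) t = ?g t" for t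
    using f nn by (intro pmf_embed_pmf) auto
  then have "set_pmf (embed_pmf ?g) \<subseteq> S" by (auto simp: set_pmf_iff split: if_splits)
  with pmf that[of "embed_pmf ?g"] show ?thesis by simp
qed

theorem prefix_code_exists:
  fixes W :: "'t \<Rightarrow> 'a::finite pmf \<Rightarrow> complex mat" and \<epsilon> :: real
  assumes \<theta>: "finite \<theta>" "\<theta> \<noteq> {}" and W: "\<And>t. t \<in> \<theta> \<Longrightarrow> cq_channel d (W t)"
    and ns: "\<not> symmetrizable d \<theta> W" and \<epsilon>: "\<epsilon> > 0"
  shows "\<forall>\<^sub>F n in sequentially. \<exists>xs\<in>words (words (UNIV :: 'a set) n) (n ^ 4). \<exists>F.
     (\<forall>i. positive_semidef (d ^ n) (F i)) \<and> mat_sum (d ^ n) {..<n ^ 4} F = 1\<^sub>m (d ^ n) \<and>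
     (\<forall>ts\<in>words \<theta> n. (\<Sum>i<n ^ 4. 1 - Re (mat_trace (word_state W ts (xs ! i) * F i))) \<le> \<epsilon> * n ^ 4)"
proof -
  obtain t0 where "t0 \<in> \<theta>" using \<theta> by blast
  then have d: "d > 0" using density_dim_pos[OF cq_channel_density[OF W]] by blast
  let ?M = "pol_effect d" and ?Y = "pol_outcomes d"
  define w where "w t a y = Re (mat_trace (at_letter (W t) a * ?M y))" for t a y
  have dens: "at_letter (W t) a \<in> density_operators d" if "t \<in> \<theta>" for t a
    using cq_channel_density[OF W[OF that]] .
  have w: "mat_trace (at_letter (W t) a * ?M y) = of_real (w t a y)" "0 \<le> w t a y" if "t \<in> \<theta>" for t a y
    unfolding w_def using mat_trace_density_psd[OF dens[OF that] positive_semidef_pol_effect] by auto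
  interpret finite_avc \<theta> ?Y w
  proof
    fix t a assume t: "t \<in> \<theta>"
    have "complex_of_real (\<Sum>y\<in>?Y. w t a y) = mat_trace (at_letter (W t) a * mat_sum d ?Y ?M)"
      using t by (subst mat_trace_mult_mat_sum) (auto intro: density_carrier dens simp: w)
    also have "\<dots> = 1" using dens[OF t] density_carrier[OF dens[OF t]]
      by (simp add: mat_sum_pol_effect[OF d] density_operators_def)
    finally show "(\<Sum>y\<in>?Y. w t a y) = 1" by (simp only: of_real_eq_1_iff)
  qed (use \<theta> w in auto)
  have "\<nexists>\<tau>. symmetrized \<tau>"
  proof
    assume "\<exists>\<tau>. symmetrized \<tau>"
    then obtain \<tau> where \<tau>: "\<And>a t. t \<in> \<theta> \<Longrightarrow> 0 \<le> \<tau> a t" "\<And>a. (\<Sum>t\<in>\<theta>. \<tau> a t) = 1"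
      "\<And>a a' y. y \<in> ?Y \<Longrightarrow> (\<Sum>t\<in>\<theta>. \<tau> a t * w t a' y) = (\<Sum>t\<in>\<theta>. \<tau> a' t * w t a y)"
      unfolding symmetrized_def by blast
    have "\<exists>Q. set_pmf Q \<subseteq> \<theta> \<and> (\<forall>t\<in>\<theta>. pmf Q t = \<tau> a t)" for a
      using embed_pmf_finite[OF \<theta>(1), of "\<tau> a"] \<tau>(1,2) by metis
    then obtain Q where Q: "\<And>a. set_pmf (Q a) \<subseteq> \<theta>" "\<And>a t. t \<in> \<theta> \<Longrightarrow> pmf (Q a) t = \<tau> a t" by metis
    \<comment> \<open>The effects separate matrices, so equality of the outcome probabilities lifts
      to equality of the averaged output states.\<close>
    have "mixture d (Q a) (\<lambda>t. at_letter (W t) a') = mixture d (Q a') (\<lambda>t. at_letter (W t) a)" for a a'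
    proof (rule pol_effect_separates)
      fix y assume y: "y \<in> ?Y"
      have tr: "mat_trace (mixture d (Q a) (\<lambda>t. at_letter (W t) a') * ?M y) = of_real (\<Sum>t\<in>\<theta>. \<tau> a t * w t a' y)" for a a'
        using \<theta> Q by (subst mat_trace_mixture_mult'[of \<theta>]) (auto intro: density_carrier dens simp: w)
      show "mat_trace (mixture d (Q a) (\<lambda>t. at_letter (W t) a') * ?M y) = mat_trace (mixture d (Q a') (\<lambda>t. at_letter (W t) a) * ?M y)"
        unfolding tr using \<tau>(3)[OF y] by simp
    qed auto
    then have "symmetrizable d \<theta> W" unfolding symmetrizable_def using Q(1) by blast
    with ns show False by blast
  qed
  from classical_code_exists[OF this \<theta>(2) \<epsilon>] show ?thesis
    using eventually_gt_at_top[of 0]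
  proof eventually_elim
    case (elim n)
    let ?N = "n ^ 4"
    have N: "?N > 0" using elim(2) by simp
    obtain xs dec0 where xs: "xs \<in> words (words (UNIV :: 'a set) n) ?N"
      "\<And>s. s \<in> words \<theta> n \<Longrightarrow> (\<Sum>i<?N. \<Sum>ys | ys \<in> words ?Y n \<and> dec0 ys \<noteq> i. \<Prod>k<n. w (s ! k) (xs ! i ! k) (ys ! k)) \<le> \<epsilon> * ?N"
      using elim(1) by blast
    \<comment> \<open>Values outside the range of messages are sent to \<open>0\<close>, so that the
      operators \<open>F i\<close> with \<open>i < ?N\<close> add up to the identity. No correct
      decision is changed by this.\<close>
    define dec where "dec ys = (if dec0 ys < ?N then dec0 ys else 0)" for ys
    let ?T = "\<lambda>ys. tensor_list (map ?M ys)"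
    have Tpsd: "positive_semidef (d ^ n) (?T ys)" if "ys \<in> words ?Y n" for ys
    proof -
      have "positive_semidef (d ^ length (map ?M ys)) (?T ys)"
        by (rule positive_semidef_tensor_list) (auto simp: positive_semidef_pol_effect)
      then show ?thesis using length_words[OF that] by simp
    qed
    have Tc: "?T ys \<in> carrier_mat (d ^ n) (d ^ n)" if "ys \<in> words ?Y n" for ys
      using Tpsd[OF that] by simp
    define F where "F i = mat_sum (d ^ n) {ys \<in> words ?Y n. dec ys = i} ?T" for i
    have finY: "finite (words ?Y n)" by (intro finite_words) auto
    have one: "mat_sum (d ^ n) (words ?Y n) ?T = 1\<^sub>m (d ^ n)"
    proof -
      have "map2 (\<lambda>_. ?M) (replicate n ()) ys = map ?M ys" if "ys \<in> words ?Y n" for ys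
        using length_words[OF that] by (intro nth_equalityI) auto
      then have "mat_sum (d ^ n) (words ?Y n) ?T = mat_sum (d ^ n) (words ?Y n) (\<lambda>ys. tensor_list (map2 (\<lambda>_. ?M) (replicate n ()) ys))"
        unfolding mat_sum_def by (intro cong_mat) auto
      also have "\<dots> = tensor_list (map (\<lambda>p. mat_sum d ?Y ?M) (replicate n ()))"
        using tensor_list_mat_sum[of "replicate n ()" ?Y "\<lambda>_. ?M" d] by simp
      also have "\<dots> = 1\<^sub>m (d ^ n)"
        unfolding mat_sum_pol_effect[OF d] by (induction n) (auto simp: tensor_mat_one)
      finally show ?thesis .
    qed
    have "mat_sum (d ^ n) {..<?N} F = mat_sum (d ^ n) (words ?Y n) ?T"
    proof (rule eq_matI)
      fix i j assume "i < dim_row (mat_sum (d ^ n) (words ?Y n) ?T)" "j < dim_col (mat_sum (d ^ n) (words ?Y n) ?T)"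
      then have ij: "i < d ^ n" "j < d ^ n" by auto
      have "(\<Sum>l<?N. \<Sum>ys | ys \<in> words ?Y n \<and> dec ys = l. ?T ys $$ (i, j)) = (\<Sum>ys\<in>words ?Y n. ?T ys $$ (i, j))"
        using finY N by (intro sum.group) (auto simp: dec_def)
      then show "mat_sum (d ^ n) {..<?N} F $$ (i, j) = mat_sum (d ^ n) (words ?Y n) ?T $$ (i, j)"
        using ij by (simp add: mat_sum_index F_def)
    qed auto
    moreover have "positive_semidef (d ^ n) (F i)" for i
      unfolding F_def using Tpsd by (intro positive_semidef_mat_sum) auto
    moreover have "(\<Sum>i<?N. 1 - Re (mat_trace (word_state W ts (xs ! i) * F i))) \<le> \<epsilon> * ?N" if ts: "ts \<in> words \<theta> n" for ts
    proof -
      let ?P = "\<lambda>x ys. \<Prod>k<n. w (ts ! k) (x ! k) (ys ! k)"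
      have "1 - Re (mat_trace (word_state W ts (xs ! i) * F i)) \<le> (\<Sum>ys | ys \<in> words ?Y n \<and> dec0 ys \<noteq> i. ?P (xs ! i) ys)"
        if i: "i < ?N" for i
      proof -
        have len: "length (xs ! i) = n" "length ts = n" using nth_words[OF xs(1) i] ts by (auto simp: words_def)
        have tr: "mat_trace (word_state W ts (xs ! i) * ?T ys) = of_real (?P (xs ! i) ys)" if ys: "ys \<in> words ?Y n" for ys
        proof -
          have "mat_trace (word_state W ts (xs ! i) * ?T ys)
            = (\<Prod>k<n. mat_trace (at_letter (W (ts ! k)) (xs ! i ! k) * ?M (ys ! k)))"
            unfolding word_state_def using len length_words[OF ys] dens set_words[OF ts]
            by (subst mat_trace_tensor_list_mult[where d = d])
              (auto intro: density_carrier dest!: set_zip_leftD)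
          also have "\<dots> = of_real (?P (xs ! i) ys)" using nth_words[OF ts] by (simp add: w)
          finally show ?thesis .
        qed
        have wc: "word_state W ts (xs ! i) \<in> carrier_mat (d ^ n) (d ^ n)"
          using word_state_density[OF W ts len(1)] by (rule density_carrier)
        have "mat_trace (word_state W ts (xs ! i) * F i) = (\<Sum>ys | ys \<in> words ?Y n \<and> dec ys = i. of_real (?P (xs ! i) ys))"
          unfolding F_def using wc Tc by (subst mat_trace_mult_mat_sum) (auto simp: tr)
        then have "Re (mat_trace (word_state W ts (xs ! i) * F i)) = (\<Sum>ys | ys \<in> words ?Y n \<and> dec ys = i. ?P (xs ! i) ys)"
          by (simp flip: of_real_prod of_real_sum)
        moreover have "(\<Sum>ys | ys \<in> words ?Y n \<and> dec ys = i. ?P (xs ! i) ys) + (\<Sum>ys | ys \<in> words ?Y n \<and> dec ys \<noteq> i. ?P (xs ! i) ys) = 1"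
        proof -
          have "(\<Sum>ys | ys \<in> words ?Y n \<and> dec ys = i. ?P (xs ! i) ys) + (\<Sum>ys | ys \<in> words ?Y n \<and> dec ys \<noteq> i. ?P (xs ! i) ys)
            = (\<Sum>ys\<in>words ?Y n. ?P (xs ! i) ys)"
            using finY by (subst sum.union_disjoint[symmetric]) (auto intro!: sum.cong)
          then show ?thesis using sum_prod_w[OF ts] by simp
        qed
        moreover have "(\<Sum>ys | ys \<in> words ?Y n \<and> dec ys \<noteq> i. ?P (xs ! i) ys) \<le> (\<Sum>ys | ys \<in> words ?Y n \<and> dec0 ys \<noteq> i. ?P (xs ! i) ys)"
        proof (rule sum_mono2)
          show "finite {ys. ys \<in> words ?Y n \<and> dec0 ys \<noteq> i}" using finY by simp
          show "{ys. ys \<in> words ?Y n \<and> dec ys \<noteq> i} \<subseteq> {ys. ys \<in> words ?Y n \<and> dec0 ys \<noteq> i}"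
            using i by (auto simp: dec_def)
          fix ys show "0 \<le> ?P (xs ! i) ys" using nth_words[OF ts] by (intro prod_nonneg) (auto simp: w)
        qed
        ultimately show ?thesis by linarith
      qed
      then have "(\<Sum>i<?N. 1 - Re (mat_trace (word_state W ts (xs ! i) * F i))) \<le> (\<Sum>i<?N. \<Sum>ys | ys \<in> words ?Y n \<and> dec0 ys \<noteq> i. ?P (xs ! i) ys)"
        by (intro sum_mono) simp
      also have "\<dots> \<le> \<epsilon> * ?N" by (rule xs(2)[OF ts])
      finally show ?thesis .
    qed
    ultimately show ?case using xs(1) one by (intro bexI[of _ xs] exI[of _ F]) auto
  qed
qed

section \<open>Derandomization\<close>

lemma (in prob_space) exists_le_expectation:
  fixes f :: "'a \<Rightarrow> real"
  assumes "integrable M f"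
  shows "\<exists>x\<in>space M. f x \<le> expectation f"
proof (rule ccontr)
  assume "\<not> ?thesis"
  then have "AE x in M. expectation f < f x" by (auto intro!: AE_I2)
  from expectation_greater[OF assms this] show False by simp
qed

text \<open>
  The method of conditional expectations, applied to the sum over \<open>i\<close> of the exponential moments of
  \<open>g i - E (g i)\<close>.
\<close>

lemma (in prob_space) exists_sample:
  fixes g :: "'i \<Rightarrow> 'a \<Rightarrow> real"
  assumes I: "finite I" "I \<noteq> {}" and g: "\<And>i. i \<in> I \<Longrightarrow> g i \<in> borel_measurable M"
    "\<And>i x. i \<in> I \<Longrightarrow> x \<in> space M \<Longrightarrow> \<bar>g i x\<bar> \<le> 1"
    and \<eta>: "0 < \<eta>" "\<eta> \<le> 1" and L: "16 * ln (card I) \<le> \<eta>\<^sup>2 * L"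
  shows "\<exists>xs. length xs = L \<and> set xs \<subseteq> space M \<and> (\<forall>i\<in>I. (\<Sum>x\<leftarrow>xs. g i x) \<le> L * (expectation (g i) + \<eta>))"
proof -
  \<comment> \<open>With this value \<open>4 * l\<^sup>2\<close> is half of
    \<open>l * \<eta>\<close>: one half of the admissible deviation pays for the exponential
    moments, the other for the union over \<open>I\<close>. The constant \<open>16\<close> in the
    hypothesis on \<open>L\<close> makes the second half suffice.\<close>
  define l where "l = \<eta> / 8"
  have l: "0 < l" "l \<le> 1 / 2" using \<eta> by (auto simp: l_def)
  let ?m = "\<lambda>i. expectation (g i)"
  have int: "integrable M (g i)" if "i \<in> I" for i
    using g that by (intro integrable_const_bound[where B = 1]) (auto intro!: AE_I2)
  have m1: "\<bar>?m i\<bar> \<le> 1" if "i \<in> I" for i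
  proof -
    have "?m i \<le> 1" using g(2)[OF that] int[OF that] by (intro integral_le_const AE_I2) (auto simp: abs_le_iff)
    moreover have "-1 \<le> ?m i" using g(2)[OF that] int[OF that]
      by (intro integral_ge_const AE_I2) (auto simp: abs_le_iff minus_le_iff)
    ultimately show ?thesis by simp
  qed
  have "\<exists>xs. length xs = n \<and> set xs \<subseteq> space M \<and>
     (\<Sum>i\<in>I. exp (l * (\<Sum>x\<leftarrow>xs. g i x - ?m i))) \<le> card I * exp (4 * l\<^sup>2) ^ n" for n
  proof (induction n)
    case (Suc n)
    then obtain xs where xs: "length xs = n" "set xs \<subseteq> space M"
      "(\<Sum>i\<in>I. exp (l * (\<Sum>x\<leftarrow>xs. g i x - ?m i))) \<le> card I * exp (4 * l\<^sup>2) ^ n" by blast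
    let ?w = "\<lambda>i. exp (l * (\<Sum>x\<leftarrow>xs. g i x - ?m i))"
    \<comment> \<open>A bound for the moments after one more sample that is affine in
      \<open>g i x\<close>, so that its expectation is explicit. The constant
      \<open>4 * l\<^sup>2\<close> covers the square, since \<open>g i x\<close> differs from its
      mean by at most \<open>2\<close>.\<close>
    let ?h = "\<lambda>x. \<Sum>i\<in>I. ?w i * (1 + l * (g i x - ?m i) + 4 * l\<^sup>2)"
    have inth: "integrable M ?h"
      using int by (intro Bochner_Integration.integrable_sum Bochner_Integration.integrable_mult_right
          Bochner_Integration.integrable_add Bochner_Integration.integrable_diff) auto
    obtain x where x: "x \<in> space M" "?h x \<le> expectation ?h"
      using exists_le_expectation[OF inth] by blast
    have "expectation ?h = (\<Sum>i\<in>I. ?w i * (1 + 4 * l\<^sup>2))"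
    proof -
      have "expectation ?h = (\<Sum>i\<in>I. expectation (\<lambda>x. ?w i * (1 + l * (g i x - ?m i) + 4 * l\<^sup>2)))"
        using int by (intro Bochner_Integration.integral_sum Bochner_Integration.integrable_mult_right
            Bochner_Integration.integrable_add Bochner_Integration.integrable_diff) auto
      also have "\<dots> = (\<Sum>i\<in>I. ?w i * (1 + 4 * l\<^sup>2))"
        using int by (intro sum.cong refl) (simp add: prob_space)
      finally show ?thesis .
    qed
    also have "\<dots> = (1 + 4 * l\<^sup>2) * (\<Sum>i\<in>I. ?w i)" by (simp add: sum_distrib_left mult.commute)
    also have "\<dots> \<le> exp (4 * l\<^sup>2) * (\<Sum>i\<in>I. ?w i)"
      by (intro mult_right_mono exp_ge_add_one_self sum_nonneg) auto
    also have "\<dots> \<le> exp (4 * l\<^sup>2) * (card I * exp (4 * l\<^sup>2) ^ n)" by (intro mult_left_mono xs(3)) auto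
    finally have E: "expectation ?h \<le> card I * exp (4 * l\<^sup>2) ^ Suc n" by (simp add: mult_ac)
    have "(\<Sum>i\<in>I. exp (l * (\<Sum>y\<leftarrow>x # xs. g i y - ?m i))) \<le> ?h x"
    proof (rule sum_mono)
      fix i assume i: "i \<in> I"
      have D: "\<bar>g i x - ?m i\<bar> \<le> 2" using g(2)[OF i x(1)] m1[OF i] by linarith
      have "\<bar>l * (g i x - ?m i)\<bar> \<le> (1 / 2) * 2" unfolding abs_mult using l D by (intro mult_mono) auto
      then have "exp (l * (g i x - ?m i)) \<le> 1 + l * (g i x - ?m i) + (l * (g i x - ?m i))\<^sup>2"
        by (intro exp_le_quadratic) simp
      also have "(l * (g i x - ?m i))\<^sup>2 \<le> 4 * l\<^sup>2"
        using power_mono[OF D, of 2] l(1) by (simp add: power_mult_distrib)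
      finally have e: "exp (l * (g i x - ?m i)) \<le> 1 + l * (g i x - ?m i) + 4 * l\<^sup>2" by simp
      have "exp (l * (\<Sum>y\<leftarrow>x # xs. g i y - ?m i)) = ?w i * exp (l * (g i x - ?m i))"
        by (simp add: distrib_left exp_add)
      also have "\<dots> \<le> ?w i * (1 + l * (g i x - ?m i) + 4 * l\<^sup>2)" by (intro mult_left_mono e) simp
      finally show "exp (l * (\<Sum>y\<leftarrow>x # xs. g i y - ?m i)) \<le> ?w i * (1 + l * (g i x - ?m i) + 4 * l\<^sup>2)" .
    qed
    with x E xs show ?case by (intro exI[of _ "x # xs"]) auto
  qed (auto intro: exI[of _ "[]"])
  from this[of L] obtain xs where xs: "length xs = L" "set xs \<subseteq> space M"
    "(\<Sum>i\<in>I. exp (l * (\<Sum>x\<leftarrow>xs. g i x - ?m i))) \<le> card I * exp (4 * l\<^sup>2) ^ L" by blast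
  have "(\<Sum>x\<leftarrow>xs. g i x) \<le> L * (?m i + \<eta>)" if i: "i \<in> I" for i
  proof -
    let ?S = "\<Sum>x\<leftarrow>xs. g i x - ?m i"
    have "exp (l * ?S) \<le> (\<Sum>i\<in>I. exp (l * (\<Sum>x\<leftarrow>xs. g i x - ?m i)))"
      using I i by (intro member_le_sum) auto
    also have "\<dots> \<le> card I * exp (4 * l\<^sup>2) ^ L" by (rule xs(3))
    also have "\<dots> = exp (ln (card I) + 4 * l\<^sup>2 * L)"
      using I by (simp add: exp_add exp_of_nat_mult[symmetric] mult_ac card_gt_0_iff)
    finally have "l * ?S \<le> ln (card I) + 4 * l\<^sup>2 * L" by simp
    also have "\<dots> \<le> \<eta>\<^sup>2 * L / 16 + 4 * l\<^sup>2 * L" using L by simp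
    also have "\<dots> = l * (\<eta> * L)" by (simp add: l_def power2_eq_square)
    finally have "?S \<le> \<eta> * L" using l by simp
    moreover have "?S = (\<Sum>x\<leftarrow>xs. g i x) - L * ?m i"
      using xs(1) by (simp add: sum_list_subtractf sum_list_triv)
    ultimately show ?thesis by (simp add: algebra_simps)
  qed
  with xs show ?thesis by blast
qed

section \<open>Codes\<close>

lemma codes_iff:
  "C \<in> codes d n J \<longleftrightarrow> fst C \<in> {1..J} \<rightarrow>\<^sub>E {P. set_pmf P \<subseteq> words UNIV n} \<and>
     snd C \<in> {1..J} \<rightarrow>\<^sub>E {A. positive_semidef (d ^ n) A} \<and> mat_sum (d ^ n) {1..J} (snd C) = 1\<^sub>m (d ^ n)"
  by (cases C) (simp add: codes_def)

lemma codesD: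
  assumes "C \<in> codes d n J" "j \<in> {1..J}"
  shows "set_pmf (fst C j) \<subseteq> words UNIV n" "positive_semidef (d ^ n) (snd C j)"
proof -
  have "fst C \<in> {1..J} \<rightarrow>\<^sub>E {P. set_pmf P \<subseteq> words UNIV n}" "snd C \<in> {1..J} \<rightarrow>\<^sub>E {A. positive_semidef (d ^ n) A}"
    using assms(1) unfolding codes_iff by blast+
  from PiE_mem[OF this(1) assms(2)] PiE_mem[OF this(2) assms(2)]
  show "set_pmf (fst C j) \<subseteq> words UNIV n" "positive_semidef (d ^ n) (snd C j)" by auto
qed

lemma codes_sum: "C \<in> codes d n J \<Longrightarrow> mat_sum (d ^ n) {1..J} (snd C) = 1\<^sub>m (d ^ n)"
  by (simp only: codes_iff)

lemma sum_success:
  assumes \<rho>: "\<rho> \<in> density_operators d" and F: "\<And>x. x \<in> X \<Longrightarrow> positive_semidef d (F x)" "mat_sum d X F = 1\<^sub>m d"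
  shows "(\<Sum>x\<in>X. Re (mat_trace (\<rho> * F x))) = 1"
proof -
  have "mat_trace (\<rho> * mat_sum d X F) = (\<Sum>x\<in>X. mat_trace (\<rho> * F x))"
    using \<rho> F(1) by (intro mat_trace_mult_mat_sum) (auto intro: density_carrier)
  also have "mat_trace (\<rho> * mat_sum d X F) = 1"
    using \<rho> density_carrier[OF \<rho>] by (simp add: F(2) density_operators_def)
  finally show ?thesis by (metis Re_sum one_complex.simps(1))
qed

lemma success_bounds:
  assumes \<rho>: "\<rho> \<in> density_operators d" and F: "\<And>x. x \<in> X \<Longrightarrow> positive_semidef d (F x)" "mat_sum d X F = 1\<^sub>m d"
    and x: "finite X" "x \<in> X"
  shows "0 \<le> Re (mat_trace (\<rho> * F x))" "Re (mat_trace (\<rho> * F x)) \<le> 1"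
proof -
  have nn: "0 \<le> Re (mat_trace (\<rho> * F x))" if "x \<in> X" for x
    using mat_trace_density_psd(2)[OF \<rho> F(1)[OF that]] .
  then show "0 \<le> Re (mat_trace (\<rho> * F x))" using x by simp
  show "Re (mat_trace (\<rho> * F x)) \<le> 1"
    using member_le_sum[of x X "\<lambda>x. Re (mat_trace (\<rho> * F x))"] nn x sum_success[OF \<rho> F] by auto
qed

section \<open>Error probability and leakage of wiretap codes, and sampling from a random
  code\<close>

locale av_wiretap =
  fixes d d' :: nat and \<theta> :: "'t set" and W V :: "'t \<Rightarrow> 'a::finite pmf \<Rightarrow> complex mat"
  assumes channel: "av_wiretap_channel d d' \<theta> W V" and states_nonempty: "\<theta> \<noteq> {}"
begin

lemma finite_states: "finite \<theta>"
  using channel by (simp add: av_wiretap_channel_def)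

lemma channel_W: "t \<in> \<theta> \<Longrightarrow> cq_channel d (W t)" and channel_V: "t \<in> \<theta> \<Longrightarrow> cq_channel d' (V t)"
  using channel by (auto simp: av_wiretap_channel_def)

lemma dim_pos: "0 < d" "0 < d'"
  using states_nonempty density_dim_pos[OF cq_channel_density[OF channel_W]]
    density_dim_pos[OF cq_channel_density[OF channel_V]] by auto

lemma Max_less_words_iff:
  fixes f :: "'t list \<Rightarrow> real"
  shows "Max (f ` words \<theta> n) < c \<longleftrightarrow> (\<forall>ts\<in>words \<theta> n. f ts < c)"
  using finite_words[OF finite_states, of n] words_nonempty[OF states_nonempty, of n] by (subst Max_less_iff) auto

lemma W_ext_density:
  "ts \<in> words \<theta> n \<Longrightarrow> C \<in> codes d n J \<Longrightarrow> j \<in> {1..J} \<Longrightarrow> channel_ext d W ts (fst C j) \<in> density_operators (d ^ n)"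
  using codesD(1) by (intro channel_ext_density[OF channel_W])

lemma V_ext_density:
  "ts \<in> words \<theta> n \<Longrightarrow> C \<in> codes d n J \<Longrightarrow> j \<in> {1..J} \<Longrightarrow> channel_ext d' V ts (fst C j) \<in> density_operators (d' ^ n)"
  using codesD(1) by (intro channel_ext_density[OF channel_V])

lemma error_prob_bounds:
  assumes C: "C \<in> codes d n J" and J: "J \<ge> 1" and ts: "ts \<in> words \<theta> n"
  shows "0 \<le> error_prob d W J C ts" "error_prob d W J C ts \<le> 1"
proof -
  have b: "0 \<le> Re (mat_trace (channel_ext d W ts (fst C j) * snd C j))"
    "Re (mat_trace (channel_ext d W ts (fst C j) * snd C j)) \<le> 1" if "j \<in> {1..J}" for j
    using success_bounds[OF W_ext_density[OF ts C that] codesD(2)[OF C] codes_sum[OF C], of j] that by auto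
  have "0 \<le> (\<Sum>j=1..J. Re (mat_trace (channel_ext d W ts (fst C j) * snd C j)))"
    using b by (intro sum_nonneg) auto
  then show "error_prob d W J C ts \<le> 1" by (simp add: error_prob_def)
  have "(\<Sum>j=1..J. Re (mat_trace (channel_ext d W ts (fst C j) * snd C j))) \<le> (\<Sum>j=1..J. 1)"
    using b by (intro sum_mono) auto
  then show "0 \<le> error_prob d W J C ts" using J by (simp add: error_prob_def field_simps)
qed

lemma leakage_bound:
  assumes C: "C \<in> codes d n J" and J: "J \<ge> 1" and ts: "ts \<in> words \<theta> n"
  shows "\<bar>leakage d' V J C ts\<bar> \<le> n * log 2 d'"
proof -
  have "\<bar>leakage d' V J C ts\<bar> \<le> log 2 (real (d' ^ n))"
    unfolding leakage_def length_words[OF ts] using J V_ext_density[OF ts C]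
    by (intro holevo_bounds) auto
  also have "\<dots> = n * log 2 d'" using dim_pos by (simp add: log_nat_power)
  finally show ?thesis .
qed

text \<open>For one message the decoder is forced to be the identity. This case stands apart in the
  passage to common randomness, where \<open>perturb_code\<close> asks for two messages, and it also
  supplies the rate \<open>0\<close>.\<close>

lemma single_message:
  assumes C: "C \<in> codes d n 1" and ts: "ts \<in> words \<theta> n"
  shows "error_prob d W 1 C ts = 0" "leakage d' V 1 C ts = 0"
proof -
  have "(\<Sum>j\<in>{1..1}. Re (mat_trace (channel_ext d W ts (fst C 1) * snd C j))) = 1"
    using codesD(2)[OF C] codes_sum[OF C] W_ext_density[OF ts C, of 1] by (intro sum_success) auto
  then show "error_prob d W 1 C ts = 0" by (simp add: error_prob_def)
  have "pmf_of_set {1..1::nat} = return_pmf 1" by (simp add: pmf_of_set_singleton)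
  then show "leakage d' V 1 C ts = 0"
    using density_carrier[OF V_ext_density[OF ts C, of 1]] length_words[OF ts]
    by (simp add: leakage_def holevo_def mixture_return)
qed

text \<open>Error and leakage are sampled as one family, indexed by a state sequence and a flag,
  which accounts for \<open>2 * card \<theta> ^ n\<close>. The leakage is divided by its bound
  beforehand, so its accuracy is worse by that factor; the summand \<open>1\<close> keeps the
  divisor positive.\<close>

lemma sample_codes:
  assumes G: "random_code d d' \<theta> W V n J G" and J: "J \<ge> 1" and \<eta>: "0 < \<eta>" "\<eta> \<le> 1"
    and L: "16 * ln (2 * card \<theta> ^ n) \<le> \<eta>\<^sup>2 * L"
  shows "\<exists>cs. length cs = L \<and> set cs \<subseteq> codes d n J \<and> (\<forall>ts\<in>words \<theta> n.
     (\<Sum>C\<leftarrow>cs. error_prob d W J C ts) \<le> L * ((\<integral>C. error_prob d W J C ts \<partial>G) + \<eta>) \<and>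
     (\<Sum>C\<leftarrow>cs. leakage d' V J C ts) \<le> L * ((\<integral>C. leakage d' V J C ts \<partial>G) + \<eta> * (n * log 2 d' + 1)))"
proof -
  interpret prob_space G using G by (simp add: random_code_def)
  have sp: "space G = codes d n J" using G by (simp add: random_code_def)
  define B where "B = n * log 2 d' + 1"
  have B: "B > 0" using dim_pos unfolding B_def by (intro add_nonneg_pos mult_nonneg_nonneg) auto
  define g where "g i C = (case i of (ts, b) \<Rightarrow> if b then error_prob d W J C ts else leakage d' V J C ts / B)" for i C
  let ?I = "words \<theta> n \<times> (UNIV :: bool set)"
  have card: "card ?I = 2 * card \<theta> ^ n"
    using card_lists_length_eq[OF finite_states, of n] by (simp add: card_cartesian_product words_def)
  have "\<exists>cs. length cs = L \<and> set cs \<subseteq> space G \<and> (\<forall>i\<in>?I. (\<Sum>C\<leftarrow>cs. g i C) \<le> L * (expectation (g i) + \<eta>))"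
  proof (rule exists_sample)
    fix i :: "'t list \<times> bool" assume i: "i \<in> ?I"
    then obtain ts b where i': "i = (ts, b)" "ts \<in> words \<theta> n" by auto
    have "g i = (if b then (\<lambda>C. error_prob d W J C ts) else (\<lambda>C. leakage d' V J C ts / B))"
      by (auto simp: g_def i'(1))
    then show "g i \<in> borel_measurable G" using G i'(2) by (auto simp: random_code_def)
    fix C assume "C \<in> space G"
    then have C: "C \<in> codes d n J" by (simp add: sp)
    have "\<bar>leakage d' V J C ts\<bar> \<le> B" using leakage_bound[OF C J i'(2)] by (simp add: B_def)
    then show "\<bar>g i C\<bar> \<le> 1" using error_prob_bounds[OF C J i'(2)] B by (auto simp: g_def i'(1))
  qed (use finite_states words_nonempty[OF states_nonempty] \<eta> L card in \<open>auto simp: mult.commute\<close>)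
  then obtain cs where cs: "length cs = L" "set cs \<subseteq> codes d n J"
    "\<And>i. i \<in> ?I \<Longrightarrow> (\<Sum>C\<leftarrow>cs. g i C) \<le> L * (expectation (g i) + \<eta>)" unfolding sp by blast
  have g_eq: "g (ts, True) = (\<lambda>C. error_prob d W J C ts)" "g (ts, False) = (\<lambda>C. leakage d' V J C ts / B)" for ts
    by (auto simp: g_def)
  have "(\<Sum>C\<leftarrow>cs. error_prob d W J C ts) \<le> L * ((\<integral>C. error_prob d W J C ts \<partial>G) + \<eta>)" if "ts \<in> words \<theta> n" for ts
    using cs(3)[of "(ts, True)"] that by (simp add: g_eq)
  moreover have "(\<Sum>C\<leftarrow>cs. leakage d' V J C ts) \<le> L * ((\<integral>C. leakage d' V J C ts \<partial>G) + \<eta> * B)" if "ts \<in> words \<theta> n" for ts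
  proof -
    have "(\<Sum>C\<leftarrow>cs. leakage d' V J C ts) / B \<le> L * ((\<integral>C. leakage d' V J C ts \<partial>G) / B + \<eta>)"
      using cs(3)[of "(ts, False)"] that by (simp add: g_eq divide_inverse sum_list_mult_const)
    then have "(\<Sum>C\<leftarrow>cs. leakage d' V J C ts) / B * B \<le> L * ((\<integral>C. leakage d' V J C ts \<partial>G) / B + \<eta>) * B"
      using B by (intro mult_right_mono) auto
    then show ?thesis using B by (simp add: algebra_simps)
  qed
  ultimately show ?thesis using cs(1,2) unfolding B_def by blast
qed

end

section \<open>Convex combinations of decoders\<close>

lemma quad_lincomb:
  assumes "A \<in> carrier_mat d d" "B \<in> carrier_mat d d"
  shows "quad d (a \<cdot>\<^sub>m A + b \<cdot>\<^sub>m B) f = a * quad d A f + b * quad d B f"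
proof -
  have "quad d (a \<cdot>\<^sub>m A + b \<cdot>\<^sub>m B) f
    = (\<Sum>i<d. \<Sum>j<d. a * (cnj (f i) * A $$ (i, j) * f j) + b * (cnj (f i) * B $$ (i, j) * f j))"
    using assms unfolding quad_def by (auto simp: algebra_simps intro!: sum.cong)
  then show ?thesis by (simp add: quad_def sum.distrib sum_distrib_left)
qed

lemma mat_trace_mult_lincomb:
  assumes "\<rho> \<in> carrier_mat d d" "A \<in> carrier_mat d d" "B \<in> carrier_mat d d"
  shows "mat_trace (\<rho> * (a \<cdot>\<^sub>m A + b \<cdot>\<^sub>m B)) = a * mat_trace (\<rho> * A) + b * mat_trace (\<rho> * B)"
proof -
  have "mat_trace (\<rho> * (a \<cdot>\<^sub>m A + b \<cdot>\<^sub>m B))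
    = (\<Sum>i<d. \<Sum>j<d. a * (\<rho> $$ (i, j) * A $$ (j, i)) + b * (\<rho> $$ (i, j) * B $$ (j, i)))"
    using assms by (subst mat_trace_mult[of _ d d]) (auto simp: algebra_simps intro!: sum.cong)
  then show ?thesis using assms by (simp add: mat_trace_mult[of _ d d] sum.distrib sum_distrib_left)
qed

context av_wiretap
begin

text \<open>
  Mixing the decoder with a constant one changes the code, but not the leakage. So a list of codes
  can be replaced by a list of distinct codes.
\<close>

lemma perturb_code:
  assumes C: "C \<in> codes d n J" and J: "J \<ge> 2" and F: "finite F" and \<eta>: "\<eta> > 0"
  shows "\<exists>C'\<in>codes d n J - F. fst C' = fst C \<and>
    (\<forall>ts\<in>words \<theta> n. error_prob d W J C' ts \<le> error_prob d W J C ts + \<eta>)"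
proof -
  let ?D = "d ^ n"
  define K where "K i = (\<lambda>j\<in>{1..J}. if j = i then 1\<^sub>m ?D else 0\<^sub>m ?D ?D :: complex mat)" for i :: nat
  have D: "?D > 0" using dim_pos by simp
  have K_ne: "K 1 1 \<noteq> K 2 1"
  proof
    assume "K 1 1 = K 2 1"
    then have "(1\<^sub>m ?D :: complex mat) $$ (0, 0) = 0\<^sub>m ?D ?D $$ (0, 0)" using J by (simp add: K_def)
    with D show False by simp
  qed
  \<comment> \<open>The decoders that always answer \<open>1\<close> and always answer
    \<open>2\<close> differ at message \<open>1\<close>, so at least one of them differs there from
    the decoder of \<open>C\<close>. Mixing with that one changes the code.\<close>
  then obtain i where i: "i \<in> {1, 2}" "K i 1 \<noteq> snd C 1" by (metis insertCI)
  have Kc: "K i j \<in> carrier_mat ?D ?D" "positive_semidef ?D (K i j)" if "j \<in> {1..J}" for j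
    using that positive_semidef_one by (auto simp: K_def positive_semidef_iff_quad quad_def)
  have Ksum: "mat_sum ?D {1..J} (K i) = 1\<^sub>m ?D"
  proof (rule eq_matI)
    fix r s assume rs: "r < dim_row (1\<^sub>m ?D :: complex mat)" "s < dim_col (1\<^sub>m ?D :: complex mat)"
    have "(\<Sum>j=1..J. K i j $$ (r, s)) = (\<Sum>j=1..J. if j = i then 1\<^sub>m ?D $$ (r, s) else 0)"
      using rs by (intro sum.cong refl) (auto simp: K_def)
    then show "mat_sum ?D {1..J} (K i) $$ (r, s) = 1\<^sub>m ?D $$ (r, s)"
      using rs i(1) J by (auto simp: mat_sum_index)
  qed auto
  have Dc: "snd C j \<in> carrier_mat ?D ?D" if "j \<in> {1..J}" for j using codesD(2)[OF C that] by simp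
  define P where "P x = (fst C, \<lambda>j\<in>{1..J}. complex_of_real (1 - x) \<cdot>\<^sub>m snd C j + complex_of_real x \<cdot>\<^sub>m K i j)" for x
  have P_code: "P x \<in> codes d n J" if x: "0 < x" "x < 1" for x
  proof -
    have "positive_semidef ?D (snd (P x) j)" if "j \<in> {1..J}" for j
      using that Kc[OF that] Dc[OF that] codesD(2)[OF C that] x
      by (auto simp: P_def positive_semidef_iff_quad quad_lincomb simp del: of_real_diff
          intro!: add_nonneg_nonneg mult_nonneg_nonneg of_real_nonneg_complex)
    moreover have "mat_sum ?D {1..J} (snd (P x)) = 1\<^sub>m ?D"
    proof (rule eq_matI)
      fix r s assume rs: "r < dim_row (1\<^sub>m ?D :: complex mat)" "s < dim_col (1\<^sub>m ?D :: complex mat)"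
      have "mat_sum ?D {1..J} (snd (P x)) $$ (r, s)
        = of_real (1 - x) * mat_sum ?D {1..J} (snd C) $$ (r, s) + of_real x * mat_sum ?D {1..J} (K i) $$ (r, s)"
      proof -
        have "(\<Sum>j=1..J. snd (P x) j $$ (r, s))
          = (\<Sum>j=1..J. of_real (1 - x) * snd C j $$ (r, s) + of_real x * K i j $$ (r, s))"
          using rs carrier_matD[OF Dc] carrier_matD[OF Kc(1)]
          by (intro sum.cong refl) (simp add: P_def del: of_real_diff)
        then show ?thesis
          using rs by (simp add: mat_sum_index sum.distrib sum_distrib_left del: of_real_diff)
      qed
      then show "mat_sum ?D {1..J} (snd (P x)) $$ (r, s) = 1\<^sub>m ?D $$ (r, s)"
        unfolding codes_sum[OF C] Ksum by (simp add: algebra_simps)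
    qed auto
    moreover have "snd (P x) \<in> extensional {1..J}" by (simp add: P_def)
    moreover have "fst (P x) = fst C" by (simp add: P_def)
    ultimately show ?thesis using C unfolding codes_iff by (simp add: PiE_iff)
  qed
  have "inj P"
  proof (rule injI)
    fix x y assume "P x = P y"
    then have eq: "complex_of_real (1 - x) \<cdot>\<^sub>m snd C 1 + complex_of_real x \<cdot>\<^sub>m K i 1
      = complex_of_real (1 - y) \<cdot>\<^sub>m snd C 1 + complex_of_real y \<cdot>\<^sub>m K i 1"
      using J unfolding P_def by (auto dest!: fun_cong[where x = 1])
    have D1: "snd C 1 \<in> carrier_mat ?D ?D" "K i 1 \<in> carrier_mat ?D ?D" using Dc[of 1] Kc(1)[of 1] J by auto
    obtain r s where rs: "r < ?D" "s < ?D" "K i 1 $$ (r, s) \<noteq> snd C 1 $$ (r, s)"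
    proof (rule ccontr)
      assume "\<not> thesis"
      with that have "K i 1 $$ (r, s) = snd C 1 $$ (r, s)" if "r < ?D" "s < ?D" for r s using that by blast
      then have "K i 1 = snd C 1" using D1 by (intro eq_matI) auto
      with i(2) show False by blast
    qed
    have "of_real (1 - x) * snd C 1 $$ (r, s) + of_real x * K i 1 $$ (r, s)
      = of_real (1 - y) * snd C 1 $$ (r, s) + of_real y * K i 1 $$ (r, s)"
      using arg_cong[OF eq, of "\<lambda>A. A $$ (r, s)"] rs D1 by simp
    then have "(complex_of_real x - of_real y) * (K i 1 $$ (r, s) - snd C 1 $$ (r, s)) = 0"
      by (simp add: algebra_simps)
    then show "x = y" using rs(3) by simp
  qed
  \<comment> \<open>Different weights give different codes, so some weight below
    \<open>\<eta>\<close> leads outside the finite set \<open>F\<close>.\<close>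
  then have "infinite (P ` {0<..<min \<eta> 1})"
  proof -
    have "infinite {0<..<min \<eta> 1}" using \<eta> by (intro infinite_Ioo) simp
    then show ?thesis using \<open>inj P\<close> finite_imageD[of P] by (meson inj_on_subset subset_UNIV)
  qed
  then have "\<not> P ` {0<..<min \<eta> 1} \<subseteq> F" using F finite_subset by blast
  then obtain x where "x \<in> {0<..<min \<eta> 1}" and xF: "P x \<notin> F" by blast
  then have x: "0 < x" "x < \<eta>" "x < 1" by auto
  have "error_prob d W J (P x) ts \<le> error_prob d W J C ts + \<eta>" if ts: "ts \<in> words \<theta> n" for ts
  proof -
    let ?s = "\<lambda>j. Re (mat_trace (channel_ext d W ts (fst C j) * snd C j))"
    have le: "?s j - x \<le> Re (mat_trace (channel_ext d W ts (fst (P x) j) * snd (P x) j))" if j: "j \<in> {1..J}" for j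
    proof -
      note \<rho> = W_ext_density[OF ts C j]
      have 0: "0 \<le> Re (mat_trace (channel_ext d W ts (fst C j) * K i j))"
        using mat_trace_density_psd(2)[OF \<rho> Kc(2)[OF j]] .
      have 1: "?s j \<le> 1"
        using success_bounds(2)[OF \<rho> codesD(2)[OF C] codes_sum[OF C] _ j] by simp
      have "Re (mat_trace (channel_ext d W ts (fst (P x) j) * snd (P x) j))
        = (1 - x) * ?s j + x * Re (mat_trace (channel_ext d W ts (fst C j) * K i j))"
        using j mat_trace_mult_lincomb[OF density_carrier[OF \<rho>] Dc[OF j] Kc(1)[OF j], of "of_real (1 - x)" "of_real x"]
        by (simp add: P_def del: of_real_diff)
      moreover have "0 \<le> x * Re (mat_trace (channel_ext d W ts (fst C j) * K i j))" using 0 x by simp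
      moreover have "x * ?s j \<le> x" using 1 x by (simp add: mult_left_le)
      ultimately show ?thesis by (simp add: left_diff_distrib)
    qed
    have "(\<Sum>j=1..J. ?s j - x) \<le> (\<Sum>j=1..J. Re (mat_trace (channel_ext d W ts (fst (P x) j) * snd (P x) j)))"
      using le by (intro sum_mono) auto
    then have "1 / real J * ((\<Sum>j=1..J. ?s j) - J * x)
      \<le> 1 / real J * (\<Sum>j=1..J. Re (mat_trace (channel_ext d W ts (fst (P x) j) * snd (P x) j)))"
      by (intro mult_left_mono) (auto simp: sum_subtractf)
    moreover have "1 / real J * ((\<Sum>j=1..J. ?s j) - J * x) = 1 / real J * (\<Sum>j=1..J. ?s j) - x"
      using J by (simp add: right_diff_distrib)
    ultimately show ?thesis unfolding error_prob_def using x by linarith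
  qed
  moreover have "fst (P x) = fst C" by (simp add: P_def)
  ultimately show ?thesis using P_code[of x] x xF by blast
qed

lemma distinct_codes:
  assumes "set cs \<subseteq> codes d n J" and J: "J \<ge> 2" and \<eta>: "\<eta> > 0"
  shows "\<exists>cs'. distinct cs' \<and> set cs' \<subseteq> codes d n J \<and> list_all2 (\<lambda>C C'. fst C' = fst C \<and>
    (\<forall>ts\<in>words \<theta> n. error_prob d W J C' ts \<le> error_prob d W J C ts + \<eta>)) cs cs'"
  using assms(1)
proof (induction cs)
  case (Cons C cs)
  then obtain cs' where cs': "distinct cs'" "set cs' \<subseteq> codes d n J" "list_all2 (\<lambda>C C'. fst C' = fst C \<and>
    (\<forall>ts\<in>words \<theta> n. error_prob d W J C' ts \<le> error_prob d W J C ts + \<eta>)) cs cs'" by auto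
  obtain C' where "C' \<in> codes d n J - set cs'" "fst C' = fst C"
    "\<forall>ts\<in>words \<theta> n. error_prob d W J C' ts \<le> error_prob d W J C ts + \<eta>"
    using perturb_code[of C n J "set cs'" \<eta>] Cons.prems J \<eta> by auto
  with cs' show ?case by (intro exI[of _ "C' # cs'"]) auto
qed simp

section \<open>Random codes and common randomness\<close>

lemma achievable_imp_cr: "achievable d d' \<theta> W V R \<Longrightarrow> achievable_cr d d' \<theta> W V R"
  unfolding achievable_def achievable_cr_def
proof (elim conjE, intro conjI allI impI)
  fix \<epsilon> \<delta> \<zeta> :: real assume pos: "\<epsilon> > 0" "\<delta> > 0" "\<zeta> > 0"
    and *: "\<forall>\<epsilon>>0. \<forall>\<delta>>0. \<forall>\<zeta>>0. \<forall>\<^sub>F n in sequentially. \<exists>J\<ge>1. \<exists>C\<in>codes d n J. R - \<delta> < log 2 (real J) / real n \<and>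
      Max ((\<lambda>ts. error_prob d W J C ts) ` words \<theta> n) < \<epsilon> \<and> Max ((\<lambda>ts. leakage d' V J C ts) ` words \<theta> n) < \<zeta>"
  from *[rule_format, OF pos]
  show "\<forall>\<^sub>F n in sequentially. \<exists>J\<ge>1. \<exists>\<Gamma>. finite \<Gamma> \<and> \<Gamma> \<noteq> {} \<and> \<Gamma> \<subseteq> codes d n J \<and> R - \<delta> < log 2 (real J) / real n \<and>
     Max ((\<lambda>ts. 1 / real (card \<Gamma>) * (\<Sum>C\<in>\<Gamma>. error_prob d W J C ts)) ` words \<theta> n) < \<epsilon> \<and>
     Max ((\<lambda>ts. 1 / real (card \<Gamma>) * (\<Sum>C\<in>\<Gamma>. leakage d' V J C ts)) ` words \<theta> n) < \<zeta>"
  proof eventually_elim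
    case (elim n)
    then obtain J C where "J \<ge> 1" "C \<in> codes d n J" "R - \<delta> < log 2 (real J) / real n"
      "Max ((\<lambda>ts. error_prob d W J C ts) ` words \<theta> n) < \<epsilon>" "Max ((\<lambda>ts. leakage d' V J C ts) ` words \<theta> n) < \<zeta>" by blast
    then show ?case by (intro exI[of _ J] conjI exI[of _ "{C}"]) auto
  qed
qed

lemma achievable_cr_imp_r: "achievable_cr d d' \<theta> W V R \<Longrightarrow> achievable_r d d' \<theta> W V R"
  unfolding achievable_cr_def achievable_r_def
proof (elim conjE, intro conjI allI impI)
  fix \<epsilon> \<delta> \<zeta> :: real assume pos: "\<epsilon> > 0" "\<delta> > 0" "\<zeta> > 0"
    and *: "\<forall>\<epsilon>>0. \<forall>\<delta>>0. \<forall>\<zeta>>0. \<forall>\<^sub>F n in sequentially. \<exists>J\<ge>1. \<exists>\<Gamma>. finite \<Gamma> \<and> \<Gamma> \<noteq> {} \<and> \<Gamma> \<subseteq> codes d n J \<and>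
     R - \<delta> < log 2 (real J) / real n \<and>
     Max ((\<lambda>ts. 1 / real (card \<Gamma>) * (\<Sum>C\<in>\<Gamma>. error_prob d W J C ts)) ` words \<theta> n) < \<epsilon> \<and>
     Max ((\<lambda>ts. 1 / real (card \<Gamma>) * (\<Sum>C\<in>\<Gamma>. leakage d' V J C ts)) ` words \<theta> n) < \<zeta>"
  from *[rule_format, OF pos]
  show "\<forall>\<^sub>F n in sequentially. \<exists>J\<ge>1. \<exists>G. random_code d d' \<theta> W V n J G \<and> R - \<delta> < log 2 (real J) / real n \<and>
     Max ((\<lambda>ts. \<integral>C. error_prob d W J C ts \<partial>G) ` words \<theta> n) < \<epsilon> \<and>
     Max ((\<lambda>ts. \<integral>C. leakage d' V J C ts \<partial>G) ` words \<theta> n) < \<zeta>"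
  proof eventually_elim
    case (elim n)
    then obtain J \<Gamma> where J: "J \<ge> 1" "finite \<Gamma>" "\<Gamma> \<noteq> {}" "\<Gamma> \<subseteq> codes d n J" "R - \<delta> < log 2 (real J) / real n"
      "Max ((\<lambda>ts. 1 / real (card \<Gamma>) * (\<Sum>C\<in>\<Gamma>. error_prob d W J C ts)) ` words \<theta> n) < \<epsilon>"
      "Max ((\<lambda>ts. 1 / real (card \<Gamma>) * (\<Sum>C\<in>\<Gamma>. leakage d' V J C ts)) ` words \<theta> n) < \<zeta>" by blast
    let ?U = "uniform_count_measure \<Gamma>"
    \<comment> \<open>The uniform measure on \<open>\<Gamma>\<close> is carried to the whole set of
      codes, as \<open>random_code\<close> demands, with the discrete sigma-algebra, for which every
      function is measurable.\<close>
    define G where "G = distr ?U (count_space (codes d n J)) (\<lambda>C. C)"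
    have meas: "(\<lambda>C. C) \<in> measurable ?U (count_space (codes d n J))"
      using J(4) by (auto simp: measurable_def space_uniform_count_measure sets_uniform_count_measure)
    have "prob_space G"
      unfolding G_def by (intro prob_space.prob_space_distr prob_space_uniform_count_measure J meas)
    then have "random_code d d' \<theta> W V n J G"
      by (auto simp: random_code_def G_def)
    moreover have "(\<integral>C. f C \<partial>G) = 1 / real (card \<Gamma>) * (\<Sum>C\<in>\<Gamma>. f C)" for f :: "'a code \<Rightarrow> real"
      unfolding G_def using J(2) by (subst integral_distr[OF meas]) (auto simp: integral_uniform_count_measure)
    ultimately show ?case using J by (intro exI[of _ J] conjI exI[of _ G]) auto
  qed
qed

text \<open>The error allowance is split in three, for the random code, the sampling and the
  perturbation into distinct codes; the leakage allowance in two, as the perturbation does not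
  affect it.\<close>

lemma achievable_r_imp_cr: "achievable_r d d' \<theta> W V R \<Longrightarrow> achievable_cr d d' \<theta> W V R"
  unfolding achievable_cr_def achievable_r_def
proof (elim conjE, intro conjI allI impI)
  fix \<epsilon> \<delta> \<zeta> :: real assume pos: "\<epsilon> > 0" "\<delta> > 0" "\<zeta> > 0"
    and *: "\<forall>\<epsilon>>0. \<forall>\<delta>>0. \<forall>\<zeta>>0. \<forall>\<^sub>F n in sequentially. \<exists>J\<ge>1. \<exists>G. random_code d d' \<theta> W V n J G \<and>
     R - \<delta> < log 2 (real J) / real n \<and>
     Max ((\<lambda>ts. \<integral>C. error_prob d W J C ts \<partial>G) ` words \<theta> n) < \<epsilon> \<and>
     Max ((\<lambda>ts. \<integral>C. leakage d' V J C ts \<partial>G) ` words \<theta> n) < \<zeta>"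
  from *[rule_format, of "\<epsilon> / 3" \<delta> "\<zeta> / 2"] pos
  have "\<forall>\<^sub>F n in sequentially. \<exists>J\<ge>1. \<exists>G. random_code d d' \<theta> W V n J G \<and> R - \<delta> < log 2 (real J) / real n \<and>
     Max ((\<lambda>ts. \<integral>C. error_prob d W J C ts \<partial>G) ` words \<theta> n) < \<epsilon> / 3 \<and>
     Max ((\<lambda>ts. \<integral>C. leakage d' V J C ts \<partial>G) ` words \<theta> n) < \<zeta> / 2" by simp
  then show "\<forall>\<^sub>F n in sequentially. \<exists>J\<ge>1. \<exists>\<Gamma>. finite \<Gamma> \<and> \<Gamma> \<noteq> {} \<and> \<Gamma> \<subseteq> codes d n J \<and> R - \<delta> < log 2 (real J) / real n \<and>
     Max ((\<lambda>ts. 1 / real (card \<Gamma>) * (\<Sum>C\<in>\<Gamma>. error_prob d W J C ts)) ` words \<theta> n) < \<epsilon> \<and>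
     Max ((\<lambda>ts. 1 / real (card \<Gamma>) * (\<Sum>C\<in>\<Gamma>. leakage d' V J C ts)) ` words \<theta> n) < \<zeta>"
  proof eventually_elim
    case (elim n)
    then obtain J G where J: "J \<ge> 1" "random_code d d' \<theta> W V n J G" "R - \<delta> < log 2 (real J) / real n"
      "\<And>ts. ts \<in> words \<theta> n \<Longrightarrow> (\<integral>C. error_prob d W J C ts \<partial>G) < \<epsilon> / 3"
      "\<And>ts. ts \<in> words \<theta> n \<Longrightarrow> (\<integral>C. leakage d' V J C ts \<partial>G) < \<zeta> / 2" unfolding Max_less_words_iff by blast
    let ?B = "n * log 2 d' + 1"
    have B: "?B > 0" using dim_pos by (intro add_nonneg_pos mult_nonneg_nonneg) auto
    define \<eta> where "\<eta> = min 1 (min (\<epsilon> / 3) (\<zeta> / (2 * ?B)))"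
    have \<eta>: "0 < \<eta>" "\<eta> \<le> 1" "\<eta> \<le> \<epsilon> / 3" "\<eta> * ?B \<le> \<zeta> / 2"
    proof -
      have "0 < \<zeta> / (2 * ?B)" using pos B by simp
      then show "0 < \<eta>" "\<eta> \<le> 1" "\<eta> \<le> \<epsilon> / 3" using pos unfolding \<eta>_def by linarith+
      have "\<eta> \<le> \<zeta> / (2 * ?B)" unfolding \<eta>_def by linarith
      then have "\<eta> * ?B \<le> \<zeta> / (2 * ?B) * ?B" using B by (intro mult_right_mono) auto
      also have "\<zeta> / (2 * b) * b = \<zeta> / 2" if "b > 0" for b :: real using that by simp
      note this[OF B]
      finally show "\<eta> * ?B \<le> \<zeta> / 2" .
    qed
    \<comment> \<open>A common randomness-assisted code may contain any finite number of codes, so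
      the sample can be taken as large as the accuracy asks.\<close>
    obtain L where L: "16 * ln (2 * card \<theta> ^ n) / \<eta>\<^sup>2 < real L" using reals_Archimedean2 by blast
    have L': "16 * ln (2 * card \<theta> ^ n) \<le> \<eta>\<^sup>2 * L"
      using L \<eta>(1) by (simp add: field_simps)
    have "0 < card \<theta> ^ n" using finite_states states_nonempty by (simp add: card_gt_0_iff)
    then have "1 \<le> 2 * card \<theta> ^ n" by linarith
    then have "1 \<le> real (2 * card \<theta> ^ n)" by (metis of_nat_1 of_nat_le_iff)
    then have "0 \<le> 16 * ln (2 * card \<theta> ^ n) / \<eta>\<^sup>2" by simp
    with L have Lpos: "L > 0" by linarith
    obtain cs where cs: "length cs = L" "set cs \<subseteq> codes d n J"
      "\<And>ts. ts \<in> words \<theta> n \<Longrightarrow> (\<Sum>C\<leftarrow>cs. error_prob d W J C ts) \<le> L * ((\<integral>C. error_prob d W J C ts \<partial>G) + \<eta>)"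
      "\<And>ts. ts \<in> words \<theta> n \<Longrightarrow> (\<Sum>C\<leftarrow>cs. leakage d' V J C ts) \<le> L * ((\<integral>C. leakage d' V J C ts \<partial>G) + \<eta> * ?B)"
      using sample_codes[OF J(2,1) \<eta>(1,2) L'] by blast
    show ?case
    proof (cases "J = 1")
      case True
      define C where "C = cs ! 0"
      have "C \<in> codes d n 1" using cs(1,2) Lpos True nth_mem[of 0 cs] by (auto simp: C_def)
      then show ?thesis using J(3) True pos
        by (intro exI[of _ 1] conjI exI[of _ "{C}"]) (auto simp: Max_less_words_iff single_message[simplified])
    next
      case False
      then have J2: "J \<ge> 2" using J(1) by simp
      obtain cs' where cs': "distinct cs'" "set cs' \<subseteq> codes d n J" "list_all2 (\<lambda>C C'. fst C' = fst C \<and>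
        (\<forall>ts\<in>words \<theta> n. error_prob d W J C' ts \<le> error_prob d W J C ts + \<epsilon> / 3)) cs cs'"
        using distinct_codes[OF cs(2) J2, of "\<epsilon> / 3"] pos by auto
      have len: "length cs' = L" using list_all2_lengthD[OF cs'(3)] cs(1) by simp
      have card: "card (set cs') = L" using cs'(1) len by (simp add: distinct_card)
      have err: "1 / real L * (\<Sum>C\<in>set cs'. error_prob d W J C ts) < \<epsilon>" if ts: "ts \<in> words \<theta> n" for ts
      proof -
        have "(\<Sum>C\<in>set cs'. error_prob d W J C ts) = (\<Sum>C\<leftarrow>cs'. error_prob d W J C ts)"
          using cs'(1) by (simp add: sum_list_distinct_conv_sum_set)
        also have "\<dots> \<le> (\<Sum>C\<leftarrow>cs. error_prob d W J C ts + \<epsilon> / 3)"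
          using cs'(3) ts by (induction rule: list_all2_induct) (auto intro: add_mono)
        also have "\<dots> = (\<Sum>C\<leftarrow>cs. error_prob d W J C ts) + L * (\<epsilon> / 3)"
          using cs(1) by (simp add: sum_list_addf sum_list_triv)
        also have "\<dots> \<le> L * ((\<integral>C. error_prob d W J C ts \<partial>G) + \<eta>) + L * (\<epsilon> / 3)" using cs(3)[OF ts] by simp
        also have "\<dots> = L * ((\<integral>C. error_prob d W J C ts \<partial>G) + \<eta> + \<epsilon> / 3)" by (simp add: algebra_simps)
        also have "\<dots> < L * \<epsilon>" using J(4)[OF ts] \<eta>(3) Lpos by (intro mult_strict_left_mono) auto
        finally show ?thesis using Lpos by (simp add: field_simps)
      qed
      have leak: "1 / real L * (\<Sum>C\<in>set cs'. leakage d' V J C ts) < \<zeta>" if ts: "ts \<in> words \<theta> n" for ts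
      proof -
        have "(\<Sum>C\<in>set cs'. leakage d' V J C ts) = (\<Sum>C\<leftarrow>cs'. leakage d' V J C ts)"
          using cs'(1) by (simp add: sum_list_distinct_conv_sum_set)
        also have "\<dots> = (\<Sum>C\<leftarrow>cs. leakage d' V J C ts)"
          using cs'(3) by (induction rule: list_all2_induct) (auto simp: leakage_def)
        also have "\<dots> \<le> L * ((\<integral>C. leakage d' V J C ts \<partial>G) + \<eta> * ?B)" by (rule cs(4)[OF ts])
        also have "\<dots> < L * \<zeta>" using J(5)[OF ts] \<eta>(4) Lpos by (intro mult_strict_left_mono) auto
        finally show ?thesis using Lpos by (simp add: field_simps)
      qed
      show ?thesis
        using J(1,3) cs'(2) card Lpos len err leak
        by (intro exI[of _ J] conjI exI[of _ "set cs'"]) (auto simp: Max_less_words_iff)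
    qed
  qed
qed

end

section \<open>Concatenation with a prefix code\<close>

lemma mixture_bind:
  assumes fin: "finite (set_pmf p)" "\<And>i. i \<in> set_pmf p \<Longrightarrow> finite (set_pmf (f i))"
    and F: "\<And>i x. i \<in> set_pmf p \<Longrightarrow> x \<in> set_pmf (f i) \<Longrightarrow> F x \<in> carrier_mat d d"
  shows "mixture d (bind_pmf p f) F = mixture d p (\<lambda>i. mixture d (f i) F)"
proof (rule eq_matI)
  fix r s assume "r < dim_row (mixture d p (\<lambda>i. mixture d (f i) F))" "s < dim_col (mixture d p (\<lambda>i. mixture d (f i) F))"
  then have rs: "r < d" "s < d" by (auto simp: mixture_def)
  let ?S = "set_pmf (bind_pmf p f)"
  have finS: "finite ?S" using fin by simp
  have Fc: "F x \<in> carrier_mat d d" if "x \<in> ?S" for x using F that by auto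
  have pmf: "pmf (bind_pmf p f) x = (\<Sum>i\<in>set_pmf p. pmf p i * pmf (f i) x)" for x
    using fin(1) by (simp add: pmf_bind integral_measure_pmf_real[of "set_pmf p"] mult.commute)
  have "mixture d (bind_pmf p f) F $$ (r, s) = (\<Sum>x\<in>?S. \<Sum>i\<in>set_pmf p. of_real (pmf p i) * (of_real (pmf (f i) x) * F x $$ (r, s)))"
    using Fc rs by (subst mixture_index) (auto simp: pmf sum_distrib_right mult.assoc)
  also have "\<dots> = (\<Sum>i\<in>set_pmf p. of_real (pmf p i) * (\<Sum>x\<in>?S. of_real (pmf (f i) x) * F x $$ (r, s)))"
    by (subst sum.swap) (simp add: sum_distrib_left)
  also have "\<dots> = (\<Sum>i\<in>set_pmf p. of_real (pmf p i) * mixture d (f i) F $$ (r, s))"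
  proof (intro sum.cong refl)
    fix i assume i: "i \<in> set_pmf p"
    have "mixture d (f i) F $$ (r, s) = (\<Sum>x\<in>set_pmf (f i). of_real (pmf (f i) x) * F x $$ (r, s))"
      using F[OF i] rs by (intro mixture_index) auto
    also have "\<dots> = (\<Sum>x\<in>?S. of_real (pmf (f i) x) * F x $$ (r, s))"
      using i finS by (intro sum.mono_neutral_left) (auto simp: set_pmf_iff)
    finally show "of_real (pmf p i) * (\<Sum>x\<in>?S. of_real (pmf (f i) x) * F x $$ (r, s)) = of_real (pmf p i) * mixture d (f i) F $$ (r, s)"
      by simp
  qed
  also have "\<dots> = mixture d p (\<lambda>i. mixture d (f i) F) $$ (r, s)"
    using rs by (subst mixture_index) auto
  finally show "mixture d (bind_pmf p f) F $$ (r, s) = mixture d p (\<lambda>i. mixture d (f i) F) $$ (r, s)" .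
qed (auto simp: mixture_def)

lemma mixture_map:
  assumes h: "inj h" and F: "\<And>x. x \<in> set_pmf p \<Longrightarrow> F (h x) \<in> carrier_mat d d"
  shows "mixture d (map_pmf h p) F = mixture d p (\<lambda>x. F (h x))"
proof (rule eq_matI)
  fix r s assume "r < dim_row (mixture d p (\<lambda>x. F (h x)))" "s < dim_col (mixture d p (\<lambda>x. F (h x)))"
  then have rs: "r < d" "s < d" by (auto simp: mixture_def)
  have "mixture d (map_pmf h p) F $$ (r, s) = (\<Sum>x\<in>h ` set_pmf p. of_real (pmf (map_pmf h p) x) * F x $$ (r, s))"
    using F rs by (subst mixture_index) auto
  also have "\<dots> = (\<Sum>x\<in>set_pmf p. of_real (pmf (map_pmf h p) (h x)) * F (h x) $$ (r, s))"
    using h by (subst sum.reindex) (auto intro: inj_on_subset)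
  also have "\<dots> = mixture d p (\<lambda>x. F (h x)) $$ (r, s)"
    using F rs h by (subst mixture_index) (auto simp: pmf_map_inj')
  finally show "mixture d (map_pmf h p) F $$ (r, s) = mixture d p (\<lambda>x. F (h x)) $$ (r, s)" .
qed (auto simp: mixture_def)

lemma word_state_append:
  "length ts = length x \<Longrightarrow> word_state W (ts @ ts') (x @ x') = tensor_mat (word_state W ts x) (word_state W ts' x')"
  by (simp add: word_state_def tensor_list_append)

lemma words_append: "x \<in> words X k \<Longrightarrow> y \<in> words X m \<Longrightarrow> x @ y \<in> words X (k + m)"
  by (auto simp: words_def)

lemma words_split:
  assumes "ts \<in> words X (k + m)"
  obtains ts1 ts2 where "ts = ts1 @ ts2" "ts1 \<in> words X k" "ts2 \<in> words X m"
  using that[of "take k ts" "drop k ts"] assms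
  by (auto simp: words_def dest: in_set_takeD in_set_dropD)

text \<open>The message independent prefix \<open>xs ! i\<close> tells the receiver which of the codes \<open>cs ! i\<close> is used.\<close>

definition concat_code :: "nat \<Rightarrow> nat \<Rightarrow> nat \<Rightarrow> 'a list list \<Rightarrow> (nat \<Rightarrow> complex mat) \<Rightarrow> 'a code list \<Rightarrow> 'a code" where
  "concat_code e N J xs F cs =
     (\<lambda>j\<in>{1..J}. bind_pmf (pmf_of_set {..<N}) (\<lambda>i. map_pmf ((@) (xs ! i)) (fst (cs ! i) j)),
      \<lambda>j\<in>{1..J}. mat_sum e {..<N} (\<lambda>i. tensor_mat (F i) (snd (cs ! i) j)))"

text \<open>The index \<open>i\<close> ties together the prefix \<open>xs ! i\<close>, its detection
  operator \<open>F i\<close> and the inner code \<open>cs ! i\<close>. The codes form a list and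
  may repeat, as sampling produces them.\<close>

locale prefixed_codes = av_wiretap d d' \<theta> W V
  for d d' :: nat and \<theta> :: "'t set" and W V :: "'t \<Rightarrow> 'a::finite pmf \<Rightarrow> complex mat" +
  fixes k m N J :: nat and xs :: "'a list list" and F :: "nat \<Rightarrow> complex mat" and cs :: "'a code list"
  assumes N: "N > 0" and J: "J \<ge> 1" and xs: "xs \<in> words (words UNIV k) N"
    and F: "\<And>i. positive_semidef (d ^ k) (F i)" "mat_sum (d ^ k) {..<N} F = 1\<^sub>m (d ^ k)"
    and cs: "cs \<in> words (codes d m J) N"
begin

abbreviation "CC \<equiv> concat_code (d ^ (k + m)) N J xs F cs"

lemma set_uniform [simp]: "set_pmf (pmf_of_set {..<N}) = {..<N}"
  using N by (intro set_pmf_of_set) auto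

lemma pmf_uniform: "i < N \<Longrightarrow> pmf (pmf_of_set {..<N}) i = 1 / N"
  using N by (subst pmf_of_set) auto

lemma code_nth: "i < N \<Longrightarrow> cs ! i \<in> codes d m J" and prefix_nth: "i < N \<Longrightarrow> xs ! i \<in> words UNIV k"
  using nth_words[OF cs] nth_words[OF xs] by auto

lemma code_word: "i < N \<Longrightarrow> j \<in> {1..J} \<Longrightarrow> y \<in> set_pmf (fst (cs ! i) j) \<Longrightarrow> y \<in> words UNIV m"
  using codesD(1)[OF code_nth] by blast

lemma concat_code_in_codes: "CC \<in> codes d (k + m) J"
  unfolding codes_iff
proof (intro conjI)
  have "set_pmf (fst CC j) \<subseteq> words UNIV (k + m)" if "j \<in> {1..J}" for j
    using that code_word[OF _ that] by (auto simp: concat_code_def intro!: words_append prefix_nth)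
  then show "fst CC \<in> {1..J} \<rightarrow>\<^sub>E {P. set_pmf P \<subseteq> words UNIV (k + m)}"
    by (auto simp: concat_code_def)
  have "positive_semidef (d ^ (k + m)) (snd CC j)" if "j \<in> {1..J}" for j
    using that codesD(2)[OF code_nth that] F(1) positive_semidef_tensor[of "d ^ k" _ "d ^ m"]
    by (auto simp: concat_code_def power_add intro!: positive_semidef_mat_sum)
  then show "snd CC \<in> {1..J} \<rightarrow>\<^sub>E {A. positive_semidef (d ^ (k + m)) A}"
    by (auto simp: concat_code_def)
  show "mat_sum (d ^ (k + m)) {1..J} (snd CC) = 1\<^sub>m (d ^ (k + m))"
  proof -
    have c: "tensor_mat (F i) (snd (cs ! i) j) $$ (r, s)
       = F i $$ (r div d ^ m, s div d ^ m) * snd (cs ! i) j $$ (r mod d ^ m, s mod d ^ m)"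
      if "i < N" "j \<in> {1..J}" "r < d ^ k * d ^ m" "s < d ^ k * d ^ m" for i j r s
      using that F(1)[of i] codesD(2)[OF code_nth[OF that(1)] that(2)]
      by (intro tensor_mat_index[of _ "d ^ k" "d ^ k"]) auto
    \<comment> \<open>For fixed \<open>i\<close> the inner decoder sums to the identity over the
      messages; then the prefix operators sum to the identity over \<open>i\<close>.\<close>
    have "mat_sum (d ^ k * d ^ m) {1..J} (snd CC) = tensor_mat (mat_sum (d ^ k) {..<N} F) (1\<^sub>m (d ^ m))"
    proof (rule eq_matI)
      fix r s assume "r < dim_row (tensor_mat (mat_sum (d ^ k) {..<N} F) (1\<^sub>m (d ^ m) :: complex mat))"
        "s < dim_col (tensor_mat (mat_sum (d ^ k) {..<N} F) (1\<^sub>m (d ^ m) :: complex mat))"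
      then have rs: "r < d ^ k * d ^ m" "s < d ^ k * d ^ m" by auto
      note b = div_mod_less[OF rs(1)] div_mod_less[OF rs(2)]
      let ?F = "\<lambda>i. F i $$ (r div d ^ m, s div d ^ m)"
      have "mat_sum (d ^ k * d ^ m) {1..J} (snd CC) $$ (r, s)
        = (\<Sum>j=1..J. \<Sum>i<N. ?F i * snd (cs ! i) j $$ (r mod d ^ m, s mod d ^ m))"
        using rs c by (auto simp: mat_sum_index concat_code_def power_add intro!: sum.cong)
      also have "\<dots> = (\<Sum>i<N. ?F i * mat_sum (d ^ m) {1..J} (snd (cs ! i)) $$ (r mod d ^ m, s mod d ^ m))"
        using b by (subst sum.swap) (simp add: mat_sum_index sum_distrib_left)
      also have "\<dots> = (\<Sum>i<N. ?F i * 1\<^sub>m (d ^ m) $$ (r mod d ^ m, s mod d ^ m))"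
        using codes_sum[OF code_nth] by simp
      also have "\<dots> = tensor_mat (mat_sum (d ^ k) {..<N} F) (1\<^sub>m (d ^ m)) $$ (r, s)"
      proof -
        have "mat_sum (d ^ k) {..<N} F $$ (r div d ^ m, s div d ^ m) = (\<Sum>i<N. ?F i)"
          by (rule mat_sum_index[OF b(1,3)])
        then show ?thesis
          unfolding tensor_mat_index[OF mat_sum_carrier one_carrier_mat rs] by (simp only: sum_distrib_right)
      qed
      finally show "mat_sum (d ^ k * d ^ m) {1..J} (snd CC) $$ (r, s) = tensor_mat (mat_sum (d ^ k) {..<N} F) (1\<^sub>m (d ^ m)) $$ (r, s)" .
    qed auto
    then show ?thesis by (simp add: F(2) tensor_mat_one power_add)
  qed
qed

lemma concat_state:
  assumes U: "\<And>t. t \<in> \<theta> \<Longrightarrow> cq_channel e (U t)" and ts: "ts1 \<in> words \<theta> k" "ts2 \<in> words \<theta> m" and j: "j \<in> {1..J}"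
  shows "channel_ext e U (ts1 @ ts2) (fst CC j) = mixture (e ^ k * e ^ m) (pmf_of_set {..<N})
    (\<lambda>i. tensor_mat (word_state U ts1 (xs ! i)) (channel_ext e U ts2 (fst (cs ! i) j)))"
proof -
  let ?D = "e ^ k * e ^ m"
  note len = length_words[OF ts(1)] length_words[OF ts(2)]
  have ts12: "ts1 @ ts2 \<in> words \<theta> (k + m)" using ts by (rule words_append)
  have w: "word_state U (ts1 @ ts2) (xs ! i @ y) = tensor_mat (word_state U ts1 (xs ! i)) (word_state U ts2 y)" if "i < N" for i y
    using length_words[OF prefix_nth[OF that]] len by (intro word_state_append) simp
  have c: "word_state U (ts1 @ ts2) z \<in> carrier_mat ?D ?D" if "z \<in> words UNIV (k + m)" for z
    using density_carrier[OF word_state_density[OF U ts12]] length_words[OF that] by (simp add: power_add)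
  have y: "y \<in> words UNIV m" if "i < N" "y \<in> set_pmf (fst (cs ! i) j)" for i y
    using code_word[OF that(1) j that(2)] .
  have "channel_ext e U (ts1 @ ts2) (fst CC j) = mixture ?D (bind_pmf (pmf_of_set {..<N}) (\<lambda>i. map_pmf ((@) (xs ! i)) (fst (cs ! i) j))) (word_state U (ts1 @ ts2))"
    using j len by (simp add: channel_ext_word_state concat_code_def power_add)
  also have "\<dots> = mixture ?D (pmf_of_set {..<N}) (\<lambda>i. mixture ?D (map_pmf ((@) (xs ! i)) (fst (cs ! i) j)) (word_state U (ts1 @ ts2)))"
    using finite_set_pmf_words[OF codesD(1)[OF code_nth j]] y words_append[OF prefix_nth] c
    by (intro mixture_bind) auto
  also have "\<dots> = mixture ?D (pmf_of_set {..<N}) (\<lambda>i. tensor_mat (word_state U ts1 (xs ! i)) (channel_ext e U ts2 (fst (cs ! i) j)))"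
  proof (rule mixture_cong)
    fix i assume "i \<in> set_pmf (pmf_of_set {..<N})"
    then have i: "i < N" by simp
    have "mixture ?D (map_pmf ((@) (xs ! i)) (fst (cs ! i) j)) (word_state U (ts1 @ ts2))
      = mixture ?D (fst (cs ! i) j) (\<lambda>z. word_state U (ts1 @ ts2) (xs ! i @ z))"
      using c words_append[OF prefix_nth[OF i] y[OF i]] by (intro mixture_map) (auto simp: inj_def)
    also have "\<dots> = mixture ?D (fst (cs ! i) j) (\<lambda>z. tensor_mat (word_state U ts1 (xs ! i)) (word_state U ts2 z))"
      by (simp add: w[OF i])
    also have "\<dots> = tensor_mat (word_state U ts1 (xs ! i)) (mixture (e ^ m) (fst (cs ! i) j) (word_state U ts2))"
      using density_carrier[OF word_state_density[OF U ts(1) length_words[OF prefix_nth[OF i]]]]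
        density_carrier[OF word_state_density[OF U ts(2) length_words[OF y[OF i]]]]
      by (intro mixture_tensor_left) auto
    finally show "mixture ?D (map_pmf ((@) (xs ! i)) (fst (cs ! i) j)) (word_state U (ts1 @ ts2))
      = tensor_mat (word_state U ts1 (xs ! i)) (channel_ext e U ts2 (fst (cs ! i) j))"
      using len by (simp add: channel_ext_word_state)
  qed
  finally show ?thesis .
qed

text \<open>If \<open>i\<close> is drawn, the \<open>i\<close>-th term of the decoder succeeds with
  probability \<open>a * b\<close>, where \<open>a\<close> belongs to the prefix and
  \<open>b\<close> to the inner code; the other terms can only help. For numbers in the unit
  interval \<open>a * b\<close> is at least \<open>b - (1 - a)\<close>, so the two error
  probabilities add.\<close>

lemma concat_error:
  assumes ts: "ts1 \<in> words \<theta> k" "ts2 \<in> words \<theta> m"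
  shows "error_prob d W J CC (ts1 @ ts2) \<le> (\<Sum>C\<leftarrow>cs. error_prob d W J C ts2) / N
    + (\<Sum>i<N. 1 - Re (mat_trace (word_state W ts1 (xs ! i) * F i))) / N"
proof -
  let ?a = "\<lambda>i. Re (mat_trace (word_state W ts1 (xs ! i) * F i))"
  let ?b = "\<lambda>i j. Re (mat_trace (channel_ext d W ts2 (fst (cs ! i) j) * snd (cs ! i) j))"
  have step: "(\<Sum>i<N. ?b i j - (1 - ?a i)) / N \<le> Re (mat_trace (channel_ext d W (ts1 @ ts2) (fst CC j) * snd CC j))"
    if j: "j \<in> {1..J}" for j
  proof -
    have \<omega>: "word_state W ts1 (xs ! i) \<in> density_operators (d ^ k)" if "i < N" for i
      using word_state_density[OF channel_W ts(1) length_words[OF prefix_nth[OF that]]] .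
    have \<rho>: "channel_ext d W ts2 (fst (cs ! i) j) \<in> density_operators (d ^ m)" if "i < N" for i
      using W_ext_density[OF ts(2) code_nth[OF that] j] .
    have Dp: "positive_semidef (d ^ m) (snd (cs ! i) j)" if "i < N" for i
      using codesD(2)[OF code_nth[OF that] j] .
    let ?s = "\<lambda>i. tensor_mat (word_state W ts1 (xs ! i)) (channel_ext d W ts2 (fst (cs ! i) j))"
    let ?D = "d ^ k * d ^ m"
    have s: "?s i \<in> density_operators ?D" if "i < N" for i using density_tensor[OF \<omega>[OF that] \<rho>[OF that]] .
    have T: "positive_semidef ?D (tensor_mat (F i) (snd (cs ! i) j))" if "i < N" for i
      using positive_semidef_tensor[OF F(1) Dp[OF that]] .
    have sndj: "snd CC j = mat_sum ?D {..<N} (\<lambda>i. tensor_mat (F i) (snd (cs ! i) j))"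
      using j by (simp add: concat_code_def power_add)
    have state: "channel_ext d W (ts1 @ ts2) (fst CC j) = mixture ?D (pmf_of_set {..<N}) ?s"
      by (rule concat_state[OF channel_W ts j])
    have "mat_trace (channel_ext d W (ts1 @ ts2) (fst CC j) * snd CC j)
      = (\<Sum>i<N. of_real (pmf (pmf_of_set {..<N}) i) * mat_trace (?s i * snd CC j))"
      unfolding state using density_carrier[OF s] sndj by (subst mat_trace_mixture_mult) auto
    then have "Re (mat_trace (channel_ext d W (ts1 @ ts2) (fst CC j) * snd CC j))
      = (\<Sum>i<N. 1 / N * Re (mat_trace (?s i * snd CC j)))"
      by (auto simp: pmf_uniform intro!: sum.cong)
    also have "\<dots> \<ge> (\<Sum>i<N. 1 / N * (?b i j - (1 - ?a i)))"
    proof (intro sum_mono mult_left_mono)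
      fix i assume "i \<in> {..<N}"
      then have i: "i < N" by simp
      have a: "0 \<le> ?a i" "?a i \<le> 1" using success_bounds[OF \<omega>[OF i] F(1) F(2), of i] i by auto
      have b: "0 \<le> ?b i j" "?b i j \<le> 1"
        using success_bounds[OF \<rho>[OF i] codesD(2)[OF code_nth[OF i]] codes_sum[OF code_nth[OF i]], of j] j by auto
      have "?b i j - (1 - ?a i) \<le> ?a i * ?b i j"
        using mult_nonneg_nonneg[of "1 - ?a i" "1 - ?b i j"] a b by (simp add: algebra_simps)
      also have "\<dots> = Re (mat_trace (?s i * tensor_mat (F i) (snd (cs ! i) j)))"
      proof -
        have "mat_trace (?s i * tensor_mat (F i) (snd (cs ! i) j))
          = mat_trace (word_state W ts1 (xs ! i) * F i) * mat_trace (channel_ext d W ts2 (fst (cs ! i) j) * snd (cs ! i) j)"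
          using density_carrier[OF \<omega>[OF i]] density_carrier[OF \<rho>[OF i]] F(1)[of i] Dp[OF i]
          by (subst tensor_mat_mult[of _ "d ^ k" "d ^ k" _ "d ^ m" "d ^ m" _ "d ^ k" _ "d ^ m"])
            (auto intro!: mat_trace_tensor[of _ "d ^ k" _ "d ^ m"])
        also have "\<dots> = of_real (?a i) * of_real (?b i j)"
          using mat_trace_density_psd(1)[OF \<omega>[OF i] F(1)[of i]] mat_trace_density_psd(1)[OF \<rho>[OF i] Dp[OF i]] by simp
        finally show ?thesis by simp
      qed
      also have "\<dots> \<le> (\<Sum>i'<N. Re (mat_trace (?s i * tensor_mat (F i') (snd (cs ! i') j))))"
        using i mat_trace_density_psd(2)[OF s[OF i] T]
        by (intro member_le_sum[of i "{..<N}" "\<lambda>i'. Re (mat_trace (?s i * tensor_mat (F i') (snd (cs ! i') j)))"]) auto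
      also have "\<dots> = Re (mat_trace (?s i * snd CC j))"
        unfolding sndj using density_carrier[OF s[OF i]] T by (subst mat_trace_mult_mat_sum) auto
      finally show "?b i j - (1 - ?a i) \<le> Re (mat_trace (?s i * snd CC j))" .
    qed simp
    finally show ?thesis by (simp add: sum_divide_distrib)
  qed
  have err: "error_prob d W J (cs ! i) ts2 = 1 - (\<Sum>j=1..J. ?b i j) / J" for i
    by (simp add: error_prob_def)
  have cs_sum: "(\<Sum>C\<leftarrow>cs. error_prob d W J C ts2) = (\<Sum>i<N. 1 - (\<Sum>j=1..J. ?b i j) / J)"
    using length_words[OF cs] by (simp add: sum_list_sum_nth lessThan_atLeast0 err)
  have "(\<Sum>j=1..J. (\<Sum>i<N. ?b i j - (1 - ?a i)) / N) \<le> (\<Sum>j=1..J. Re (mat_trace (channel_ext d W (ts1 @ ts2) (fst CC j) * snd CC j)))"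
    by (intro sum_mono step)
  then have "1 / real J * (\<Sum>j=1..J. (\<Sum>i<N. ?b i j - (1 - ?a i)) / N)
      \<le> 1 / real J * (\<Sum>j=1..J. Re (mat_trace (channel_ext d W (ts1 @ ts2) (fst CC j) * snd CC j)))"
    by (intro mult_left_mono) auto
  moreover have "1 / real J * (\<Sum>j=1..J. (\<Sum>i<N. ?b i j - (1 - ?a i)) / N)
     = (\<Sum>i<N. (\<Sum>j=1..J. ?b i j) / J) / N - (\<Sum>i<N. 1 - ?a i) / N"
  proof -
    have "(\<Sum>j=1..J. \<Sum>i<N. ?b i j - (1 - ?a i)) = (\<Sum>i<N. \<Sum>j=1..J. ?b i j) - J * (\<Sum>i<N. 1 - ?a i)"
      by (subst sum.swap) (simp add: sum_subtractf sum_distrib_left[symmetric] right_diff_distrib)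
    then show ?thesis
      using J by (simp add: sum_divide_distrib[symmetric] diff_divide_distrib)
  qed
  moreover have "(\<Sum>i<N. 1 - (\<Sum>j=1..J. ?b i j) / J) / N = 1 - (\<Sum>i<N. (\<Sum>j=1..J. ?b i j) / J) / N"
    using N by (simp add: sum_subtractf diff_divide_distrib)
  ultimately show ?thesis unfolding cs_sum by (simp add: error_prob_def)
qed

lemma concat_leakage:
  assumes ts: "ts1 \<in> words \<theta> k" "ts2 \<in> words \<theta> m"
  shows "leakage d' V J CC (ts1 @ ts2) \<le> (\<Sum>C\<leftarrow>cs. leakage d' V J C ts2) / N"
proof -
  let ?Q = "pmf_of_set {1..J}"
  let ?s = "\<lambda>j i. tensor_mat (word_state V ts1 (xs ! i)) (channel_ext d' V ts2 (fst (cs ! i) j))"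
  let ?D = "d' ^ k * d' ^ m"
  have \<omega>: "word_state V ts1 (xs ! i) \<in> density_operators (d' ^ k)" if "i < N" for i
    using word_state_density[OF channel_V ts(1) length_words[OF prefix_nth[OF that]]] .
  have \<rho>: "channel_ext d' V ts2 (fst (cs ! i) j) \<in> density_operators (d' ^ m)" if "i < N" "j \<in> {1..J}" for i j
    using V_ext_density[OF ts(2) code_nth[OF that(1)] that(2)] .
  have Q: "set_pmf ?Q = {1..J}" using J by simp
  have "leakage d' V J CC (ts1 @ ts2) = holevo ?D ?Q (\<lambda>j. channel_ext d' V (ts1 @ ts2) (fst CC j))"
    using length_words[OF ts(1)] length_words[OF ts(2)] by (simp add: leakage_def power_add)
  also have "\<dots> = holevo ?D ?Q (\<lambda>j. mixture ?D (pmf_of_set {..<N}) (?s j))"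
  proof -
    have "mixture ?D ?Q (\<lambda>j. channel_ext d' V (ts1 @ ts2) (fst CC j)) = mixture ?D ?Q (\<lambda>j. mixture ?D (pmf_of_set {..<N}) (?s j))"
      using concat_state[of d' V, OF channel_V ts] Q by (intro mixture_cong) auto
    moreover have "(\<Sum>j\<in>{1..J}. pmf ?Q j * von_neumann_entropy (channel_ext d' V (ts1 @ ts2) (fst CC j)))
      = (\<Sum>j\<in>{1..J}. pmf ?Q j * von_neumann_entropy (mixture ?D (pmf_of_set {..<N}) (?s j)))"
      using concat_state[of d' V, OF channel_V ts] by (intro sum.cong refl) simp
    ultimately show ?thesis unfolding holevo_def Q by simp
  qed
  also have "\<dots> \<le> (\<Sum>i\<in>set_pmf (pmf_of_set {..<N}). pmf (pmf_of_set {..<N}) i * holevo ?D ?Q (\<lambda>j. ?s j i))"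
    using Q density_tensor[OF \<omega> \<rho>] by (intro holevo_mixture_le) auto
  also have "\<dots> = (\<Sum>i<N. 1 / N * leakage d' V J (cs ! i) ts2)"
  proof (intro sum.cong)
    fix i assume "i \<in> {..<N}"
    then have i: "i < N" by simp
    have "holevo ?D ?Q (\<lambda>j. ?s j i) = holevo (d' ^ m) ?Q (\<lambda>j. channel_ext d' V ts2 (fst (cs ! i) j))"
      using Q \<rho>[OF i] by (intro holevo_tensor \<omega>[OF i]) auto
    then show "pmf (pmf_of_set {..<N}) i * holevo ?D ?Q (\<lambda>j. ?s j i) = 1 / N * leakage d' V J (cs ! i) ts2"
      using length_words[OF ts(2)] by (simp add: leakage_def pmf_uniform[OF i])
  qed simp
  also have "\<dots> = (\<Sum>C\<leftarrow>cs. leakage d' V J C ts2) / N"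
    using length_words[OF cs] by (simp add: sum_list_sum_nth lessThan_atLeast0 sum_divide_distrib)
  finally show ?thesis .
qed

end

text \<open>The inner block has length at least \<open>n * (1 - 1 / q)\<close>, so the rate shrinks
  at most by the factor \<open>1 - 1 / q\<close>, and the choice of \<open>q\<close> keeps this loss
  within \<open>\<delta> / 2\<close>. If \<open>R - \<delta> / 2\<close> is not positive, it is
  enough that \<open>l\<close> is nonnegative.\<close>

lemma rate_after_prefix:
  fixes R \<delta> l :: real and n q :: nat
  assumes q: "q \<ge> 2" "2 * \<bar>R\<bar> / \<delta> < q" and \<delta>: "\<delta> > 0" and n: "n > 0"
    and l: "0 \<le> l" "R - \<delta> / 2 < l / real (n - n div q)"
  shows "R - \<delta> < l / real n"
proof (cases "R - \<delta> / 2 \<le> 0")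
  case True
  then have "R - \<delta> < 0" using \<delta> by simp
  also have "0 \<le> l / real n" using l by simp
  finally show ?thesis .
next
  case False
  let ?m = "n - n div q"
  have "n div q < n" using n q(1) by simp
  then have m: "?m > 0" by simp
  have "real (n div q) \<le> real n / real q" by (rule of_nat_div_le_of_nat)
  then have "real n * (1 - 1 / real q) \<le> real ?m" by (simp add: algebra_simps of_nat_diff)
  then have "(R - \<delta> / 2) * (real n * (1 - 1 / real q)) \<le> (R - \<delta> / 2) * real ?m"
    using False by (intro mult_left_mono) auto
  also have "\<dots> < l" using l(2) m by (simp add: pos_less_divide_eq)
  finally have "(R - \<delta> / 2) * (1 - 1 / real q) * real n < l" by (simp add: mult_ac)
  then have *: "(R - \<delta> / 2) * (1 - 1 / real q) < l / real n" using n by (simp add: pos_less_divide_eq)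
  have "R - \<delta> / 2 \<le> \<bar>R\<bar>" using \<delta> by simp
  then have "(R - \<delta> / 2) * (1 / real q) \<le> \<bar>R\<bar> * (1 / real q)" by (intro mult_right_mono) auto
  also have "\<dots> \<le> \<delta> / 2" using q \<delta> by (simp add: field_simps)
  finally have "(R - \<delta> / 2) * (1 / real q) \<le> \<delta> / 2" .
  moreover have "(R - \<delta> / 2) * (1 - 1 / real q) = (R - \<delta> / 2) - (R - \<delta> / 2) * (1 / real q)"
    by (simp only: right_diff_distrib mult_1_right)
  ultimately show ?thesis using * by linarith
qed

context av_wiretap
begin

lemma achievableD:
  "achievable d d' \<theta> W V R \<Longrightarrow> 0 < \<epsilon> \<Longrightarrow> 0 < \<delta> \<Longrightarrow> 0 < \<zeta> \<Longrightarrow>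
    \<forall>\<^sub>F n in sequentially. \<exists>J\<ge>1. \<exists>C\<in>codes d n J. R - \<delta> < log 2 (real J) / real n \<and>
      Max ((\<lambda>ts. error_prob d W J C ts) ` words \<theta> n) < \<epsilon> \<and> Max ((\<lambda>ts. leakage d' V J C ts) ` words \<theta> n) < \<zeta>"
  unfolding achievable_def by blast

lemma achievable_rD:
  "achievable_r d d' \<theta> W V R \<Longrightarrow> 0 < \<epsilon> \<Longrightarrow> 0 < \<delta> \<Longrightarrow> 0 < \<zeta> \<Longrightarrow>
    \<forall>\<^sub>F n in sequentially. \<exists>J\<ge>1. \<exists>G. random_code d d' \<theta> W V n J G \<and> R - \<delta> < log 2 (real J) / real n \<and>
      Max ((\<lambda>ts. \<integral>C. error_prob d W J C ts \<partial>G) ` words \<theta> n) < \<epsilon> \<and>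
      Max ((\<lambda>ts. \<integral>C. leakage d' V J C ts \<partial>G) ` words \<theta> n) < \<zeta>"
  unfolding achievable_r_def by blast

text \<open>
  A prefix of length \<open>n div q\<close> is long enough to announce one of \<open>(n div q)\<^sup>4\<close> codes of length
  \<open>n - n div q\<close>, which are enough to replace a random code; the loss of rate is at most \<open>R / q\<close>.
\<close>

lemma achievable_r_imp_achievable:
  assumes ns: "\<not> symmetrizable d \<theta> W" and R: "achievable_r d d' \<theta> W V R"
  shows "achievable d d' \<theta> W V R"
  unfolding achievable_def
proof (intro conjI allI impI)
  show "0 \<le> R" using R by (simp add: achievable_r_def)
  fix \<epsilon> \<delta> \<zeta> :: real assume pos: "\<epsilon> > 0" "\<delta> > 0" "\<zeta> > 0"
  obtain q0 where q0: "2 * \<bar>R\<bar> / \<delta> < real q0" using reals_Archimedean2 by blast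
  define q where "q = max 2 q0"
  have q: "q \<ge> 2" "2 * \<bar>R\<bar> / \<delta> < q" using q0 by (auto simp: q_def)
  define D where "D = log 2 (real d')"
  have D: "D \<ge> 0" using dim_pos by (simp add: D_def)
  define T where "T = ln (real (card \<theta>))"
  have card\<theta>: "card \<theta> > 0" using finite_states states_nonempty by (simp add: card_gt_0_iff)
  then have T: "T \<ge> 0" by (simp add: T_def)
  define c where "c = min 1 (min (\<epsilon> / 4) (\<zeta> / (4 * (q * D + 1))))"
  have qD: "q * D + 1 > 0" using D by (intro add_nonneg_pos mult_nonneg_nonneg) auto
  have "\<zeta> / (4 * (q * D + 1)) > 0" using pos qD by simp
  then have c: "0 < c" "c \<le> 1" "c \<le> \<epsilon> / 4" "c \<le> \<zeta> / (4 * (q * D + 1))"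
    using pos unfolding c_def by linarith+
  \<comment> \<open>The accuracy has to fall like \<open>1 / k\<close>, because the leakage bound
    grows with the inner block length, which is at most \<open>q * (k + 1)\<close>.\<close>
  define \<eta> where "\<eta> k = c / (real k + 2)" for k :: nat
  have \<eta>: "0 < \<eta> k" "\<eta> k \<le> 1" "\<eta> k \<le> \<epsilon> / 4" for k
  proof -
    have "\<eta> k \<le> c / 1" unfolding \<eta>_def using c by (intro divide_left_mono) auto
    then have "\<eta> k \<le> c" by simp
    then show "\<eta> k \<le> 1" "\<eta> k \<le> \<epsilon> / 4" using c by linarith+
    show "0 < \<eta> k" using c(1) by (simp add: \<eta>_def)
  qed
  have codes: "\<forall>\<^sub>F m in sequentially. \<exists>J\<ge>1. \<exists>G. random_code d d' \<theta> W V m J G \<and> R - \<delta> / 2 < log 2 (real J) / real m \<and>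
     Max ((\<lambda>ts. \<integral>C. error_prob d W J C ts \<partial>G) ` words \<theta> m) < \<epsilon> / 4 \<and>
     Max ((\<lambda>ts. \<integral>C. leakage d' V J C ts \<partial>G) ` words \<theta> m) < \<zeta> / 2"
    by (rule achievable_rD[OF R]) (use pos in auto)
  have prefix: "\<forall>\<^sub>F k in sequentially. \<exists>xs\<in>words (words (UNIV :: 'a set) k) (k ^ 4). \<exists>F.
     (\<forall>i. positive_semidef (d ^ k) (F i)) \<and> mat_sum (d ^ k) {..<k ^ 4} F = 1\<^sub>m (d ^ k) \<and>
     (\<forall>ts\<in>words \<theta> k. (\<Sum>i<k ^ 4. 1 - Re (mat_trace (word_state W ts (xs ! i) * F i))) \<le> \<epsilon> / 4 * k ^ 4)"
    using prefix_code_exists[OF finite_states states_nonempty channel_W ns, of "\<epsilon> / 4"] pos by simp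
  \<comment> \<open>The left side grows linearly and the right side quadratically. This is where the
    fourth power is used: with \<open>k ^ 3\<close> both sides would be of the same order.\<close>
  have "\<forall>\<^sub>F k in at_top. 16 * (ln 2 + real q * (k + 1) * T) \<le> (c / (k + 2))\<^sup>2 * k ^ 4"
    using c(1) by real_asymp
  then have large: "\<forall>\<^sub>F k in sequentially. 16 * (ln 2 + real q * (real k + 1) * T) \<le> (\<eta> k)\<^sup>2 * real k ^ 4"
    unfolding \<eta>_def by (rule eventually_compose_filterlim) (rule filterlim_real_sequentially)
  have k_lim: "filterlim (\<lambda>n. n div q) sequentially sequentially"
    using q(1) by (intro filterlim_at_top_div_const_nat) auto
  have m_lim: "filterlim (\<lambda>n. n - n div q) sequentially sequentially"
  proof (rule filterlim_at_top_mono)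
    show "filterlim (\<lambda>n::nat. n div 2) sequentially sequentially"
      by (intro filterlim_at_top_div_const_nat) auto
    have "n div 2 \<le> n - n div q" for n
    proof -
      have "n div q \<le> n div 2" using q(1) by (rule div_le_mono2[rotated]) simp
      then show ?thesis by linarith
    qed
    then show "\<forall>\<^sub>F n in sequentially. n div 2 \<le> n - n div q" by simp
  qed
  show "\<forall>\<^sub>F n in sequentially. \<exists>J\<ge>1. \<exists>C\<in>codes d n J. R - \<delta> < log 2 (real J) / real n \<and>
     Max ((\<lambda>ts. error_prob d W J C ts) ` words \<theta> n) < \<epsilon> \<and> Max ((\<lambda>ts. leakage d' V J C ts) ` words \<theta> n) < \<zeta>"
    using eventually_compose_filterlim[OF codes m_lim] eventually_compose_filterlim[OF prefix k_lim]
      eventually_compose_filterlim[OF large k_lim] eventually_ge_at_top[of q]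
  proof eventually_elim
    case (elim n)
    define k where "k = n div q"
    define m where "m = n - k"
    define N where "N = k ^ 4"
    have n: "n > 0" using elim(4) q(1) by simp
    have k: "k > 0" unfolding k_def using elim(4) q(1) by (simp add: div_greater_zero_iff)
    have km: "n = k + m" by (simp add: m_def k_def)
    have N: "N > 0" using k by (simp add: N_def)
    have mq: "real m \<le> real q * (real k + 1)"
    proof -
      have "n < q * (k + 1)" unfolding k_def using q(1) dividend_less_times_div[of q n] by (simp add: algebra_simps)
      then have "m \<le> q * (k + 1)" by (simp add: m_def)
      then show ?thesis by (metis of_nat_1 of_nat_add of_nat_le_iff of_nat_mult)
    qed
    obtain J G where J: "J \<ge> 1" "random_code d d' \<theta> W V m J G" "R - \<delta> / 2 < log 2 (real J) / real m"
      "\<And>ts. ts \<in> words \<theta> m \<Longrightarrow> (\<integral>C. error_prob d W J C ts \<partial>G) < \<epsilon> / 4"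
      "\<And>ts. ts \<in> words \<theta> m \<Longrightarrow> (\<integral>C. leakage d' V J C ts \<partial>G) < \<zeta> / 2"
      using elim(1) unfolding Max_less_words_iff k_def[symmetric] m_def[symmetric] by blast
    obtain xs F where xs: "xs \<in> words (words (UNIV :: 'a set) k) N" "\<And>i. positive_semidef (d ^ k) (F i)"
      "mat_sum (d ^ k) {..<N} F = 1\<^sub>m (d ^ k)"
      "\<And>ts. ts \<in> words \<theta> k \<Longrightarrow> (\<Sum>i<N. 1 - Re (mat_trace (word_state W ts (xs ! i) * F i))) \<le> \<epsilon> / 4 * N"
      using elim(2) unfolding k_def[symmetric] N_def by auto
    let ?B = "m * log 2 d' + 1"
    have B: "\<eta> k * ?B \<le> \<zeta> / 4"
    proof -
      have "?B \<le> (real k + 2) * (q * D + 1)"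
      proof -
        have "m * D \<le> real q * (real k + 1) * D" using mq D by (intro mult_right_mono) auto
        moreover have "0 \<le> real q * D" using D by simp
        ultimately show ?thesis by (simp add: D_def algebra_simps)
      qed
      then have "\<eta> k * ?B \<le> \<eta> k * ((real k + 2) * (q * D + 1))" using \<eta>(1)[of k] by (intro mult_left_mono) auto
      also have "\<dots> = c * (q * D + 1)" by (simp add: \<eta>_def)
      also have "\<dots> \<le> \<zeta> / (4 * (q * D + 1)) * (q * D + 1)" using c(4) qD by (intro mult_right_mono) auto
      also have "\<zeta> / (4 * b) * b = \<zeta> / 4" if "b > 0" for b :: real using that by simp
      note this[OF qD]
      finally show ?thesis .
    qed
    have L: "16 * ln (2 * card \<theta> ^ m) \<le> (\<eta> k)\<^sup>2 * N"
    proof -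
      have "ln (real (2 * card \<theta> ^ m)) = ln 2 + m * T"
        using card\<theta> by (simp add: ln_mult ln_realpow T_def)
      also have "\<dots> \<le> ln 2 + real q * (real k + 1) * T" using mq T by (intro add_left_mono mult_right_mono)
      finally show ?thesis using elim(3) by (simp add: k_def[symmetric] N_def)
    qed
    obtain cs where cs: "length cs = N" "set cs \<subseteq> codes d m J"
      "\<And>ts. ts \<in> words \<theta> m \<Longrightarrow> (\<Sum>C\<leftarrow>cs. error_prob d W J C ts) \<le> N * ((\<integral>C. error_prob d W J C ts \<partial>G) + \<eta> k)"
      "\<And>ts. ts \<in> words \<theta> m \<Longrightarrow> (\<Sum>C\<leftarrow>cs. leakage d' V J C ts) \<le> N * ((\<integral>C. leakage d' V J C ts \<partial>G) + \<eta> k * ?B)"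
      using sample_codes[OF J(2,1) \<eta>(1,2)[of k] L] by blast
    interpret P: prefixed_codes d d' \<theta> W V k m N J xs F cs
    proof unfold_locales
      show "cs \<in> words (codes d m J) N" using cs(1,2) by (simp add: words_def)
    qed (fact N J(1) xs(1-3))+
    have "error_prob d W J P.CC ts < \<epsilon>" if "ts \<in> words \<theta> n" for ts
    proof -
      have "ts \<in> words \<theta> (k + m)" using that by (simp only: km[symmetric])
      then obtain ts1 ts2 where ts: "ts = ts1 @ ts2" "ts1 \<in> words \<theta> k" "ts2 \<in> words \<theta> m"
        by (rule words_split)
      have "(\<Sum>C\<leftarrow>cs. error_prob d W J C ts2) / N \<le> (\<integral>C. error_prob d W J C ts2 \<partial>G) + \<eta> k"
        using cs(3)[OF ts(3)] N by (simp add: divide_le_eq mult.commute)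
      moreover have "(\<Sum>i<N. 1 - Re (mat_trace (word_state W ts1 (xs ! i) * F i))) / N \<le> \<epsilon> / 4"
        using xs(4)[OF ts(2)] N by (simp add: divide_le_eq)
      ultimately show ?thesis using P.concat_error[OF ts(2,3)] J(4)[OF ts(3)] \<eta>(3)[of k] pos unfolding ts(1) by linarith
    qed
    moreover have "leakage d' V J P.CC ts < \<zeta>" if "ts \<in> words \<theta> n" for ts
    proof -
      have "ts \<in> words \<theta> (k + m)" using that by (simp only: km[symmetric])
      then obtain ts1 ts2 where ts: "ts = ts1 @ ts2" "ts1 \<in> words \<theta> k" "ts2 \<in> words \<theta> m"
        by (rule words_split)
      have "(\<Sum>C\<leftarrow>cs. leakage d' V J C ts2) / N \<le> (\<integral>C. leakage d' V J C ts2 \<partial>G) + \<eta> k * ?B"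
        using cs(4)[OF ts(3)] N by (simp add: divide_le_eq mult.commute)
      then show ?thesis using P.concat_leakage[OF ts(2,3)] J(5)[OF ts(3)] B pos unfolding ts(1) by linarith
    qed
    moreover have "R - \<delta> < log 2 (real J) / real n"
      using J(1,3) by (intro rate_after_prefix[OF q pos(2) n]) (auto simp: m_def k_def)
    moreover have "P.CC \<in> codes d n J" using P.concat_code_in_codes by (simp add: km)
    ultimately show ?case using J(1) by (intro exI[of _ J] conjI bexI[of _ P.CC]) (auto simp: Max_less_words_iff)
  qed
qed

section \<open>Symmetrizable channels\<close>

text \<open>
  If every codeword is jammed by \<open>\<tau>\<close> applied to the codeword of another message, the receiver cannot
  tell the two messages apart.
\<close>

lemma symmetrizable_error:
  assumes sym: "symmetrizable d \<theta> W" and C: "C \<in> codes d n J" and J: "J \<ge> 2"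
  shows "\<exists>ts\<in>words \<theta> n. 1 / 4 \<le> error_prob d W J C ts"
proof -
  obtain \<tau> :: "'a \<Rightarrow> 't pmf" where \<tau>: "\<And>a. set_pmf (\<tau> a) \<subseteq> \<theta>"
    "\<And>a a'. mixture d (\<tau> a) (\<lambda>t. at_letter (W t) a') = mixture d (\<tau> a') (\<lambda>t. at_letter (W t) a)"
    using sym unfolding symmetrizable_def by blast
  let ?A = "words (UNIV :: 'a set) n" and ?E = "\<lambda>j. fst C j" and ?D = "\<lambda>j. snd C j"
  have finA: "finite ?A" and finT: "finite (words \<theta> n)" using finite_states by auto
  \<comment> \<open>The law of the state sequence when the jammer simulates the input word
    \<open>a\<close> letter by letter.\<close>
  define p where "p a ts = (\<Prod>k<n. pmf (\<tau> (a ! k)) (ts ! k))" for a :: "'a list" and ts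
  have p0: "0 \<le> p a ts" for a ts by (simp add: p_def prod_nonneg)
  have p1: "(\<Sum>ts\<in>words \<theta> n. p a ts) = 1" for a
  proof -
    have "(\<Sum>t\<in>\<theta>. pmf (\<tau> b) t) = 1" for b
      using finite_states \<tau>(1) by (rule Probability_Mass_Function.sum_pmf_eq_1)
    then show ?thesis unfolding p_def by (simp add: sum_prod_words[where f = "\<lambda>k. pmf (\<tau> (a ! k))"])
  qed
  \<comment> \<open>The average output when \<open>a'\<close> is sent while the jammer simulates
    \<open>a\<close>; symmetrizability makes it invariant under exchanging the two words.\<close>
  define \<sigma> where "\<sigma> a a' = mat_sum (d ^ n) (words \<theta> n) (\<lambda>ts. complex_of_real (p a ts) \<cdot>\<^sub>m word_state W ts a')" for a a'
  have wd: "word_state W ts a \<in> density_operators (d ^ n)" if "ts \<in> words \<theta> n" "a \<in> ?A" for ts a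
    using word_state_density[OF channel_W that(1) length_words[OF that(2)]] .
  have \<sigma>_eq: "\<sigma> a a' = tensor_list (map (\<lambda>(b, b'). mixture d (\<tau> b) (\<lambda>t. at_letter (W t) b')) (zip a a'))"
    if a: "a \<in> ?A" "a' \<in> ?A" for a a'
  proof -
    let ?F = "\<lambda>(b, b') t. complex_of_real (pmf (\<tau> b) t) \<cdot>\<^sub>m at_letter (W t) b'"
    have Fc: "?F x t \<in> carrier_mat d d" if "t \<in> \<theta>" for x t
      using density_carrier[OF cq_channel_density[OF channel_W[OF that]]] by (cases x) auto
    have scale: "tensor_list (map2 ?F (zip a a') ts) = complex_of_real (\<Prod>k<length ts. pmf (\<tau> (a ! k)) (ts ! k)) \<cdot>\<^sub>m word_state W ts a'"
      if "length a = length ts" "length a' = length ts" for a a' and ts :: "'t list"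
      using that
    proof (induction ts arbitrary: a a')
      case (Cons t ts)
      then obtain b as b' as' where ab: "a = b # as" "a' = b' # as'" by (cases a; cases a') auto
      have "tensor_mat (x \<cdot>\<^sub>m A) (y \<cdot>\<^sub>m B) = (x * y) \<cdot>\<^sub>m tensor_mat A B" for x y :: complex and A B
        by (rule eq_matI) (auto simp: tensor_mat_def div_mod_less)
      then show ?case using Cons
        by (simp add: ab word_state_def prod.lessThan_Suc_shift del: prod.lessThan_Suc)
    qed (auto simp: word_state_def intro!: eq_matI)
    have "\<sigma> a a' = mat_sum (d ^ length (zip a a')) (words \<theta> (length (zip a a'))) (\<lambda>ts. tensor_list (map2 ?F (zip a a') ts))"
      unfolding \<sigma>_def mat_sum_def p_def using a scale[of a _ a'] by (intro cong_mat) (auto simp: words_def intro!: sum.cong)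
    also have "\<dots> = tensor_list (map (\<lambda>x. mat_sum d \<theta> (?F x)) (zip a a'))"
      using Fc by (intro tensor_list_mat_sum) auto
    also have "map (\<lambda>x. mat_sum d \<theta> (?F x)) (zip a a') = map (\<lambda>(b, b'). mixture d (\<tau> b) (\<lambda>t. at_letter (W t) b')) (zip a a')"
      using mixture_eq_mat_sum[OF finite_states \<tau>(1) density_carrier[OF cq_channel_density[OF channel_W]]] by auto
    finally show ?thesis .
  qed
  have \<sigma>_sym: "\<sigma> a a' = \<sigma> a' a" if "a \<in> ?A" "a' \<in> ?A" for a a'
  proof -
    have "map (\<lambda>(b, b'). mixture d (\<tau> b) (\<lambda>t. at_letter (W t) b')) (zip a a')
      = map (\<lambda>(b, b'). mixture d (\<tau> b) (\<lambda>t. at_letter (W t) b')) (zip a' a)"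
      using \<tau>(2) length_words[OF that(1)] length_words[OF that(2)] by (intro nth_equalityI) auto
    then show ?thesis using \<sigma>_eq that by simp
  qed
  have \<sigma>_trace: "mat_trace (\<sigma> a a' * B) = (\<Sum>ts\<in>words \<theta> n. of_real (p a ts) * mat_trace (word_state W ts a' * B))"
    if a: "a' \<in> ?A" and B: "B \<in> carrier_mat (d ^ n) (d ^ n)" for a a' B
  proof -
    have c: "word_state W ts a' \<in> carrier_mat (d ^ n) (d ^ n)" if "ts \<in> words \<theta> n" for ts
      using wd[OF that a] by (rule density_carrier)
    have "mat_trace (\<sigma> a a' * B) = mat_trace (B * \<sigma> a a')"
      using B by (intro mat_trace_comm[of _ "d ^ n" "d ^ n"]) (auto simp: \<sigma>_def)
    also have "\<dots> = (\<Sum>ts\<in>words \<theta> n. mat_trace (B * (complex_of_real (p a ts) \<cdot>\<^sub>m word_state W ts a')))"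
      unfolding \<sigma>_def using B c by (intro mat_trace_mult_mat_sum) auto
    also have "\<dots> = (\<Sum>ts\<in>words \<theta> n. of_real (p a ts) * mat_trace (word_state W ts a' * B))"
    proof (intro sum.cong refl)
      fix ts assume ts: "ts \<in> words \<theta> n"
      have "mat_trace (B * (complex_of_real (p a ts) \<cdot>\<^sub>m word_state W ts a')) = of_real (p a ts) * mat_trace (B * word_state W ts a')"
        using B c[OF ts] by (simp add: mat_trace_mult[of _ "d ^ n" "d ^ n"] sum_distrib_left mult_ac)
      then show "mat_trace (B * (complex_of_real (p a ts) \<cdot>\<^sub>m word_state W ts a')) = of_real (p a ts) * mat_trace (word_state W ts a' * B)"
        using mat_trace_comm[OF B c[OF ts]] by simp
    qed
    finally show ?thesis .
  qed
  define r where "r a a' j = Re (mat_trace (\<sigma> a a' * ?D j))" for a a' j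
  have r_eq: "r a a' j = (\<Sum>ts\<in>words \<theta> n. p a ts * Re (mat_trace (word_state W ts a' * ?D j)))"
    if "a' \<in> ?A" "j \<in> {1..J}" for a a' j
    using \<sigma>_trace[OF that(1) positive_semidef_carrier[OF codesD(2)[OF C that(2)]]] by (simp add: r_def)
  have r0: "0 \<le> r a a' j" if "a' \<in> ?A" "j \<in> {1..J}" for a a' j
    unfolding r_eq[OF that] using p0 mat_trace_density_psd(2)[OF wd[OF _ that(1)] codesD(2)[OF C that(2)]]
    by (intro sum_nonneg mult_nonneg_nonneg) auto
  have r_sum: "(\<Sum>j=1..J. r a a' j) = 1" if "a' \<in> ?A" for a a'
  proof -
    have "(\<Sum>j=1..J. r a a' j) = (\<Sum>j=1..J. \<Sum>ts\<in>words \<theta> n. p a ts * Re (mat_trace (word_state W ts a' * ?D j)))"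
      using that by (intro sum.cong r_eq) auto
    also have "\<dots> = (\<Sum>ts\<in>words \<theta> n. p a ts * (\<Sum>j=1..J. Re (mat_trace (word_state W ts a' * ?D j))))"
      by (subst sum.swap) (simp add: sum_distrib_left)
    also have "\<dots> = (\<Sum>ts\<in>words \<theta> n. p a ts)"
      using sum_success[OF wd[OF _ that] codesD(2)[OF C] codes_sum[OF C]] by simp
    finally show ?thesis by (simp add: p1)
  qed
  \<comment> \<open>Both summands refer to the same output state, for which the answers
    \<open>i\<close> and \<open>j\<close> exclude each other.\<close>
  have r_pair: "r a a' i + r a' a j \<le> 1" if "a \<in> ?A" "a' \<in> ?A" "i \<in> {1..J}" "j \<in> {1..J}" "i \<noteq> j" for a a' i j
  proof -
    have "r a' a j = r a a' j" unfolding r_def using \<sigma>_sym[OF that(1,2)] by simp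
    then have "r a a' i + r a' a j = (\<Sum>l\<in>{i, j}. r a a' l)" using that by simp
    also have "\<dots> \<le> (\<Sum>l=1..J. r a a' l)" using that r0[OF that(2)] by (intro sum_mono2) auto
    finally show ?thesis using r_sum[OF that(2)] by simp
  qed
  have r_le: "r a a' j \<le> 1" if "a' \<in> ?A" "j \<in> {1..J}" for a a' j
    using member_le_sum[of j "{1..J}" "r a a'"] r0[OF that(1)] r_sum[OF that(1), of a] that(2) by auto
  define e where "e j a = pmf (?E j) a" for j a
  have e1: "(\<Sum>a\<in>?A. e j a) = 1" if "j \<in> {1..J}" for j
    unfolding e_def using finA codesD(1)[OF C that] by (rule Probability_Mass_Function.sum_pmf_eq_1)
  \<comment> \<open>The probability that message \<open>j\<close> is decoded correctly while the
    jammer simulates a random codeword of message \<open>i\<close>.\<close>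
  define s where "s i j = (\<Sum>a\<in>?A. \<Sum>a'\<in>?A. e i a * (e j a' * r a a' j))" for i j
  have s_pair: "s i j + s j i \<le> 1" if ij: "i \<in> {1..J}" "j \<in> {1..J}" "i \<noteq> j" for i j
  proof -
    have "s j i = (\<Sum>a\<in>?A. \<Sum>a'\<in>?A. e j a' * (e i a * r a' a i))" unfolding s_def by (rule sum.swap)
    then have "s i j + s j i = (\<Sum>a\<in>?A. \<Sum>a'\<in>?A. e i a * (e j a' * r a a' j) + e j a' * (e i a * r a' a i))"
      by (simp only: s_def[of i j] sum.distrib)
    also have "\<dots> = (\<Sum>a\<in>?A. \<Sum>a'\<in>?A. e i a * e j a' * (r a a' j + r a' a i))"
      by (intro sum.cong refl) (simp add: algebra_simps)
    also have "\<dots> \<le> (\<Sum>a\<in>?A. \<Sum>a'\<in>?A. e i a * e j a' * 1)"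
      using r_pair ij by (intro sum_mono mult_left_mono) (auto simp: e_def)
    also have "\<dots> = 1" using e1 ij by (simp add: sum_product[symmetric])
    finally show ?thesis .
  qed
  have s_le: "s i j \<le> 1" if ij: "i \<in> {1..J}" "j \<in> {1..J}" for i j
  proof -
    have "s i j \<le> (\<Sum>a\<in>?A. \<Sum>a'\<in>?A. e i a * (e j a' * 1))"
      unfolding s_def using r_le ij by (intro sum_mono mult_left_mono) (auto simp: e_def)
    also have "\<dots> = 1" using e1 ij by (simp add: sum_product[symmetric])
    finally show ?thesis .
  qed
  \<comment> \<open>Each of the \<open>J * (J - 1) / 2\<close> unordered pairs of different messages
    contributes at most \<open>1\<close>, and so does each of the \<open>J\<close> diagonal
    terms.\<close>
  have sum_s: "(\<Sum>i=1..J. \<Sum>j=1..J. s i j) \<le> J * (J + 1) / 2"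
  proof -
    have "2 * (\<Sum>i=1..J. \<Sum>j=1..J. s i j) = (\<Sum>i=1..J. \<Sum>j=1..J. s i j + s j i)"
    proof -
      have "(\<Sum>i=1..J. \<Sum>j=1..J. s j i) = (\<Sum>i=1..J. \<Sum>j=1..J. s i j)" by (rule sum.swap)
      then show ?thesis by (simp add: sum.distrib)
    qed
    also have "\<dots> \<le> (\<Sum>i=1..J. \<Sum>j=1..J. 1 + (if j = i then 1 else 0))"
    proof (intro sum_mono)
      fix i j assume "i \<in> {1..J}" "j \<in> {1..J}"
      then show "s i j + s j i \<le> 1 + (if j = i then 1 else 0)"
        using s_pair[of i j] s_le[of i j] s_le[of j i] by (cases "j = i") auto
    qed
    also have "\<dots> = J * (J + 1)" by (simp add: sum.distrib algebra_simps)
    finally show ?thesis by simp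
  qed
  define P where "P i ts = (\<Sum>a\<in>?A. e i a * p a ts)" for i ts
  have succ: "Re (mat_trace (channel_ext d W ts (?E j) * ?D j)) = (\<Sum>a'\<in>?A. e j a' * Re (mat_trace (word_state W ts a' * ?D j)))"
    if ts: "ts \<in> words \<theta> n" and j: "j \<in> {1..J}" for ts j
    unfolding channel_ext_word_state length_words[OF ts] e_def
    using finA codesD[OF C j] density_carrier[OF wd[OF ts]] by (subst mat_trace_mixture_mult'[of ?A]) auto
  have s_eq: "s i j = (\<Sum>ts\<in>words \<theta> n. P i ts * Re (mat_trace (channel_ext d W ts (?E j) * ?D j)))" if j: "j \<in> {1..J}" for i j
  proof -
    have "s i j = (\<Sum>a\<in>?A. \<Sum>a'\<in>?A. \<Sum>ts\<in>words \<theta> n. (e i a * p a ts) * (e j a' * Re (mat_trace (word_state W ts a' * ?D j))))"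
      unfolding s_def using r_eq[OF _ j] by (intro sum.cong refl) (simp add: sum_distrib_left mult_ac)
    also have "\<dots> = (\<Sum>a\<in>?A. \<Sum>ts\<in>words \<theta> n. \<Sum>a'\<in>?A. (e i a * p a ts) * (e j a' * Re (mat_trace (word_state W ts a' * ?D j))))"
      by (rule sum.cong[OF refl], rule sum.swap)
    also have "\<dots> = (\<Sum>ts\<in>words \<theta> n. \<Sum>a\<in>?A. \<Sum>a'\<in>?A. (e i a * p a ts) * (e j a' * Re (mat_trace (word_state W ts a' * ?D j))))"
      by (rule sum.swap)
    also have "\<dots> = (\<Sum>ts\<in>words \<theta> n. P i ts * (\<Sum>a'\<in>?A. e j a' * Re (mat_trace (word_state W ts a' * ?D j))))"
      by (simp only: P_def sum_product)
    finally show ?thesis using succ[OF _ j] by simp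
  qed
  have P0: "0 \<le> P i ts" for i ts unfolding P_def using p0 by (intro sum_nonneg mult_nonneg_nonneg) (auto simp: e_def)
  have P1: "(\<Sum>ts\<in>words \<theta> n. P i ts) = 1" if "i \<in> {1..J}" for i
    unfolding P_def by (subst sum.swap) (simp add: sum_distrib_left[symmetric] p1 e1[OF that])
  have JJ: "real J > 0" using J by simp
  \<comment> \<open>If every error were below \<open>1 / 4\<close>, the mean of \<open>s\<close>
    over all pairs of messages would exceed \<open>3 / 4\<close>. By \<open>sum_s\<close> this mean
    is at most \<open>(J + 1) / (2 * J)\<close>, which is \<open>3 / 4\<close> for two messages and
    less for more; hence the constant \<open>1 / 4\<close>.\<close>
  show ?thesis
  proof (rule ccontr)
    assume "\<not> ?thesis"
    then have lt: "error_prob d W J C ts < 1 / 4" if "ts \<in> words \<theta> n" for ts using that by (auto simp: not_le)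
    have S: "3 / 4 * J \<le> (\<Sum>j=1..J. Re (mat_trace (channel_ext d W ts (?E j) * ?D j)))" if "ts \<in> words \<theta> n" for ts
      using lt[OF that] JJ unfolding error_prob_def by (simp add: field_simps)
    have strict: "3 / 4 * J < (\<Sum>j=1..J. s i j)" if i: "i \<in> {1..J}" for i
    proof -
      have "(\<Sum>j=1..J. s i j) = (\<Sum>ts\<in>words \<theta> n. P i ts * (\<Sum>j=1..J. Re (mat_trace (channel_ext d W ts (?E j) * ?D j))))"
        using s_eq by (simp add: sum_distrib_left) (rule sum.swap)
      moreover have "(\<Sum>ts\<in>words \<theta> n. P i ts * (3 / 4 * J)) < (\<Sum>ts\<in>words \<theta> n. P i ts * (\<Sum>j=1..J. Re (mat_trace (channel_ext d W ts (?E j) * ?D j))))"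
      proof (rule sum_strict_mono_ex1[OF finT])
        show "\<forall>ts\<in>words \<theta> n. P i ts * (3 / 4 * J) \<le> P i ts * (\<Sum>j=1..J. Re (mat_trace (channel_ext d W ts (?E j) * ?D j)))"
          using S P0 by (intro ballI mult_left_mono) auto
        obtain ts where ts: "ts \<in> words \<theta> n" "P i ts \<noteq> 0" using P1[OF i] by (metis sum.neutral zero_neq_one)
        have "3 / 4 * J < (\<Sum>j=1..J. Re (mat_trace (channel_ext d W ts (?E j) * ?D j)))"
          using lt[OF ts(1)] JJ unfolding error_prob_def by (simp add: field_simps)
        then show "\<exists>ts\<in>words \<theta> n. P i ts * (3 / 4 * J) < P i ts * (\<Sum>j=1..J. Re (mat_trace (channel_ext d W ts (?E j) * ?D j)))"
          using ts P0[of i ts] by (intro bexI[of _ ts] mult_strict_left_mono) auto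
      qed
      moreover have "(\<Sum>ts\<in>words \<theta> n. P i ts * (3 / 4 * J)) = 3 / 4 * J"
        by (simp only: sum_distrib_right[symmetric] P1[OF i] mult_1)
      ultimately show ?thesis by simp
    qed
    have "(\<Sum>i=1..J. 3 / 4 * real J) < (\<Sum>i=1..J. \<Sum>j=1..J. s i j)"
      using strict J by (intro sum_strict_mono) auto
    then have "J * (3 / 4 * real J) < J * (J + 1) / 2" using sum_s by simp
    then have "real J * real J < real J * 2" by (simp add: field_simps)
    then have "real J < 2" using JJ by (simp only: mult_less_cancel_left_pos)
    then show False using J by simp
  qed
qed

text \<open>It makes the set of achievable rates nonempty; in \<open>ereal\<close> the supremum of
  the empty set would be minus infinity instead of \<open>0\<close>.\<close>

lemma achievable_0: "achievable d d' \<theta> W V 0"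
  unfolding achievable_def
proof (intro conjI allI impI order_refl)
  fix \<epsilon> \<delta> \<zeta> :: real assume pos: "\<epsilon> > 0" "\<delta> > 0" "\<zeta> > 0"
  show "\<forall>\<^sub>F n in sequentially. \<exists>J\<ge>1. \<exists>C\<in>codes d n J. 0 - \<delta> < log 2 (real J) / real n \<and>
     Max ((\<lambda>ts. error_prob d W J C ts) ` words \<theta> n) < \<epsilon> \<and> Max ((\<lambda>ts. leakage d' V J C ts) ` words \<theta> n) < \<zeta>"
  proof (rule always_eventually, rule allI)
    fix n
    define C where "C = ((\<lambda>j\<in>{1..1::nat}. return_pmf (replicate n (undefined :: 'a))), (\<lambda>j\<in>{1..1::nat}. 1\<^sub>m (d ^ n) :: complex mat))"
    have "mat_sum (d ^ n) {1..1} (snd C) = 1\<^sub>m (d ^ n)"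
      by (rule eq_matI) (auto simp: C_def mat_sum_index)
    then have C: "C \<in> codes d n 1"
      unfolding codes_iff using positive_semidef_one by (auto simp: C_def words_def)
    then show "\<exists>J\<ge>1. \<exists>C\<in>codes d n J. 0 - \<delta> < log 2 (real J) / real n \<and>
     Max ((\<lambda>ts. error_prob d W J C ts) ` words \<theta> n) < \<epsilon> \<and> Max ((\<lambda>ts. leakage d' V J C ts) ` words \<theta> n) < \<zeta>"
      using pos single_message[OF C] by (intro exI[of _ 1] conjI bexI[OF _ C]) (auto simp: Max_less_words_iff)
  qed
qed

text \<open>A positive rate forces at least two messages, and then a single block length already
  contradicts an error below \<open>1 / 4\<close>.\<close>

lemma symmetrizable_achievable:
  assumes sym: "symmetrizable d \<theta> W" and R: "achievable d d' \<theta> W V R"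
  shows "R = 0"
proof (rule ccontr)
  assume "R \<noteq> 0"
  then have pos: "R > 0" using R by (simp add: achievable_def)
  have "\<forall>\<^sub>F n in sequentially. \<exists>J\<ge>1. \<exists>C\<in>codes d n J. R - R / 2 < log 2 (real J) / real n \<and>
     Max ((\<lambda>ts. error_prob d W J C ts) ` words \<theta> n) < 1 / 4 \<and> Max ((\<lambda>ts. leakage d' V J C ts) ` words \<theta> n) < 1"
    by (rule achievableD[OF R]) (use pos in auto)
  then obtain n J C where n: "J \<ge> 1" "C \<in> codes d n J" "R - R / 2 < log 2 (real J) / real n"
    "\<And>ts. ts \<in> words \<theta> n \<Longrightarrow> error_prob d W J C ts < 1 / 4"
    unfolding Max_less_words_iff eventually_sequentially by blast
  have "J \<noteq> 1" using n(3) pos by auto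
  then have "J \<ge> 2" using n(1) by simp
  from symmetrizable_error[OF sym n(2) this] n(4) show False by force
qed

end

theorem theorem3p1:
  fixes d d' T :: nat
    and W V :: "nat \<Rightarrow> 'a::finite pmf \<Rightarrow> complex mat"
  assumes "T \<ge> 1"
    and "av_wiretap_channel d d' {1..T} W V"
  shows "(\<not> symmetrizable d {1..T} W \<longrightarrow>
            secrecy_capacity d d' {1..T} W V = secrecy_capacity_r d d' {1..T} W V) \<and>
         (symmetrizable d {1..T} W \<longrightarrow> secrecy_capacity d d' {1..T} W V = 0) \<and>
         secrecy_capacity_cr d d' {1..T} W V = secrecy_capacity_r d d' {1..T} W V"
proof -
  interpret av_wiretap d d' "{1..T}" W V
    using assms by unfold_locales auto
  have cr: "achievable_cr d d' {1..T} W V = achievable_r d d' {1..T} W V"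
    using achievable_cr_imp_r achievable_r_imp_cr by blast
  \<comment> \<open>One inclusion always holds, because a deterministic code is a family with one
    member; nonsymmetrizability is needed for the other.\<close>
  have ns: "achievable d d' {1..T} W V = achievable_r d d' {1..T} W V" if "\<not> symmetrizable d {1..T} W"
    using achievable_r_imp_achievable[OF that] achievable_imp_cr achievable_cr_imp_r by blast
  have sym: "{R. achievable d d' {1..T} W V R} = {0}" if "symmetrizable d {1..T} W"
    using symmetrizable_achievable[OF that] achievable_0 by auto
  show ?thesis
    unfolding secrecy_capacity_def secrecy_capacity_r_def secrecy_capacity_cr_def
    using ns sym unfolding cr by (auto simp del: One_nat_def simp flip: zero_ereal_def)
qed

end
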